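(* For all $\varepsilon\in(0,1)$ there exists $\nu>0$ such that for any vector field $k=(k_1,k_2)\in\mathcal{B}_{0,4+\varepsilon}$ on $\mathbb{R}^2$ satisfying $$\|k;\mathcal{B}_{0,4+\varepsilon}\|\le\nu,\qquad \int_{\mathbb{R}^2}k=0,$$ there exists $a=(a_1,a_2,a_3)\in\mathbb{R}^3$ such that there exist $u$ and $p$ satisfying $$\Delta u-\nabla p-u\cdot\nabla u=f,\qquad \nabla\cdot u=0\quad\text{in }\mathbb{R}^2,\qquad \lim_{|x|\to\infty}u=0,$$ with $$f(x)=k(x)+\frac{e^{-|x|^2}}{\pi}\bigl[a_1(x_1,-x_2)+a_2(x_2,x_1)+a_3(-x_2,x_1)\bigr].$$ Moreover, there exists $A=(A_1,A_2,A_3,A_4)\in\mathbb{R}^4$ such that, as $r=|x|\to\infty$, $$\begin{aligned}u&=\frac{A_1}{4\pi r^2}\bigl(\cos(2\theta),\sin(2\theta)\bigr)+\frac{A_2}{4\pi r^2}\bigl(\sin(2\theta),-\cos(2\theta)\bigr)\\&\quad+\frac{A_3}{4\pi r^2}\bigl(\cos(2\theta)+\cos(4\theta),\sin(4\theta)\bigr)+\frac{A_4}{4\pi r^2}\bigl(\sin(2\theta)+\sin(4\theta),-\cos(4\theta)\bigr)+O(r^{-2-\varepsilon}).\end{aligned}$$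
   Context: $(r,\theta)$ are polar coordinates in $\mathbb{R}^2$. For $q\ge0$ let $w_q(x)=1+|x|^q$ if $q>0$ and $w_0(x)=[\log(2+|x|)]^{-1}$. For $k\in\mathbb{N}$, $\mathcal{B}_{k,q}$ is the Banach space of (scalar or, componentwise, vector valued) functions $g\in C^k(\mathbb{R}^2)$ with $w_{q+|\alpha|}D^\alpha g\in L^\infty(\mathbb{R}^2)$ for all multi-indices $|\alpha|\le k$, with norm $\|g;\mathcal{B}_{k,q}\|=\max_{|\alpha|\le k}\sup_{x}w_{q+|\alpha|}(x)|D^\alpha g(x)|$. Since $k$ is only continuous, the equations are understood in the sense of distributions with $u\in C^1(\mathbb{R}^2)$ and $p\in C^0(\mathbb{R}^2)$. *)

theory Defs
  imports "HOL-Analysis.Analysis" "HOL-Library.Landau_Symbols"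
begin

section \<open>Partial derivatives and functions of class \<open>C\<^sup>k\<close> on the plane\<close>

definition partial_deriv :: "2 \<Rightarrow> (real^2 \<Rightarrow> 'b::real_normed_vector) \<Rightarrow> real^2 \<Rightarrow> 'b" where
  "partial_deriv i f x = frechet_derivative f (at x) (axis i 1)"

primrec Ck :: "nat \<Rightarrow> (real^2 \<Rightarrow> 'b::real_normed_vector) \<Rightarrow> bool" where
  "Ck 0 f \<longleftrightarrow> continuous_on UNIV f"
| "Ck (Suc k) f \<longleftrightarrow> f differentiable_on UNIV \<and> (\<forall>i. Ck k (partial_deriv i f))"

type_synonym multi_index = "nat \<times> nat"

definition mi_length :: "multi_index \<Rightarrow> nat" where
  "mi_length \<alpha> = fst \<alpha> + snd \<alpha>"

definition mi_deriv :: "multi_index \<Rightarrow> (real^2 \<Rightarrow> 'b::real_normed_vector) \<Rightarrow> real^2 \<Rightarrow> 'b" where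
  "mi_deriv \<alpha> f = (partial_deriv 1 ^^ fst \<alpha>) ((partial_deriv 2 ^^ snd \<alpha>) f)"


section \<open>The weighted spaces \<open>B\<^bsub>k,q\<^esub>\<close>\<close>

definition weight :: "real \<Rightarrow> real^2 \<Rightarrow> real" where
  "weight q x = (if q = 0 then inverse (ln (2 + norm x)) else 1 + norm x powr q)"

text \<open>
  The functions \<open>weight (q + |\<alpha>|) x *\<^sub>R mi_deriv \<alpha> g x\<close> are continuous, so being
  in \<open>L\<^sup>\<infinity>\<close> means being bounded. For vector valued \<open>g\<close> the boundedness condition is
  equivalent to the componentwise one, and the norm uses the Euclidean length of the values.
\<close>

definition B_space :: "nat \<Rightarrow> real \<Rightarrow> (real^2 \<Rightarrow> 'b::real_normed_vector) set" where
  "B_space k q = {g. Ck k g \<and>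
     (\<forall>\<alpha>. mi_length \<alpha> \<le> k \<longrightarrow>
        bounded (range (\<lambda>x. weight (q + real (mi_length \<alpha>)) x *\<^sub>R mi_deriv \<alpha> g x)))}"

definition B_norm :: "nat \<Rightarrow> real \<Rightarrow> (real^2 \<Rightarrow> 'b::real_normed_vector) \<Rightarrow> real" where
  "B_norm k q g =
     Max ((\<lambda>\<alpha>. SUP x. weight (q + real (mi_length \<alpha>)) x * norm (mi_deriv \<alpha> g x))
          ` {\<alpha>. mi_length \<alpha> \<le> k})"


section \<open>Distributions and the stationary Navier--Stokes equations\<close>

definition test_function :: "(real^2 \<Rightarrow> real) \<Rightarrow> bool" where
  "test_function \<phi> \<longleftrightarrow> (\<forall>k. Ck k \<phi>) \<and> compact (closure {x. \<phi> x \<noteq> 0})"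

text \<open>
  Distributions are represented by their action on functions; only the values on test functions
  are meaningful. All functions turned into distributions below are continuous.
\<close>

type_synonym distr = "(real^2 \<Rightarrow> real) \<Rightarrow> real"

definition distr_of :: "(real^2 \<Rightarrow> real) \<Rightarrow> distr" where
  "distr_of g \<phi> = (LINT x|lborel. g x * \<phi> x)"

definition distr_deriv :: "2 \<Rightarrow> distr \<Rightarrow> distr" where
  "distr_deriv i T \<phi> = - T (partial_deriv i \<phi>)"

definition convection :: "(real^2 \<Rightarrow> real^2) \<Rightarrow> real^2 \<Rightarrow> real^2" where
  "convection u x = (\<Sum>j\<in>UNIV. u x $ j *\<^sub>R partial_deriv j u x)"

definition stationary_NS ::
  "(real^2 \<Rightarrow> real^2) \<Rightarrow> (real^2 \<Rightarrow> real) \<Rightarrow> (real^2 \<Rightarrow> real^2) \<Rightarrow> bool" where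
  "stationary_NS u p f \<longleftrightarrow> (\<forall>\<phi>. test_function \<phi> \<longrightarrow>
     (\<forall>i. (\<Sum>j\<in>UNIV. distr_deriv j (distr_deriv j (distr_of (\<lambda>x. u x $ i))) \<phi>)
            - distr_deriv i (distr_of p) \<phi>
            - distr_of (\<lambda>x. convection u x $ i) \<phi>
          = distr_of (\<lambda>x. f x $ i) \<phi>) \<and>
     (\<Sum>j\<in>UNIV. distr_deriv j (distr_of (\<lambda>x. u x $ j)) \<phi>) = 0)"


section \<open>The force correction and the asymptotic profile\<close>

definition corrected_force :: "(real^2 \<Rightarrow> real^2) \<Rightarrow> real^3 \<Rightarrow> real^2 \<Rightarrow> real^2" where
  "corrected_force k a x = k x + (exp (- (norm x)\<^sup>2) / pi) *\<^sub>R
     (a$1 *\<^sub>R vector [x$1, - x$2] + a$2 *\<^sub>R vector [x$2, x$1] + a$3 *\<^sub>R vector [- x$2, x$1])"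

definition polar_angle :: "real^2 \<Rightarrow> real" where
  "polar_angle x = Arg (Complex (x$1) (x$2))"

definition asymptotic_profile :: "real^4 \<Rightarrow> real^2 \<Rightarrow> real^2" where
  "asymptotic_profile A x = (let r = norm x; \<theta> = polar_angle x in
       (A$1 / (4 * pi * r\<^sup>2)) *\<^sub>R vector [cos (2*\<theta>), sin (2*\<theta>)]
     + (A$2 / (4 * pi * r\<^sup>2)) *\<^sub>R vector [sin (2*\<theta>), - cos (2*\<theta>)]
     + (A$3 / (4 * pi * r\<^sup>2)) *\<^sub>R vector [cos (2*\<theta>) + cos (4*\<theta>), sin (4*\<theta>)]
     + (A$4 / (4 * pi * r\<^sup>2)) *\<^sub>R vector [sin (2*\<theta>) + sin (4*\<theta>), - cos (4*\<theta>)])"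

end

theory Submission imports Defs
begin

text \<open>
  Write the plane as the complex plane, a vector field as \<open>u1 + \<i> u2\<close>. With the Wirtinger derivatives
  \<open>d\<close> and \<open>dbar\<close> the Stokes system with force \<open>F\<close> reads \<open>dbar (4 d u - 2 p) = F\<close>,
  \<open>Re (d u) = 0\<close>. Hence \<open>H = 4 d u - 2 p\<close> is the Cauchy transform of \<open>F\<close>, \<open>p = - Re H / 2\<close>,
  \<open>d u = (H - cnj H) / 8\<close>, and \<open>u\<close> is the convolution of \<open>F\<close> with an explicit kernel built from
  \<open>ln (|z|^2)\<close> and \<open>z / cnj z\<close>. The Taylor remainders of this kernel have closed forms; together with the
  bound \<open>\<integral> |y - p|^(-\<gamma>) / |y - q| dy \<le> C |p - q|^(1 - \<gamma>)\<close> they give differentiability of \<open>u\<close>,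
  its decay and its far field.

  The terms of order \<open>1/r\<close> vanish if \<open>\<integral> F = 0\<close>, \<open>\<integral> z F = 0\<close> and \<open>Im (\<integral> cnj z F) = 0\<close>.
  The last two are three real conditions, which the three Gaussian fields can enforce. Then \<open>u\<close> and its gradient
  decay so fast that \<open>u \<cdot> \<nabla>u\<close> again belongs to the class of admissible forces. The solution is obtained from
  Banach's fixed point theorem for the force \<open>F = k + u \<cdot> \<nabla>u\<close>, where \<open>u\<close> solves the Stokes system for
  the corrected \<open>F\<close>; no mean value has to be corrected at the fixed point, since \<open>u \<cdot> \<nabla>u\<close> has mean zero.
\<close>


section \<open>Singular integrals in the plane\<close>

text \<open>Every Taylor remainder of the kernels is bounded by a single quotient
  \<open>|w|^n / (|z|^m |z - w|)\<close>, valid for all \<open>z\<close> and \<open>w\<close> off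
  the singular points. Such a bound needs no splitting into near and far regions, and its integral
  against a decaying density reduces to one two-point Riesz integral. So the same estimates serve
  regularity (\<open>z = x - y\<close>, \<open>w\<close> a small increment) and decay
  (\<open>z = x\<close>, \<open>w = y\<close>). The decay rates are chosen to close the iteration
  rather than to be optimal: for forces of order \<open>q = 4 + \<epsilon>\<close> the velocity gets
  the exponent \<open>(q - 1) / 2\<close> and its gradient \<open>(q + 1) / 2\<close>. These add up
  to exactly \<open>q\<close>, so the convection term returns to the class. The Riesz exponent has
  to lie between 1 and 2, which becomes \<open>q < 5\<close>. All bounds are linear in the size
  \<open>M\<close> of the density. This turns the estimate of the convection term into a bilinear
  one, from which self-mapping and contraction both follow. The fixed point map also removes the
  mean of each density to which it is applied: intermediate densities need not have mean zero, and
  without that their velocities would not decay.\<close>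

lemma nn_integral_affine:
  fixes f :: "'a::euclidean_space \<Rightarrow> ennreal"
  assumes [measurable]: "f \<in> borel_measurable borel" and c: "c \<noteq> 0"
  shows "(\<integral>\<^sup>+x. f x \<partial>lborel) = ennreal (\<bar>c\<bar> ^ DIM('a)) * (\<integral>\<^sup>+x. f (t + c *\<^sub>R x) \<partial>lborel)"
  by (subst lborel_affine[OF c, of t])
     (simp add: nn_integral_density nn_integral_distr nn_integral_cmult)

lemma nn_integral_shift:
  fixes f :: "'a::euclidean_space \<Rightarrow> ennreal"
  assumes [measurable]: "f \<in> borel_measurable borel"
  shows "(\<integral>\<^sup>+x. f (x - t) \<partial>lborel) = (\<integral>\<^sup>+x. f x \<partial>lborel)"
    and "(\<integral>\<^sup>+x. f (t - x) \<partial>lborel) = (\<integral>\<^sup>+x. f x \<partial>lborel)"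
  using nn_integral_affine[OF assms, of 1 "-t"]
    nn_integral_affine[OF assms, of "-1" t]
  by (simp_all add: add.commute)

text \<open>A radial majorant with independent exponents at the origin and at infinity; in the plane
  it is integrable for \<open>0 < a < 2 < b\<close>.\<close>

definition ppow :: "real \<Rightarrow> real \<Rightarrow> real \<Rightarrow> real" where
  "ppow a b t = (if t < 1 then t powr (-a) else t powr (-b))"

lemma ppow_nonneg: "0 \<le> ppow a b t" by (simp add: ppow_def)

lemma ppow_measurable[measurable]: "ppow a b \<in> borel_measurable borel"
  unfolding ppow_def by measurable

lemma nn_integral_ppow_real:
  assumes "a < 1" "1 < b" "0 < a"
  shows "(\<integral>\<^sup>+t. ennreal (ppow a b \<bar>t\<bar>) \<partial>lborel) < \<infinity>"
proof -
  let ?g = "\<lambda>t. ennreal (ppow a b t) * indicator {0..} t"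
  have 1: "(\<integral>\<^sup>+t. ennreal (t powr (-a)) * indicator {0..1} t \<partial>lborel) < \<infinity>"
  proof -
    have "((\<lambda>t::real. t powr (-a)) has_integral (1 powr (-a+1) / (-a+1))) {0..1}"
      by (rule has_integral_powr_from_0) (use assms in auto)
    then have "(\<integral>\<^sup>+t. ennreal (t powr (-a)) * indicator {0..1} t \<partial>lborel) = ennreal (1 powr (-a+1) / (-a+1))"
      by (intro nn_integral_has_integral_lebesgue' ) auto
    then show ?thesis by simp
  qed
  have 2: "(\<integral>\<^sup>+t. ennreal (t powr (-b)) * indicator {1..} t \<partial>lborel) < \<infinity>"
  proof -
    have "((\<lambda>t::real. t powr (-b)) has_integral (-(1 powr (-b+1)) / (-b+1))) {1..}"
      by (rule has_integral_powr_to_inf) (use assms in auto)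
    then have "(\<integral>\<^sup>+t. ennreal (t powr (-b)) * indicator {1..} t \<partial>lborel) = ennreal (-(1 powr (-b+1)) / (-b+1))"
      by (intro nn_integral_has_integral_lebesgue') auto
    then show ?thesis by simp
  qed
  have "(\<integral>\<^sup>+t. ?g t \<partial>lborel) \<le> (\<integral>\<^sup>+t. ennreal (t powr (-a)) * indicator {0..1} t + ennreal (t powr (-b)) * indicator {1..} t \<partial>lborel)"
    by (intro nn_integral_mono) (auto simp: ppow_def indicator_def)
  also have "\<dots> < \<infinity>" using 1 2 by (simp add: nn_integral_add less_top)
  finally have g: "(\<integral>\<^sup>+t. ?g t \<partial>lborel) < \<infinity>" .
  have "(\<integral>\<^sup>+t. ennreal (ppow a b \<bar>t\<bar>) \<partial>lborel) \<le> (\<integral>\<^sup>+t. ?g t + ?g (0 - t) \<partial>lborel)"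
    by (intro nn_integral_mono) (auto simp: indicator_def)
  also have "\<dots> = (\<integral>\<^sup>+t. ?g t \<partial>lborel) + (\<integral>\<^sup>+t. ?g (0 - t) \<partial>lborel)"
    by (rule nn_integral_add) auto
  also have "\<dots> < \<infinity>" using g by (subst nn_integral_shift(2)) (auto simp: less_top)
  finally show ?thesis .
qed

lemma prod_UNIV_2: "(\<Prod>b\<in>(Basis::(real^2) set). f (x \<bullet> b)) = f (x$1) * f (x$2)"
proof -
  have eq: "(Basis::(real^2) set) = {axis 1 1, axis 2 1}"
    by (auto simp: Basis_vec_def exhaust_2) (metis exhaust_2)+
  have "axis 1 (1::real) \<noteq> (axis 2 1 :: real^2)" by (simp add: axis_eq_axis)
  then show ?thesis unfolding eq by (simp add: inner_axis)
qed

lemma nn_integral_plane_prod: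
  fixes f :: "real \<Rightarrow> ennreal"
  assumes [measurable]: "f \<in> borel_measurable borel"
  shows "(\<integral>\<^sup>+x. f (x$1) * f (x$2) \<partial>(lborel :: (real^2) measure)) = (\<integral>\<^sup>+t. f t \<partial>lborel)^2"
  using nn_integral_lborel_prod[where 'a="real^2", of "\<lambda>_. f"]
  by (simp add: prod_UNIV_2 DIM_cart)

lemma norm_plane: "norm (x::real^2) = sqrt ((x$1)^2 + (x$2)^2)"
  by (simp add: norm_vec_def L2_set_def sum_2)

text \<open>Polar coordinates are avoided: the radial function is dominated by a sum of two products
  of one-variable functions. Near the origin \<open>|x1| |x2| <= |x|^2\<close> splits the power
  evenly between the coordinates; far away \<open>|x|^(-b/2)\<close> is at most \<open>g\<close> of
  either coordinate.\<close>

lemma nn_integral_ppow: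
  assumes "a < 2" "2 < b" "0 < a"
  shows "(\<integral>\<^sup>+x. ennreal (ppow a b (norm x)) \<partial>(lborel :: (real^2) measure)) < \<infinity>"
proof -
  \<comment> \<open>The value infinity at \<open>0\<close> keeps the bound true on the coordinate
    axes, where HOL evaluates a negative power of \<open>0\<close> to \<open>0\<close>. The
    exponents \<open>2\<close> here and \<open>1/2\<close> in \<open>g\<close> only have to lie on
    the integrable side of 1.\<close>
  define n where "n t = (if t = 0 then \<infinity> else ennreal (ppow (a/2) 2 \<bar>t\<bar>))" for t :: real
  define g where "g t = ennreal (ppow (1/2) (b/2) \<bar>t\<bar>) + indicator {-1..1} t" for t :: real
  have [measurable]: "n \<in> borel_measurable borel" "g \<in> borel_measurable borel"
    unfolding n_def g_def by measurable
  have "(\<integral>\<^sup>+t. n t \<partial>lborel) = (\<integral>\<^sup>+t. ennreal (ppow (a/2) 2 \<bar>t\<bar>) \<partial>lborel)"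
    by (rule nn_integral_cong_AE) (use AE_lborel_singleton[of 0] in \<open>auto simp: n_def\<close>)
  also have "\<dots> < \<infinity>" by (rule nn_integral_ppow_real) (use assms in auto)
  finally have n: "(\<integral>\<^sup>+t. n t \<partial>lborel) < \<infinity>" .
  have g: "(\<integral>\<^sup>+t. g t \<partial>lborel) < \<infinity>"
    using nn_integral_ppow_real[of "1/2" "b/2"] assms
    by (simp add: g_def nn_integral_add less_top)
  have "ennreal (ppow a b (norm x)) \<le> n (x$1) * n (x$2) + g (x$1) * g (x$2)" for x :: "real^2"
  proof (cases "norm x < 1")
    case True
    have c: "\<bar>x$1\<bar> < 1" "\<bar>x$2\<bar> < 1" using component_le_norm_cart[of x] True by (meson le_less_trans)+
    have n0: "n (x$i) \<noteq> 0" for i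
      using c exhaust_2[of i] by (auto simp: n_def ppow_def)
    show ?thesis
    proof (cases "x$1 = 0 \<or> x$2 = 0")
      case True
      then have "n (x$1) * n (x$2) = \<infinity>" using n0 by (auto simp: n_def ennreal_mult_eq_top_iff split: if_splits)
      then show ?thesis by simp
    next
      case False
      have 2: "\<bar>x$1\<bar> * \<bar>x$2\<bar> \<le> norm x * norm x"
        using component_le_norm_cart[of x] by (intro mult_mono) auto
      have "norm x powr (-a) = (norm x * norm x) powr (-a/2)"
        by (simp add: powr_mult flip: powr_add)
      also have "\<dots> \<le> (\<bar>x$1\<bar> * \<bar>x$2\<bar>) powr (-a/2)"
        using 2 False assms by (intro powr_mono2') auto
      also have "\<dots> = \<bar>x$1\<bar> powr (-a/2) * \<bar>x$2\<bar> powr (-a/2)" by (simp add: powr_mult)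
      finally have "ennreal (norm x powr (-a)) \<le> n (x$1) * n (x$2)"
        using False c by (auto simp: n_def ppow_def simp flip: ennreal_mult)
      then show ?thesis using True by (auto simp: ppow_def add_increasing2)
    qed
  next
    case False
    have g1: "ennreal (norm x powr (-b/2)) \<le> g (x$i)" for i
    proof (cases "\<bar>x$i\<bar> \<le> 1")
      case True
      have "norm x powr (-b/2) \<le> 1 powr (-b/2)" using False assms by (intro powr_mono2') auto
      then have "ennreal (norm x powr (-b/2)) \<le> indicator {-1..1} (x$i)" using True
        by (auto simp: indicator_def)
      then show ?thesis by (auto simp: g_def add_increasing)
    next
      case False
      have "norm x powr (-b/2) \<le> \<bar>x$i\<bar> powr (-b/2)"
        using False assms component_le_norm_cart[of x i] by (intro powr_mono2') auto
      then show ?thesis using False by (auto simp: g_def ppow_def add_increasing2)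
    qed
    have "ennreal (norm x powr (-b)) = ennreal (norm x powr (-b/2)) * ennreal (norm x powr (-b/2))"
      by (simp flip: ennreal_mult powr_add)
    also have "\<dots> \<le> g (x$1) * g (x$2)" by (intro mult_mono g1) auto
    finally show ?thesis using False by (auto simp: ppow_def add_increasing)
  qed
  then have "(\<integral>\<^sup>+x. ennreal (ppow a b (norm x)) \<partial>(lborel :: (real^2) measure))
     \<le> (\<integral>\<^sup>+x. n (x$1) * n (x$2) + g (x$1) * g (x$2) \<partial>(lborel :: (real^2) measure))"
    by (rule nn_integral_mono)
  also have "\<dots> = (\<integral>\<^sup>+t. n t \<partial>lborel)^2 + (\<integral>\<^sup>+t. g t \<partial>lborel)^2"
    by (subst nn_integral_add) (auto simp: nn_integral_plane_prod)
  also have "\<dots> < \<infinity>" using n g by (simp add: power2_eq_square ennreal_mult_less_top)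
  finally show ?thesis .
qed

text \<open>Three regions: near \<open>0\<close> and near \<open>e\<close> the other factor is
  bounded, and elsewhere \<open>|z| <= 3 |z - e|\<close> merges both factors into a power of order
  \<open>\<gamma> + 1 > 2\<close>, which is integrable at infinity.\<close>

lemma riesz_bound_unit:
  assumes "1 < \<gamma>" "\<gamma> < 2"
  shows "\<exists>C\<ge>0. \<forall>e::real^2. norm e = 1 \<longrightarrow>
    (\<integral>\<^sup>+z. ennreal (norm z powr (-\<gamma>) / norm (z - e)) \<partial>lborel) \<le> ennreal C"
proof -
  obtain A where A: "(\<integral>\<^sup>+x. ennreal (ppow \<gamma> (\<gamma>+1) (norm x)) \<partial>(lborel :: (real^2) measure)) = ennreal A" "A \<ge> 0"
    using nn_integral_ppow[of \<gamma> "\<gamma>+1"] assms by (auto simp: less_top_ennreal)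
  obtain B where B: "(\<integral>\<^sup>+x. ennreal (ppow 1 3 (norm x)) \<partial>(lborel :: (real^2) measure)) = ennreal B" "B \<ge> 0"
    using nn_integral_ppow[of 1 3] assms by (auto simp: less_top_ennreal)
  have "(\<integral>\<^sup>+z. ennreal (norm z powr (-\<gamma>) / norm (z - e)) \<partial>lborel) \<le> ennreal (6 * A + 4 * B)"
    if e: "norm e = 1" for e :: "real^2"
  proof -
    have pw: "norm z powr (-\<gamma>) / norm (z - e) \<le> 6 * ppow \<gamma> (\<gamma>+1) (norm z) + 4 * ppow 1 3 (norm (z - e))" for z
    proof -
      consider "norm z < 1/2" | "norm (z - e) < 1/2" "norm z \<ge> 1/2" | "norm (z - e) \<ge> 1/2" "norm z \<ge> 1/2"
        by linarith
      then show ?thesis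
      proof cases
        case 1
        have "norm (z - e) \<ge> 1/2" using 1 e norm_triangle_ineq2[of e z] by (simp add: norm_minus_commute)
        then have "norm z powr (-\<gamma>) / norm (z - e) \<le> norm z powr (-\<gamma>) / (1/2)"
          by (intro divide_left_mono) auto
        also have "\<dots> \<le> 6 * ppow \<gamma> (\<gamma>+1) (norm z)" using 1 by (simp add: ppow_def)
        finally show ?thesis using ppow_nonneg[of 1 3 "norm (z-e)"] by linarith
      next
        case 2
        have "norm z powr (-\<gamma>) \<le> (1/2) powr (-\<gamma>)" using 2 assms by (intro powr_mono2') auto
        also have "\<dots> = 2 powr \<gamma>" by (simp add: powr_minus powr_divide)
        also have "\<dots> \<le> 2 powr 2" using assms by (intro powr_mono) auto
        finally have "norm z powr (-\<gamma>) \<le> 4" by simp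
        then have "norm z powr (-\<gamma>) / norm (z - e) \<le> 4 / norm (z - e)" by (intro divide_right_mono) auto
        also have "\<dots> \<le> 4 * ppow 1 3 (norm (z - e))" using 2 by (simp add: ppow_def powr_minus field_simps)
        finally show ?thesis using ppow_nonneg[of \<gamma> "\<gamma>+1" "norm z"] by linarith
      next
        case 3
        have "norm z \<le> 3 * norm (z - e)" using 3 e norm_triangle_ineq2[of z e] by linarith
        then have "norm z powr (-\<gamma>) / norm (z - e) \<le> norm z powr (-\<gamma>) / (norm z / 3)"
          using 3 by (intro divide_left_mono) (auto intro!: mult_pos_pos)
        also have "\<dots> = 3 * norm z powr (-(\<gamma>+1))"
          using 3 by (simp add: powr_diff powr_minus field_simps powr_add)
        also have "\<dots> \<le> 6 * ppow \<gamma> (\<gamma>+1) (norm z)"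
        \<comment> \<open>For \<open>1/2 <= norm z < 1\<close> a factor
          \<open>1 / norm z <= 2\<close> is given up, which turns 3 into 6.\<close>
        proof (cases "norm z < 1")
          case True
          have "norm z powr (-(\<gamma>+1)) = norm z powr (-\<gamma>) / norm z" using 3 by (simp add: powr_diff powr_minus field_simps powr_add)
          also have "\<dots> \<le> norm z powr (-\<gamma>) / (1/2)" using 3 by (intro divide_left_mono) (auto intro!: mult_pos_pos)
          finally show ?thesis using True by (simp add: ppow_def)
        qed (simp add: ppow_def)
        finally show ?thesis using ppow_nonneg[of 1 3 "norm (z-e)"] by linarith
      qed
    qed
    have "(\<integral>\<^sup>+z. ennreal (norm z powr (-\<gamma>) / norm (z - e)) \<partial>lborel)
      \<le> (\<integral>\<^sup>+z. ennreal 6 * ennreal (ppow \<gamma> (\<gamma>+1) (norm z)) + ennreal 4 * ennreal (ppow 1 3 (norm (z - e))) \<partial>lborel)"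
      using pw by (intro nn_integral_mono) (simp add: ppow_nonneg del: ennreal_numeral flip: ennreal_mult ennreal_plus)
    also have "\<dots> = ennreal 6 * ennreal A + ennreal 4 * (\<integral>\<^sup>+z. ennreal (ppow 1 3 (norm (z - e))) \<partial>lborel)"
      by (simp add: nn_integral_add nn_integral_cmult A)
    also have "(\<integral>\<^sup>+z. ennreal (ppow 1 3 (norm (z - e))) \<partial>lborel) = ennreal B"
      using nn_integral_shift(1)[of "\<lambda>z. ennreal (ppow 1 3 (norm z))" e] B by simp
    also have "ennreal 6 * ennreal A + ennreal 4 * ennreal B = ennreal (6 * A + 4 * B)"
      using A(2) B(2) by (simp add: ennreal_mult)
    finally show ?thesis .
  qed
  then show ?thesis using A B by (intro exI[of _ "6*A+4*B"]) auto
qed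

text \<open>Scaling: \<open>y = p + r z\<close> with \<open>r = |p - q|\<close> contributes the area
  factor \<open>r^2\<close>, the integrand is homogeneous of degree \<open>- \<gamma> - 1\<close>,
  and the remaining integral has its second singularity on the unit circle.\<close>

lemma riesz_bound_nn:
  assumes "1 < \<gamma>" "\<gamma> < 2"
  shows "\<exists>C\<ge>0. \<forall>p q::real^2. p \<noteq> q \<longrightarrow>
    (\<integral>\<^sup>+y. ennreal (norm (y - p) powr (-\<gamma>) / norm (y - q)) \<partial>lborel) \<le> ennreal (C * norm (p - q) powr (1 - \<gamma>))"
proof -
  obtain C where C: "C \<ge> 0" "\<And>e::real^2. norm e = 1 \<Longrightarrow>
    (\<integral>\<^sup>+z. ennreal (norm z powr (-\<gamma>) / norm (z - e)) \<partial>lborel) \<le> ennreal C"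
    using riesz_bound_unit[OF assms] by blast
  have "(\<integral>\<^sup>+y. ennreal (norm (y - p) powr (-\<gamma>) / norm (y - q)) \<partial>lborel) \<le> ennreal (C * norm (p - q) powr (1 - \<gamma>))"
    if pq: "p \<noteq> q" for p q :: "real^2"
  proof -
    define r where "r = norm (p - q)"
    define e where "e = (1/r) *\<^sub>R (q - p)"
    have r: "r > 0" using pq by (simp add: r_def)
    have e: "norm e = 1" using r by (simp add: e_def r_def norm_minus_commute)
    have q: "q = p + r *\<^sub>R e" using r by (simp add: e_def)
    have eq: "norm (p + r *\<^sub>R z - p) powr (-\<gamma>) / norm (p + r *\<^sub>R z - q)
        = r powr (-\<gamma>-1) * (norm z powr (-\<gamma>) / norm (z - e))" for z
    proof -
      have "p + r *\<^sub>R z - q = r *\<^sub>R (z - e)" by (simp add: q algebra_simps)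
      then have "norm (p + r *\<^sub>R z - q) = r * norm (z - e)" using r by simp
      then show ?thesis using r by (simp add: powr_mult powr_diff)
    qed
    have "(\<integral>\<^sup>+y. ennreal (norm (y - p) powr (-\<gamma>) / norm (y - q)) \<partial>lborel)
       = ennreal (r^2) * (\<integral>\<^sup>+z. ennreal (r powr (-\<gamma>-1) * (norm z powr (-\<gamma>) / norm (z - e))) \<partial>lborel)"
      using r by (subst nn_integral_affine[of _ r p]) (simp_all only: eq DIM_cart, simp_all)
    also have "\<dots> = ennreal (r^2) * (ennreal (r powr (-\<gamma>-1)) * (\<integral>\<^sup>+z. ennreal (norm z powr (-\<gamma>) / norm (z - e)) \<partial>lborel))"
      by (subst nn_integral_cmult[symmetric]) (simp_all only: ennreal_mult' powr_ge_zero, simp_all)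
    also have "\<dots> \<le> ennreal (r^2) * (ennreal (r powr (-\<gamma>-1)) * ennreal C)"
      by (intro mult_left_mono C e) auto
    also have "\<dots> = ennreal (r^2 * r powr (-\<gamma>-1) * C)"
      using C(1) by (simp add: ennreal_mult mult.assoc)
    also have "r^2 * r powr (-\<gamma>-1) = r powr (1-\<gamma>)"
    proof -
      have "r^2 * r powr (-\<gamma>-1) = r powr 2 * r powr (-\<gamma>-1)" using r by simp
      also have "\<dots> = r powr (2 + (-\<gamma>-1))" by (rule powr_add[symmetric])
      finally show ?thesis by simp
    qed
    finally show ?thesis by (simp add: r_def mult.commute)
  qed
  then show ?thesis using C(1) by blast
qed

lemma integral_bound_by_nn:
  fixes g :: "'a \<Rightarrow> 'b::{banach, second_countable_topology}"
  assumes [measurable]: "g \<in> borel_measurable M" and "(\<integral>\<^sup>+x. ennreal (h x) \<partial>M) \<le> ennreal C"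
    and "AE x in M. norm (g x) \<le> B * h x" "B \<ge> 0" "C \<ge> 0" and [measurable]: "h \<in> borel_measurable M"
  shows "integrable M g" "norm (integral\<^sup>L M g) \<le> B * C"
proof -
  have "(\<integral>\<^sup>+x. ennreal (norm (g x)) \<partial>M) \<le> (\<integral>\<^sup>+x. ennreal B * ennreal (h x) \<partial>M)"
    using assms(3,4) by (intro nn_integral_mono_AE) (auto simp: ennreal_mult'[symmetric] intro: ennreal_leI)
  also have "\<dots> = ennreal B * (\<integral>\<^sup>+x. ennreal (h x) \<partial>M)" by (simp add: nn_integral_cmult)
  also have "\<dots> \<le> ennreal B * ennreal C" by (intro mult_left_mono assms) auto
  also have "\<dots> = ennreal (B * C)" using assms by (simp add: ennreal_mult)
  finally have *: "(\<integral>\<^sup>+x. ennreal (norm (g x)) \<partial>M) \<le> ennreal (B * C)" .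
  then show i: "integrable M g"
    by (intro integrableI_bounded) (auto intro: le_less_trans[OF _ ennreal_less_top])
  have "norm (integral\<^sup>L M g) \<le> (\<integral>x. norm (g x) \<partial>M)" by (rule integral_norm_bound)
  also have "ennreal \<dots> = (\<integral>\<^sup>+x. ennreal (norm (g x)) \<partial>M)"
    using i by (intro nn_integral_eq_integral[symmetric]) auto
  then have "(\<integral>x. norm (g x) \<partial>M) \<le> B * C"
    using * assms(4,5) by (metis ennreal_le_iff mult_nonneg_nonneg)
  finally show "norm (integral\<^sup>L M g) \<le> B * C" .
qed

text \<open>The pointwise bound is asked for only off \<open>p\<close> and \<open>q\<close>: there
  the majorant is singular and HOL gives it the value \<open>0\<close>, but two points are a null
  set. \<open>C\<close> is fixed before \<open>p\<close>, \<open>q\<close> and \<open>g\<close>, so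
  everything derived from it is uniform.\<close>

lemma riesz_bound:
  assumes "1 < \<gamma>" "\<gamma> < 2"
  obtains C where "C > 0" "\<And>p q B (g :: real^2 \<Rightarrow> 'b::{banach, second_countable_topology}).
      \<lbrakk>g \<in> borel_measurable borel; p \<noteq> q; B \<ge> 0;
       \<And>y. y \<noteq> p \<Longrightarrow> y \<noteq> q \<Longrightarrow> norm (g y) \<le> B * (norm (y - p) powr (-\<gamma>) / norm (y - q))\<rbrakk>
      \<Longrightarrow> integrable lborel g \<and> norm (integral\<^sup>L lborel g) \<le> B * (C * norm (p - q) powr (1 - \<gamma>))"
proof -
  obtain C where C: "C \<ge> 0" "\<And>p q::real^2. p \<noteq> q \<Longrightarrow>
    (\<integral>\<^sup>+y. ennreal (norm (y - p) powr (-\<gamma>) / norm (y - q)) \<partial>lborel) \<le> ennreal (C * norm (p - q) powr (1 - \<gamma>))"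
    using riesz_bound_nn[OF assms] by blast
  show thesis
  proof (rule that[of "C + 1"])
    fix p q :: "real^2" and B and g :: "real^2 \<Rightarrow> 'b"
    assume *: "g \<in> borel_measurable borel" "p \<noteq> q" "B \<ge> 0"
       "\<And>y. y \<noteq> p \<Longrightarrow> y \<noteq> q \<Longrightarrow> norm (g y) \<le> B * (norm (y - p) powr (-\<gamma>) / norm (y - q))"
    have ae: "AE y in lborel. norm (g y) \<le> B * (norm (y - p) powr (-\<gamma>) / norm (y - q))"
      using AE_lborel_singleton[of p] AE_lborel_singleton[of q] by eventually_elim (rule *(4))
    have nn: "(\<integral>\<^sup>+y. ennreal (norm (y - p) powr (-\<gamma>) / norm (y - q)) \<partial>lborel) \<le> ennreal ((C+1) * norm (p - q) powr (1 - \<gamma>))"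
      using C(2)[OF *(2)] by (rule order_trans) (auto intro!: ennreal_leI mult_right_mono)
    show "integrable lborel g \<and> norm (integral\<^sup>L lborel g) \<le> B * ((C+1) * norm (p - q) powr (1 - \<gamma>))"
      using integral_bound_by_nn[OF _ nn ae *(3), of ] C(1) *(1) by auto
  qed (use C in auto)
qed

section \<open>Pointwise bounds for the Stokes kernel\<close>

text \<open>
  Vectors are written as complex numbers; the kernel is only real linear in the density \<open>f\<close>.
  Primes denote real derivatives in \<open>z\<close>, in the directions \<open>h\<close> and \<open>w\<close>.
\<close>

definition stokes_kernel :: "complex \<Rightarrow> complex \<Rightarrow> complex" where
  "stokes_kernel z f = of_real (ln ((cmod z)\<^sup>2)) * f - z / cnj z * cnj f"

definition stokes_kernel' :: "complex \<Rightarrow> complex \<Rightarrow> complex \<Rightarrow> complex" where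
  "stokes_kernel' z h f = of_real (2 * Re (h / z)) * f - (h / cnj z - z * cnj h / (cnj z)\<^sup>2) * cnj f"

definition stokes_kernel'' :: "complex \<Rightarrow> complex \<Rightarrow> complex \<Rightarrow> complex \<Rightarrow> complex" where
  "stokes_kernel'' z w h f = - of_real (2 * Re (h * w / z\<^sup>2)) * f
     + ((h * cnj w + w * cnj h) / (cnj z)\<^sup>2 - 2 * z * cnj h * cnj w / (cnj z) ^ 3) * cnj f"

text \<open>Trades the logarithm for powers; the term \<open>1 / x\<close> matches the factor
  \<open>1 / |1 - t|\<close> that the remainder bounds carry anyway.\<close>

lemma abs_ln_bound: "x > 0 \<Longrightarrow> \<bar>ln x\<bar> \<le> x + 1 / (x::real)"
proof -
  assume x: "x > 0"
  have "ln x \<le> x" "ln (1/x) \<le> 1/x" using x by (auto intro: less_imp_le ln_less_self)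
  then show ?thesis using x by (auto simp: ln_div abs_if) (smt (verit) divide_pos_pos)+
qed

text \<open>The error term has derivative \<open>- t^2 / (1 - t)\<close>, of size at most
  \<open>2 |t|^2\<close> because \<open>|1 - s| >= 1/2\<close> on the disc; the mean value
  inequality integrates this from \<open>0\<close>.\<close>

lemma Ln_taylor2:
  assumes "cmod t \<le> 1/2"
  shows "cmod (Ln (1 - t) + t + t\<^sup>2/2) \<le> 2 * cmod t ^ 3"
proof -
  let ?g = "\<lambda>t. Ln (1 - t) + t + t\<^sup>2/2"
  let ?S = "cball 0 (cmod t) :: complex set"
  have d: "(?g has_field_derivative (- (s\<^sup>2 / (1 - s)))) (at s within ?S)" if s: "s \<in> ?S" for s
  proof -
    have m: "cmod s \<le> 1/2" using that assms by simp
    have "Re s \<le> 1/2" using complex_Re_le_cmod[of s] m by linarith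
    then have r: "1 - s \<notin> \<real>\<^sub>\<le>\<^sub>0" by (auto simp: complex_nonpos_Reals_iff)
    have n: "1 - s \<noteq> 0" using r by auto
    have "(?g has_field_derivative (- inverse (1 - s) + 1 + s)) (at s within ?S)"
      by (rule derivative_eq_intros refl r | simp)+
    moreover have "- inverse (1 - s) + 1 + s = - (s\<^sup>2 / (1 - s))"
      using n by (simp add: field_simps power2_eq_square)
    ultimately show ?thesis by simp
  qed
  have b: "cmod (- (s\<^sup>2 / (1 - s))) \<le> 2 * (cmod t)\<^sup>2" if s: "s \<in> ?S" for s
  proof -
    have m: "cmod s \<le> cmod t" "cmod (1 - s) \<ge> 1/2"
      using that assms norm_triangle_ineq2[of 1 s] by auto
    have "cmod (- (s\<^sup>2 / (1 - s))) = (cmod s)\<^sup>2 / cmod (1 - s)" by (simp add: norm_divide norm_power)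
    also have "\<dots> \<le> (cmod t)\<^sup>2 / (1/2)" using m by (intro frac_le power_mono) auto
    finally show ?thesis by simp
  qed
  have "cmod (?g t - ?g 0) \<le> 2 * (cmod t)\<^sup>2 * cmod (t - 0)"
    by (rule field_differentiable_bound[OF _ d b]) auto
  then show ?thesis by (simp add: power3_eq_cube power2_eq_square)
qed

text \<open>\<open>ln |1 - t|\<close> is the real part of \<open>Ln (1 - t)\<close>, so small
  \<open>t\<close> is covered by the Taylor bound; for \<open>|t| > 1/2\<close> every term is
  bounded on its own. The factor \<open>1 / |1 - t|\<close> makes the bounds hold up to the
  singularity at \<open>t = 1\<close> and for all larger \<open>t\<close>.\<close>

lemma log_remainders:
  fixes t :: complex
  assumes "t \<noteq> 1"
  shows "\<bar>ln ((cmod (1 - t))\<^sup>2) + 2 * Re t\<bar> \<le> 32 * (cmod t)\<^sup>2 / cmod (1 - t)"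
    and "\<bar>ln ((cmod (1 - t))\<^sup>2) + 2 * Re t + Re (t\<^sup>2)\<bar> \<le> 67 * cmod t ^ 3 / cmod (1 - t)"
proof -
  define n T where "n = cmod (1 - t)" and "T = cmod t"
  have n: "n > 0" using assms by (simp add: n_def)
  have T: "T \<ge> 0" by (simp add: T_def)
  have ln2: "ln (n\<^sup>2) = 2 * ln n" using n by (simp add: ln_realpow)
  have Ret: "\<bar>Re t\<bar> \<le> T" using abs_Re_le_cmod[of t] by (simp add: T_def)
  have Ret2: "\<bar>Re (t\<^sup>2)\<bar> \<le> T\<^sup>2" using abs_Re_le_cmod[of "t\<^sup>2"] by (simp add: T_def norm_power)
  have "\<bar>2 * ln n + 2 * Re t\<bar> \<le> 32 * T\<^sup>2 / n \<and> \<bar>2 * ln n + 2 * Re t + Re (t\<^sup>2)\<bar> \<le> 67 * T ^ 3 / n"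
  proof (cases "T \<le> 1/2")
    case True
    have n32: "n \<le> 3/2" using norm_triangle_ineq4[of 1 t] True by (simp add: n_def T_def)
    have "2 * ln n + 2 * Re t + Re (t\<^sup>2) = 2 * Re (Ln (1 - t) + t + t\<^sup>2/2)"
      using assms by (simp add: n_def)
    also have "\<bar>\<dots>\<bar> \<le> 4 * T ^ 3"
      using abs_Re_le_cmod[of "Ln (1 - t) + t + t\<^sup>2/2"] Ln_taylor2[of t] True by (simp add: T_def)
    finally have 3: "\<bar>2 * ln n + 2 * Re t + Re (t\<^sup>2)\<bar> \<le> 4 * T ^ 3" .
    \<comment> \<open>Since \<open>n <= 3/2\<close> for small \<open>t\<close>, inserting the
      missing factor \<open>1 / n\<close> costs only \<open>3/2\<close>.\<close>
    have c: "X \<le> 3/2 * X / n" if "X \<ge> 0" for X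
    proof -
      have "X * n \<le> X * (3/2)" by (intro mult_left_mono n32 that)
      then show ?thesis using n by (simp add: field_simps)
    qed
    have T3: "T ^ 3 \<le> T\<^sup>2 / 2" using mult_left_mono[OF True, of "T\<^sup>2"] by (simp add: power3_eq_cube power2_eq_square)
    have "\<bar>2 * ln n + 2 * Re t\<bar> \<le> 3 * T\<^sup>2" using 3 Ret2 T3 by linarith
    also have "\<dots> \<le> 3/2 * (3 * T\<^sup>2) / n" by (rule c) simp
    also have "\<dots> \<le> 32 * T\<^sup>2 / n" using n by (intro divide_right_mono) auto
    finally have 2: "\<bar>2 * ln n + 2 * Re t\<bar> \<le> 32 * T\<^sup>2 / n" .
    note 3
    also have "4 * T ^ 3 \<le> 3/2 * (4 * T ^ 3) / n" by (rule c) (use T in simp)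
    also have "\<dots> \<le> 67 * T ^ 3 / n" using n T by (intro divide_right_mono) auto
    finally show ?thesis using 2 by simp
  next
    case False
    \<comment> \<open>For \<open>T > 1/2\<close> one has \<open>1 < 2 T\<close>, hence
      \<open>n <= 3 T\<close>, and low powers of \<open>T\<close> can be raised to the required
      order. The constants arise as \<open>32 = 2 * 9 + 2 * 4 + 2 * 3\<close> and
      \<open>67 = 2 * 32 + 3\<close>.\<close>
    have n3: "n \<le> 3 * T" using norm_triangle_ineq4[of 1 t] False by (simp add: n_def T_def)
    have "n * n \<le> (3 * T) * (3 * T)" using n n3 T by (intro mult_mono) auto
    then have a: "n \<le> 9 * T\<^sup>2 / n" using n by (simp add: field_simps power2_eq_square)
    have "1/2 * (1/2) \<le> T * T" using False by (intro mult_mono) auto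
    then have b: "1 / n \<le> 4 * T\<^sup>2 / n" using n by (intro divide_right_mono) (auto simp: power2_eq_square)
    have "T * n \<le> T * (3 * T)" using n3 T by (intro mult_left_mono)
    then have d: "T \<le> 3 * T\<^sup>2 / n" using n by (simp add: field_simps power2_eq_square)
    have 2: "\<bar>2 * ln n + 2 * Re t\<bar> \<le> 32 * T\<^sup>2 / n"
    proof -
      have "\<bar>2 * a + 2 * b\<bar> \<le> 2 * X + 2 * Y" if "\<bar>a\<bar> \<le> X" "\<bar>b\<bar> \<le> Y" for a b X Y :: real
        using that by linarith
      from this[OF abs_ln_bound[OF n] Ret]
      have "\<bar>2 * ln n + 2 * Re t\<bar> \<le> 2 * (n + 1 / n) + 2 * T" .
      also have "\<dots> \<le> 2 * (9 * T\<^sup>2 / n + 4 * T\<^sup>2 / n) + 2 * (3 * T\<^sup>2 / n)" using a b d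
        by (intro add_mono mult_left_mono) auto
      also have "\<dots> = 32 * T\<^sup>2 / n" by (simp add: field_simps)
      finally show ?thesis .
    qed
    have T3: "T\<^sup>2 \<le> 2 * T ^ 3" using mult_left_mono[of "1/2" T "T\<^sup>2"] False by (simp add: power3_eq_cube power2_eq_square)
    have "T\<^sup>2 * n \<le> T\<^sup>2 * (3 * T)" using n3 by (intro mult_left_mono) auto
    then have e: "T\<^sup>2 \<le> 3 * T ^ 3 / n" using n by (simp add: field_simps power2_eq_square power3_eq_cube)
    have "32 * T\<^sup>2 / n \<le> 32 * (2 * T ^ 3) / n" using T3 n by (intro divide_right_mono) auto
    then have "\<bar>2 * ln n + 2 * Re t + Re (t\<^sup>2)\<bar> \<le> 32 * (2 * T ^ 3) / n + 3 * T ^ 3 / n"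
      using 2 Ret2 e by linarith
    also have "\<dots> = 67 * T ^ 3 / n" by (simp add: field_simps)
    finally show ?thesis using 2 by simp
  qed
  then show "\<bar>ln ((cmod (1 - t))\<^sup>2) + 2 * Re t\<bar> \<le> 32 * (cmod t)\<^sup>2 / cmod (1 - t)"
    "\<bar>ln ((cmod (1 - t))\<^sup>2) + 2 * Re t + Re (t\<^sup>2)\<bar> \<le> 67 * cmod t ^ 3 / cmod (1 - t)"
    using ln2 by (simp_all add: n_def T_def)
qed

text \<open>The substitution \<open>t = w / z\<close>, after factoring \<open>z - w\<close> as
  \<open>z\<close> times \<open>1 - t\<close>.\<close>

lemma log_remainders_scaled:
  fixes z w :: complex
  assumes z: "z \<noteq> 0" and w: "z \<noteq> w"
  shows "\<bar>ln ((cmod (z - w))\<^sup>2) - ln ((cmod z)\<^sup>2) + 2 * Re (w / z)\<bar> \<le> 32 * (cmod w)\<^sup>2 / (cmod z * cmod (z - w))"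
    and "\<bar>ln ((cmod (z - w))\<^sup>2) - ln ((cmod z)\<^sup>2) + 2 * Re (w / z) + Re (w\<^sup>2 / z\<^sup>2)\<bar>
          \<le> 67 * cmod w ^ 3 / ((cmod z)\<^sup>2 * cmod (z - w))"
proof -
  define t where "t = w / z"
  have t: "t \<noteq> 1" using w z by (simp add: t_def)
  have zw: "z - w = z * (1 - t)" using z by (simp add: t_def algebra_simps)
  have "ln ((cmod (z - w))\<^sup>2) - ln ((cmod z)\<^sup>2) = ln ((cmod (1 - t))\<^sup>2)"
    using z t by (simp add: zw norm_mult power_mult_distrib ln_mult)
  moreover have "32 * (cmod t)\<^sup>2 / cmod (1 - t) = 32 * (cmod w)\<^sup>2 / (cmod z * cmod (z - w))"
    "67 * cmod t ^ 3 / cmod (1 - t) = 67 * cmod w ^ 3 / ((cmod z)\<^sup>2 * cmod (z - w))"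
    using z unfolding zw norm_mult
    by (simp_all add: t_def norm_divide power_divide power2_eq_square power3_eq_cube)
  moreover have "t\<^sup>2 = w\<^sup>2 / z\<^sup>2" by (simp add: t_def power_divide)
  ultimately show "\<bar>ln ((cmod (z - w))\<^sup>2) - ln ((cmod z)\<^sup>2) + 2 * Re (w / z)\<bar> \<le> 32 * (cmod w)\<^sup>2 / (cmod z * cmod (z - w))"
    "\<bar>ln ((cmod (z - w))\<^sup>2) - ln ((cmod z)\<^sup>2) + 2 * Re (w / z) + Re (w\<^sup>2 / z\<^sup>2)\<bar>
          \<le> 67 * cmod w ^ 3 / ((cmod z)\<^sup>2 * cmod (z - w))"
    using log_remainders[OF t] unfolding t_def[symmetric] by metis+
qed

text \<open>\<open>Z\<close> and \<open>Y\<close> stand for \<open>cnj z\<close> and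
  \<open>cnj (z - w)\<close> and are treated as independent variables, which makes these identities
  rational. The right-hand sides display the powers of \<open>w\<close> and of
  \<open>Z - Y = cnj w\<close> that factor out, that is, the order to which each remainder
  vanishes.\<close>

lemma kernel_identities:
  fixes z w Z Y :: complex
  assumes "Z \<noteq> 0" "Y \<noteq> 0"
  shows "(z - w) / Y - z / Z + (w / Z - z * (Z - Y) / Z\<^sup>2) = (Z - Y) * ((Z - Y) * z - w * Z) / (Z\<^sup>2 * Y)"
    and "(z - w) / Y - z / Z + (w / Z - z * (Z - Y) / Z\<^sup>2) + w * (Z - Y) / Z\<^sup>2 - z * (Z - Y)\<^sup>2 / Z ^ 3
      = (Z - Y)\<^sup>2 * ((Z - Y) * z - w * Z) / (Z ^ 3 * Y)"
    and "(z - w) / Y\<^sup>2 - z / Z\<^sup>2 = (Z - Y) * (z * Y + Z * (z - w)) / (Z\<^sup>2 * Y\<^sup>2) - w / (Z * Y)"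
    and "(z - w) / Y\<^sup>2 - z / Z\<^sup>2 + w / Z\<^sup>2 - 2 * z * (Z - Y) / Z ^ 3
      = (Z - Y) * (2 * z * (Z - Y) * Y + Z * (Z - Y) * (z - w) - 2 * Z * w * Y) / (Z ^ 3 * Y\<^sup>2)"
    and "1 / Y - 1 / Z = (Z - Y) / (Z * Y)"
    and "1 / Y - 1 / Z - (Z - Y) / Z\<^sup>2 = (Z - Y)\<^sup>2 / (Z\<^sup>2 * Y)"
proof -
  show "(z - w) / Y - z / Z + (w / Z - z * (Z - Y) / Z\<^sup>2) = (Z - Y) * ((Z - Y) * z - w * Z) / (Z\<^sup>2 * Y)"
    using assms by (simp add: divide_simps) algebra
  show "(z - w) / Y - z / Z + (w / Z - z * (Z - Y) / Z\<^sup>2) + w * (Z - Y) / Z\<^sup>2 - z * (Z - Y)\<^sup>2 / Z ^ 3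
      = (Z - Y)\<^sup>2 * ((Z - Y) * z - w * Z) / (Z ^ 3 * Y)"
    using assms by (simp add: divide_simps) algebra
  show "(z - w) / Y\<^sup>2 - z / Z\<^sup>2 = (Z - Y) * (z * Y + Z * (z - w)) / (Z\<^sup>2 * Y\<^sup>2) - w / (Z * Y)"
    using assms by (simp add: divide_simps) algebra
  show "(z - w) / Y\<^sup>2 - z / Z\<^sup>2 + w / Z\<^sup>2 - 2 * z * (Z - Y) / Z ^ 3
      = (Z - Y) * (2 * z * (Z - Y) * Y + Z * (Z - Y) * (z - w) - 2 * Z * w * Y) / (Z ^ 3 * Y\<^sup>2)"
    using assms by (simp add: divide_simps) algebra
  show "1 / Y - 1 / Z = (Z - Y) / (Z * Y)"
    using assms by (simp add: field_simps)
  show "1 / Y - 1 / Z - (Z - Y) / Z\<^sup>2 = (Z - Y)\<^sup>2 / (Z\<^sup>2 * Y)"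
    using assms by (simp add: divide_simps) algebra
qed

lemma frac_add: "m * a / d + n * a / d = (m + n) * a / (d::real)"
  by (simp add: algebra_simps add_divide_distrib)

lemma cmod_combine: "cmod a \<le> A \<Longrightarrow> cmod b \<le> B \<Longrightarrow> cmod (a * f - b * cnj f) \<le> (A + B) * cmod f"
proof -
  assume ab: "cmod a \<le> A" "cmod b \<le> B"
  have "cmod (a * f - b * cnj f) \<le> cmod a * cmod f + cmod b * cmod f"
    using norm_triangle_ineq4[of "a * f" "b * cnj f"] by (simp add: norm_mult)
  also have "\<dots> \<le> A * cmod f + B * cmod f" using ab by (intro add_mono mult_right_mono) auto
  finally show ?thesis by (simp add: algebra_simps)
qed

section \<open>Size of the kernels and of their Taylor remainders\<close>

lemma norm_stokes_kernel: "z \<noteq> 0 \<Longrightarrow> cmod (stokes_kernel z f) \<le> (2 * cmod z + 2 / cmod z + 1) * cmod f"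
  unfolding stokes_kernel_def
  by (rule cmod_combine)
     (use abs_ln_bound[of "cmod z"] in \<open>auto simp: ln_realpow norm_divide\<close>)

text \<open>This covers \<open>z = 0\<close> as well, since division by zero makes both sides
  \<open>0\<close>.\<close>

lemma norm_stokes_kernel': "cmod (stokes_kernel' z h f) \<le> 4 * cmod h / cmod z * cmod f"
proof -
  have 1: "cmod (of_real (2 * Re (h / z))) \<le> 2 * (cmod h / cmod z)"
    using abs_Re_le_cmod[of "h/z"] by (simp add: norm_divide norm_mult)
  have 2: "cmod (h / cnj z - z * cnj h / (cnj z)\<^sup>2) \<le> 2 * (cmod h / cmod z)"
    using norm_triangle_ineq4[of "h / cnj z" "z * cnj h / (cnj z)\<^sup>2"]
    by (cases "z = 0") (auto simp: norm_divide norm_mult norm_power power2_eq_square)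
  show ?thesis unfolding stokes_kernel'_def using cmod_combine[OF 1 2, of f] by simp
qed

text \<open>The increment is \<open>- w\<close>, hence the plus sign before
  \<open>stokes_kernel'\<close>. The estimate is used twice: with \<open>z = x - y\<close> and
  \<open>w = - h\<close> for differentiability of the potential, with \<open>z = x\<close> and
  \<open>w = y\<close> for its decay. The constant is 32 from the logarithm plus 2 from
  \<open>z / cnj z\<close>.\<close>

lemma stokes_kernel_remainder1:
  assumes z: "z \<noteq> 0" and w: "z \<noteq> w"
  shows "cmod (stokes_kernel (z - w) f - stokes_kernel z f + stokes_kernel' z w f)
    \<le> 34 * (cmod w)\<^sup>2 / (cmod z * cmod (z - w)) * cmod f"
proof -
  define a where "a = complex_of_real (ln ((cmod (z - w))\<^sup>2) - ln ((cmod z)\<^sup>2) + 2 * Re (w / z))"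
  define b where "b = (z - w) / cnj (z - w) - z / cnj z + (w / cnj z - z * cnj w / (cnj z)\<^sup>2)"
  have eq: "stokes_kernel (z - w) f - stokes_kernel z f + stokes_kernel' z w f = a * f - b * cnj f"
    by (simp add: stokes_kernel_def stokes_kernel'_def a_def b_def algebra_simps)
  have a: "cmod a \<le> 32 * (cmod w)\<^sup>2 / (cmod z * cmod (z - w))"
    unfolding a_def norm_of_real by (rule log_remainders_scaled(1)[OF z w])
  have nz: "cnj z \<noteq> 0" "cnj z - cnj w \<noteq> 0" using z w by auto
  have "b = cnj w * (cnj w * z - w * cnj z) / ((cnj z)\<^sup>2 * (cnj z - cnj w))"
    unfolding b_def using kernel_identities(1)[OF nz, of z w] by simp
  then have "cmod b = cmod w * cmod (cnj w * z - w * cnj z) / ((cmod z)\<^sup>2 * cmod (z - w))"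
    by (simp add: norm_mult norm_divide norm_power flip: complex_cnj_diff)
  also have "\<dots> \<le> cmod w * (2 * cmod w * cmod z) / ((cmod z)\<^sup>2 * cmod (z - w))"
    using norm_triangle_ineq4[of "cnj w * z" "w * cnj z"]
    by (intro divide_right_mono mult_left_mono) (auto simp: norm_mult)
  also have "\<dots> = 2 * (cmod w)\<^sup>2 / (cmod z * cmod (z - w))"
    using z w by (simp add: field_simps power2_eq_square)
  finally have b: "cmod b \<le> \<dots>" .
  show ?thesis using cmod_combine[OF a b, of f] unfolding eq frac_add by simp
qed

text \<open>One order beyond \<open>stokes_kernel_remainder1\<close>; this order isolates the far
  field. Again the logarithm contributes 67 and \<open>z / cnj z\<close> contributes 2.\<close>

lemma stokes_kernel_remainder2:
  assumes z: "z \<noteq> 0" and w: "z \<noteq> w"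
  shows "cmod (stokes_kernel (z - w) f - stokes_kernel z f + stokes_kernel' z w f - stokes_kernel'' z w w f / 2)
    \<le> 69 * cmod w ^ 3 / ((cmod z)\<^sup>2 * cmod (z - w)) * cmod f"
proof -
  define a where "a = complex_of_real (ln ((cmod (z - w))\<^sup>2) - ln ((cmod z)\<^sup>2) + 2 * Re (w / z) + Re (w\<^sup>2 / z\<^sup>2))"
  define b where "b = (z - w) / cnj (z - w) - z / cnj z + (w / cnj z - z * cnj w / (cnj z)\<^sup>2)
      + (w * cnj w) / (cnj z)\<^sup>2 - z * (cnj w)\<^sup>2 / (cnj z) ^ 3"
  \<comment> \<open>These rearrangements are proved for free variables, so that ring normalisation
    never looks into the kernels or their denominators.\<close>
  have "(p + p) / X - 2 * u * v * v / Y = 2 * (p / X - u * v\<^sup>2 / Y)" for p X u v Y :: complex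
    by (simp add: power2_eq_square right_diff_distrib mult.assoc)
  note h1 = this
  have h2: "(- of_real (2 * r) * f + 2 * t * g) / 2 = - of_real r * f + t * g" for r :: real and t g :: complex
    by (simp add: add_divide_distrib)
  have half: "stokes_kernel'' z w w f / 2
      = - of_real (Re (w\<^sup>2 / z\<^sup>2)) * f + (w * cnj w / (cnj z)\<^sup>2 - z * (cnj w)\<^sup>2 / (cnj z) ^ 3) * cnj f"
    unfolding stokes_kernel''_def power2_eq_square[of w] h1 h2 ..
  have "L1 * f - q1 * g - (L0 * f - q0 * g) + (R * f - s * g) - (- R2 * f + (t - u) * g)
      = (L1 - L0 + R + R2) * f - (q1 - q0 + s + t - u) * g" for L1 q1 L0 q0 R s R2 t u g :: complex
    by (simp add: algebra_simps)
  then have eq: "stokes_kernel (z - w) f - stokes_kernel z f + stokes_kernel' z w f - stokes_kernel'' z w w f / 2 = a * f - b * cnj f"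
    unfolding half stokes_kernel_def stokes_kernel'_def a_def b_def of_real_add of_real_diff .
  have a: "cmod a \<le> 67 * cmod w ^ 3 / ((cmod z)\<^sup>2 * cmod (z - w))"
    unfolding a_def norm_of_real by (rule log_remainders_scaled(2)[OF z w])
  have nz: "cnj z \<noteq> 0" "cnj z - cnj w \<noteq> 0" using z w by auto
  have "b = (cnj w)\<^sup>2 * (cnj w * z - w * cnj z) / ((cnj z) ^ 3 * (cnj z - cnj w))"
    unfolding b_def using kernel_identities(2)[OF nz, of z w] by simp
  then have "cmod b = (cmod w)\<^sup>2 * cmod (cnj w * z - w * cnj z) / ((cmod z) ^ 3 * cmod (z - w))"
    by (simp add: norm_mult norm_divide norm_power flip: complex_cnj_diff)
  also have "\<dots> \<le> (cmod w)\<^sup>2 * (2 * cmod w * cmod z) / ((cmod z) ^ 3 * cmod (z - w))"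
    using norm_triangle_ineq4[of "cnj w * z" "w * cnj z"]
    by (intro divide_right_mono mult_left_mono) (auto simp: norm_mult)
  also have "\<dots> = 2 * cmod w ^ 3 / ((cmod z)\<^sup>2 * cmod (z - w))"
    using z w by (simp add: field_simps power2_eq_square power3_eq_cube)
  finally have b: "cmod b \<le> \<dots>" .
  show ?thesis using cmod_combine[OF a b, of f] unfolding eq frac_add by simp
qed

text \<open>Used for the continuity of the velocity gradient. The parts 2, 1 and 3 of the constant
  come from \<open>h / z\<close>, \<open>h / cnj z\<close> and \<open>z / (cnj z)^2\<close>.\<close>

lemma stokes_kernel'_diff:
  assumes z: "z \<noteq> 0" and w: "z \<noteq> w"
  shows "cmod (stokes_kernel' (z - w) h f - stokes_kernel' z h f)
    \<le> 6 * (cmod h * cmod w) / (cmod z * cmod (z - w)) * cmod f"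
proof -
  define a where "a = complex_of_real (2 * Re (h / (z - w)) - 2 * Re (h / z))"
  define c where "c = (z - w) / (cnj (z - w))\<^sup>2 - z / (cnj z)\<^sup>2"
  define b where "b = h / cnj (z - w) - h / cnj z - c * cnj h"
  have eq: "stokes_kernel' (z - w) h f - stokes_kernel' z h f = a * f - b * cnj f"
    by (simp add: stokes_kernel'_def a_def b_def c_def algebra_simps)
  have nz: "cnj z \<noteq> 0" "cnj z - cnj w \<noteq> 0" "z - w \<noteq> 0" using z w by auto
  have "a = of_real (2 * Re (h / (z - w) - h / z))" by (simp add: a_def)
  also have "h / (z - w) - h / z = h * w / (z * (z - w))" using nz z by (simp add: field_simps)
  finally have a: "cmod a \<le> 2 * (cmod h * cmod w) / (cmod z * cmod (z - w))"
    using abs_Re_le_cmod[of "h * w / (z * (z - w))"] by (simp only: norm_of_real) (simp add: norm_mult norm_divide)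
  have "c = cnj w * (z * (cnj z - cnj w) + cnj z * (z - w)) / ((cnj z)\<^sup>2 * (cnj z - cnj w)\<^sup>2)
        - w / (cnj z * (cnj z - cnj w))"
    unfolding c_def using kernel_identities(3)[OF nz(1,2), of z w] by simp
  then have "cmod c \<le> cmod (cnj w * (z * (cnj z - cnj w) + cnj z * (z - w)) / ((cnj z)\<^sup>2 * (cnj z - cnj w)\<^sup>2))
      + cmod (w / (cnj z * (cnj z - cnj w)))"
    using norm_triangle_ineq4 by simp
  also have "\<dots> = cmod w * cmod (z * (cnj z - cnj w) + cnj z * (z - w)) / ((cmod z)\<^sup>2 * (cmod (z - w))\<^sup>2)
      + cmod w / (cmod z * cmod (z - w))"
    by (simp add: norm_mult norm_divide norm_power flip: complex_cnj_diff)
  also have "\<dots> \<le> cmod w * (2 * cmod z * cmod (z - w)) / ((cmod z)\<^sup>2 * (cmod (z - w))\<^sup>2)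
      + cmod w / (cmod z * cmod (z - w))"
    using norm_triangle_ineq[of "z * (cnj z - cnj w)" "cnj z * (z - w)"]
    by (intro add_mono divide_right_mono mult_left_mono) (auto simp: norm_mult simp flip: complex_cnj_diff)
  also have "\<dots> = 3 * cmod w / (cmod z * cmod (z - w))"
    using z nz(3) by (simp add: field_simps power2_eq_square)
  finally have c: "cmod c \<le> 3 * cmod w / (cmod z * cmod (z - w))" .
  have "b = h * cnj w / (cnj z * (cnj z - cnj w)) - c * cnj h"
    unfolding b_def using arg_cong[OF kernel_identities(5)[OF nz(1,2)], of "\<lambda>x. h * x"]
    by (simp add: right_diff_distrib)
  then have "cmod b \<le> cmod (h * cnj w / (cnj z * (cnj z - cnj w))) + cmod (c * cnj h)"
    using norm_triangle_ineq4 by simp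
  also have "\<dots> = cmod h * cmod w / (cmod z * cmod (z - w)) + cmod c * cmod h"
    by (simp add: norm_mult norm_divide flip: complex_cnj_diff)
  also have "\<dots> \<le> cmod h * cmod w / (cmod z * cmod (z - w)) + 3 * cmod w / (cmod z * cmod (z - w)) * cmod h"
    by (intro add_mono mult_right_mono c) auto
  also have "\<dots> = 4 * (cmod h * cmod w) / (cmod z * cmod (z - w))" by (simp add: field_simps)
  finally have b: "cmod b \<le> \<dots>" .
  show ?thesis using cmod_combine[OF a b, of f] unfolding eq frac_add by simp
qed

text \<open>Used for the decay of the gradient. Compared with
  \<open>stokes_kernel_remainder1\<close> the order in \<open>w\<close> is the same but one more
  power of \<open>z\<close> stands in the denominator, so the gradient gains a full power of
  decay.\<close>

lemma stokes_kernel'_remainder: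
  assumes z: "z \<noteq> 0" and w: "z \<noteq> w"
  shows "cmod (stokes_kernel' (z - w) h f - stokes_kernel' z h f + stokes_kernel'' z w h f)
    \<le> 8 * (cmod h * (cmod w)\<^sup>2) / ((cmod z)\<^sup>2 * cmod (z - w)) * cmod f"
proof -
  define a where "a = complex_of_real (2 * Re (h / (z - w)) - 2 * Re (h / z) - 2 * Re (h * w / z\<^sup>2))"
  define c where "c = (z - w) / (cnj (z - w))\<^sup>2 - z / (cnj z)\<^sup>2 + w / (cnj z)\<^sup>2 - 2 * z * cnj w / (cnj z) ^ 3"
  define d where "d = 1 / cnj (z - w) - 1 / cnj z - cnj w / (cnj z)\<^sup>2"
  define b where "b = h / cnj (z - w) - h / cnj z - h * cnj w / (cnj z)\<^sup>2 - c * cnj h"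
  have b_eq: "b = h * d - c * cnj h" unfolding b_def d_def right_diff_distrib by simp
  have "(u / p - v / q + x / q - 2 * v * y / r) * H = u * H / p - v * H / q + x * H / q - 2 * v * H * y / r"
    for u p v q x y r H :: complex
    by (simp add: ring_distribs mult_ac)
  then have "c * cnj h = (z - w) * cnj h / (cnj (z - w))\<^sup>2 - z * cnj h / (cnj z)\<^sup>2 + w * cnj h / (cnj z)\<^sup>2
      - 2 * z * cnj h * cnj w / (cnj z) ^ 3"
    unfolding c_def .
  then have b_eq2: "b = h / cnj (z - w) - (z - w) * cnj h / (cnj (z - w))\<^sup>2 - (h / cnj z - z * cnj h / (cnj z)\<^sup>2)
      - ((h * cnj w + w * cnj h) / (cnj z)\<^sup>2 - 2 * z * cnj h * cnj w / (cnj z) ^ 3)"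
    unfolding b_def add_divide_distrib by simp
  have "L1 * f - q1 * g - (L0 * f - q0 * g) + (- R2 * f + t * g)
      = (L1 - L0 - R2) * f - (q1 - q0 - t) * g" for L1 q1 L0 q0 R2 t g :: complex
    by (simp add: algebra_simps)
  then have eq: "stokes_kernel' (z - w) h f - stokes_kernel' z h f + stokes_kernel'' z w h f = a * f - b * cnj f"
    unfolding stokes_kernel'_def stokes_kernel''_def a_def b_eq2 of_real_diff .
  have nz: "cnj z \<noteq> 0" "cnj z - cnj w \<noteq> 0" "z - w \<noteq> 0" using z w by auto
  have "a = of_real (2 * Re (h / (z - w) - h / z - h * w / z\<^sup>2))" by (simp add: a_def)
  also have "h / (z - w) - h / z - h * w / z\<^sup>2 = h * w\<^sup>2 / (z\<^sup>2 * (z - w))"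
    using nz z by (simp add: field_simps power2_eq_square)
  finally have a: "cmod a \<le> 2 * (cmod h * (cmod w)\<^sup>2) / ((cmod z)\<^sup>2 * cmod (z - w))"
    using abs_Re_le_cmod[of "h * w\<^sup>2 / (z\<^sup>2 * (z - w))"]
    by (simp only: norm_of_real) (simp add: norm_mult norm_divide norm_power)
  have "d = (cnj w)\<^sup>2 / ((cnj z)\<^sup>2 * (cnj z - cnj w))"
    unfolding d_def using kernel_identities(6)[OF nz(1,2)] by simp
  then have d: "cmod d = (cmod w)\<^sup>2 / ((cmod z)\<^sup>2 * cmod (z - w))"
    by (simp add: norm_mult norm_divide norm_power flip: complex_cnj_diff)
  have "c = cnj w * (2 * z * cnj w * (cnj z - cnj w) + cnj z * cnj w * (z - w) - 2 * cnj z * w * (cnj z - cnj w))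
       / ((cnj z) ^ 3 * (cnj z - cnj w)\<^sup>2)"
    unfolding c_def using kernel_identities(4)[OF nz(1,2), of z w] by simp
  then have "cmod c = cmod w * cmod (2 * z * cnj w * (cnj z - cnj w) + cnj z * cnj w * (z - w) - 2 * cnj z * w * (cnj z - cnj w))
       / ((cmod z) ^ 3 * (cmod (z - w))\<^sup>2)"
    by (simp add: norm_mult norm_divide norm_power flip: complex_cnj_diff)
  also have "\<dots> \<le> cmod w * (5 * cmod z * cmod w * cmod (z - w)) / ((cmod z) ^ 3 * (cmod (z - w))\<^sup>2)"
  proof (intro divide_right_mono mult_left_mono)
    have "cmod (2 * z * cnj w * (cnj z - cnj w)) = 2 * (cmod z * cmod w * cmod (z - w))"
      "cmod (cnj z * cnj w * (z - w)) = cmod z * cmod w * cmod (z - w)"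
      "cmod (2 * cnj z * w * (cnj z - cnj w)) = 2 * (cmod z * cmod w * cmod (z - w))"
      by (simp_all add: norm_mult flip: complex_cnj_diff)
    then show "cmod (2 * z * cnj w * (cnj z - cnj w) + cnj z * cnj w * (z - w) - 2 * cnj z * w * (cnj z - cnj w))
        \<le> 5 * cmod z * cmod w * cmod (z - w)"
      using norm_triangle_ineq4[of "2 * z * cnj w * (cnj z - cnj w) + cnj z * cnj w * (z - w)" "2 * cnj z * w * (cnj z - cnj w)"]
        norm_triangle_ineq[of "2 * z * cnj w * (cnj z - cnj w)" "cnj z * cnj w * (z - w)"]
      by (simp only: mult.assoc)
  qed auto
  also have "\<dots> = 5 * (cmod w)\<^sup>2 / ((cmod z)\<^sup>2 * cmod (z - w))"
    using z nz(3) by (simp add: field_simps power2_eq_square power3_eq_cube)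
  finally have c: "cmod c \<le> 5 * (cmod w)\<^sup>2 / ((cmod z)\<^sup>2 * cmod (z - w))" .
  have "cmod b \<le> cmod h * cmod d + cmod c * cmod h"
    unfolding b_eq using norm_triangle_ineq4[of "h * d" "c * cnj h"] by (simp add: norm_mult)
  also have "\<dots> \<le> cmod h * ((cmod w)\<^sup>2 / ((cmod z)\<^sup>2 * cmod (z - w))) + 5 * (cmod w)\<^sup>2 / ((cmod z)\<^sup>2 * cmod (z - w)) * cmod h"
    unfolding d by (intro add_mono mult_right_mono c) auto
  also have "\<dots> = 6 * (cmod h * (cmod w)\<^sup>2) / ((cmod z)\<^sup>2 * cmod (z - w))" by (simp add: field_simps)
  finally have b: "cmod b \<le> \<dots>" .
  show ?thesis using cmod_combine[OF a b, of f] unfolding eq frac_add by simp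
qed

section \<open>Integration by parts and test functions\<close>

lemma integral_shift:
  fixes f :: "'a::euclidean_space \<Rightarrow> 'b::{banach, second_countable_topology}"
  assumes f: "f \<in> borel_measurable borel"
  shows "(\<integral>x. f (t + x) \<partial>lborel) = (\<integral>x. f x \<partial>lborel)"
  using integral_distr[of "(+) t" lborel borel f] f by (simp add: lborel_distr_plus)

lemma integrable_shift:
  fixes f :: "'a::euclidean_space \<Rightarrow> 'b::{banach, second_countable_topology}"
  assumes f: "integrable lborel f"
  shows "integrable lborel (\<lambda>x. f (t + x))"
  using integrable_distr[of "(+) t" lborel borel f] f by (simp add: lborel_distr_plus)

text \<open>\<open>C\<close> is chosen before \<open>B\<close> and \<open>g\<close>; this uniformity
  keeps the later bounds linear in the size of the density.\<close>

lemma integrable_ppow_bound: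
  fixes g :: "real^2 \<Rightarrow> 'b::{banach, second_countable_topology}"
  assumes "0 < a" "a < 2" "2 < b"
  obtains C where "C \<ge> 0" "\<And>B (g :: real^2 \<Rightarrow> 'b). \<lbrakk>g \<in> borel_measurable borel; B \<ge> 0;
      \<And>x. x \<noteq> 0 \<Longrightarrow> norm (g x) \<le> B * ppow a b (norm x)\<rbrakk>
    \<Longrightarrow> integrable lborel g \<and> norm (integral\<^sup>L lborel g) \<le> B * C"
proof -
  obtain C where C: "(\<integral>\<^sup>+x. ennreal (ppow a b (norm x)) \<partial>(lborel :: (real^2) measure)) = ennreal C" "C \<ge> 0"
    using nn_integral_ppow[of a b] assms by (auto simp: less_top_ennreal)
  show thesis
  proof (rule that[OF C(2)])
    fix B and g :: "real^2 \<Rightarrow> 'b"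
    assume *: "g \<in> borel_measurable borel" "B \<ge> 0" "\<And>x. x \<noteq> 0 \<Longrightarrow> norm (g x) \<le> B * ppow a b (norm x)"
    have ae: "AE x in lborel. norm (g x) \<le> B * ppow a b (norm x)"
      using AE_lborel_singleton[of 0] by eventually_elim (rule *(3))
    show "integrable lborel g \<and> norm (integral\<^sup>L lborel g) \<le> B * C"
      using integral_bound_by_nn[OF _ _ ae *(2) C(2)] C(1) *(1) by auto
  qed
qed

lemma ppow_cube: "t > 0 \<Longrightarrow> 1 / (1 + t) ^ 3 \<le> ppow 1 3 t"
proof -
  assume t: "t > 0"
  show ?thesis
  proof (cases "t < 1")
    case True
    have "1 / (1 + t) ^ 3 \<le> 1" using t by (simp add: one_le_power)
    also have "1 \<le> 1 / t" using True t by simp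
    finally show ?thesis using True t by (simp add: ppow_def powr_minus_divide)
  next
    case False
    have "1 / (1 + t) ^ 3 \<le> 1 / t ^ 3" using t by (intro divide_left_mono power_mono) auto
    then show ?thesis using False t powr_realpow[of t 3] by (simp add: ppow_def powr_minus_divide)
  qed
qed

text \<open>Three is the least integer order of decay that is integrable in the plane. Unlike the
  singular majorants this one is finite everywhere and is compared at every point.\<close>

lemma integrable_cube:
  fixes g :: "real^2 \<Rightarrow> 'b::{banach, second_countable_topology}"
  assumes g: "g \<in> borel_measurable borel" and b: "\<And>x. norm (g x) \<le> B / (1 + norm x) ^ 3"
  shows "integrable lborel g"
proof -
  have B: "B \<ge> 0" using order_trans[OF norm_ge_zero b[of 0]] by simp
  obtain C where C: "\<And>B (g :: real^2 \<Rightarrow> 'b). \<lbrakk>g \<in> borel_measurable borel; B \<ge> 0;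
      \<And>x. x \<noteq> 0 \<Longrightarrow> norm (g x) \<le> B * ppow 1 3 (norm x)\<rbrakk>
    \<Longrightarrow> integrable lborel g \<and> norm (integral\<^sup>L lborel g) \<le> B * C"
    by (rule integrable_ppow_bound[of 1 3]) (simp_all, blast)
  have "norm (g x) \<le> B * ppow 1 3 (norm x)" if "x \<noteq> 0" for x
    using b[of x] mult_left_mono[OF ppow_cube[of "norm x"] B] that by simp
  then show ?thesis using C[OF g B] by blast
qed

text \<open>The integral of a difference quotient vanishes by translation invariance.\<close>

lemma integral_deriv_eq_0:
  fixes F :: "real^2 \<Rightarrow> 'b::{banach, second_countable_topology}"
  assumes d: "\<And>x. (F has_derivative F' x) (at x)" and F: "integrable lborel F"
    and b: "\<And>x. norm (F' x e) \<le> B / (1 + norm x) ^ 3" and e: "norm e = 1"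
    and [measurable]: "(\<lambda>x. F' x e) \<in> borel_measurable borel"
  shows "integrable lborel (\<lambda>x. F' x e)" "(\<integral>x. F' x e \<partial>lborel) = 0"
proof -
  show "integrable lborel (\<lambda>x. F' x e)" by (rule integrable_cube[OF _ b]) simp
  have B: "B \<ge> 0" using b[of 0] norm_ge_zero[of "F' 0 e"] by (simp del: norm_ge_zero)
  have cF: "continuous_on UNIV F"
    using d by (meson has_derivative_continuous continuous_at_imp_continuous_on)
  then have [measurable]: "F \<in> borel_measurable borel" by (rule borel_measurable_continuous_onI)
  define t where "t n = inverse (real (Suc n))" for n
  have t: "0 < t n" "t n \<le> 1" for n by (auto simp: t_def inverse_eq_divide)
  have t0: "t \<longlonglongrightarrow> 0" unfolding t_def by (rule LIMSEQ_inverse_real_of_nat)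
  define G where "G n x = (1 / t n) *\<^sub>R (F (t n *\<^sub>R e + x) - F x)" for n x
  have line: "((\<lambda>s. F (x + s *\<^sub>R e)) has_vector_derivative F' (x + s *\<^sub>R e) e) (at s within S)" for x s S
  proof -
    have "((\<lambda>s. F (x + s *\<^sub>R e)) has_derivative (\<lambda>h. F' (x + s *\<^sub>R e) (h *\<^sub>R e))) (at s within S)"
      by (rule has_derivative_compose[OF _ d]) (auto intro!: derivative_eq_intros)
    moreover have "F' (x + s *\<^sub>R e) (h *\<^sub>R e) = h *\<^sub>R F' (x + s *\<^sub>R e) e" for h
      using d[of "x + s *\<^sub>R e"] by (simp add: has_derivative_def linear_simps)
    ultimately show ?thesis by (simp add: has_vector_derivative_def)
  qed
  have "(\<lambda>n. \<integral>x. G n x \<partial>lborel) \<longlonglongrightarrow> (\<integral>x. F' x e \<partial>lborel)"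
  proof (rule integral_dominated_convergence[where w="\<lambda>x. 8 * B / (1 + norm x) ^ 3"])
    show "(\<lambda>x. F' x e) \<in> borel_measurable lborel" by simp
    show "G n \<in> borel_measurable lborel" for n unfolding G_def by measurable
    show "integrable lborel (\<lambda>x::real^2. 8 * B / (1 + norm x) ^ 3)"
      by (rule integrable_cube[of _ "8 * B"]) (use B in auto)
    show "AE x in lborel. (\<lambda>n. G n x) \<longlonglongrightarrow> F' x e"
    proof (rule AE_I2)
      fix x
      have lim: "(\<lambda>h. norm (F (x + h) - F x - F' x h) / norm h) \<midarrow>0\<rightarrow> 0"
        using d[of x] unfolding has_derivative_at by blast
      have lin: "F' x (c *\<^sub>R e) = c *\<^sub>R F' x e" for c
        using linear_scale[OF has_derivative_linear[OF d[of x]]] .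
      have "filterlim (\<lambda>n. t n *\<^sub>R e) (at 0) sequentially"
        unfolding filterlim_at using tendsto_scaleR[OF t0 tendsto_const[of e]] t(1) e
        by (auto intro!: always_eventually simp: less_imp_neq[symmetric])
      from filterlim_compose[OF lim this]
      have "(\<lambda>n. norm (F (x + t n *\<^sub>R e) - F x - F' x (t n *\<^sub>R e)) / norm (t n *\<^sub>R e)) \<longlonglongrightarrow> 0" .
      moreover have "norm (F (x + t n *\<^sub>R e) - F x - F' x (t n *\<^sub>R e)) / norm (t n *\<^sub>R e) = norm (G n x - F' x e)" for n
      proof -
        have "G n x - F' x e = (1 / t n) *\<^sub>R (F (x + t n *\<^sub>R e) - F x - F' x (t n *\<^sub>R e))"
          using t(1)[of n] by (simp add: G_def lin scaleR_right_diff_distrib add.commute)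
        then show ?thesis using t(1)[of n] e by simp
      qed
      ultimately show "(\<lambda>n. G n x) \<longlonglongrightarrow> F' x e" by (simp add: tendsto_norm_zero_iff LIM_zero_iff)
    qed
    show "AE x in lborel. norm (G n x) \<le> 8 * B / (1 + norm x) ^ 3" for n
    proof (rule AE_I2)
      fix x :: "real^2"
      \<comment> \<open>On a segment of length at most 1 the weight \<open>1 + norm\<close> changes
        by a factor of at most 2; its cube is the 8 in the majorant.\<close>
      have bd: "norm (F' (x + s *\<^sub>R e) e) \<le> 8 * B / (1 + norm x) ^ 3" if "s \<in> {0..t n}" for s
      proof -
        have s: "norm (s *\<^sub>R e) \<le> 1" using that t[of n] e by auto
        have "norm x \<le> norm (x + s *\<^sub>R e) + norm (s *\<^sub>R e)" using norm_triangle_ineq4[of "x + s *\<^sub>R e" "s *\<^sub>R e"] by simp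
        then have "norm x \<le> norm (x + s *\<^sub>R e) + 1" using s by (rule order_trans[OF _ add_left_mono])
        have "1 + a \<le> 2 * (1 + b)" if "a \<le> b + 1" "0 \<le> b" for a b :: real using that by simp
        from this[OF \<open>norm x \<le> norm (x + s *\<^sub>R e) + 1\<close> norm_ge_zero]
        have "(1 + norm x) / 2 \<le> 1 + norm (x + s *\<^sub>R e)" by simp
        from power_mono[OF this, of 3] have "((1 + norm x) / 2) ^ 3 \<le> (1 + norm (x + s *\<^sub>R e)) ^ 3" by simp
        moreover have "0 < ((1 + norm x) / 2) ^ 3" by (intro zero_less_power) (simp add: add_pos_nonneg)
        ultimately have "B / (1 + norm (x + s *\<^sub>R e)) ^ 3 \<le> B / ((1 + norm x) / 2) ^ 3"
          by (intro frac_le B order_refl)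
        also have "\<dots> = 8 * B / (1 + norm x) ^ 3" by (simp add: power_divide)
        finally show ?thesis using b[of "x + s *\<^sub>R e"] by (rule order_trans[rotated])
      qed
      have *: "norm (F (x + t n *\<^sub>R e) - F x) \<le> t n * (8 * B / (1 + norm x) ^ 3)"
      proof -
        have "norm (F (x + t n *\<^sub>R e) - F (x + 0 *\<^sub>R e)) \<le> (8 * B / (1 + norm x) ^ 3) * norm (t n - 0)"
        proof (rule differentiable_bound[where S="{0..t n}" and f="\<lambda>s. F (x + s *\<^sub>R e)" and f'="\<lambda>s h. h *\<^sub>R F' (x + s *\<^sub>R e) e"])
          show "((\<lambda>s. F (x + s *\<^sub>R e)) has_derivative (\<lambda>h. h *\<^sub>R F' (x + s *\<^sub>R e) e)) (at s within {0..t n})" for s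
            using line[of x s "{0..t n}"] unfolding has_vector_derivative_def .
          show "onorm (\<lambda>h. h *\<^sub>R F' (x + s *\<^sub>R e) e) \<le> 8 * B / (1 + norm x) ^ 3" if "s \<in> {0..t n}" for s
          proof (rule onorm_le)
            fix h :: real
            show "norm (h *\<^sub>R F' (x + s *\<^sub>R e) e) \<le> 8 * B / (1 + norm x) ^ 3 * norm h"
              unfolding norm_scaleR mult.commute[of "\<bar>h\<bar>"] real_norm_def by (intro mult_right_mono bd that) simp
          qed
        qed (use t[of n] in auto)
        then show ?thesis using t[of n] by (simp add: mult.commute)
      qed
      show "norm (G n x) \<le> 8 * B / (1 + norm x) ^ 3"
      proof -
        have "norm (G n x) = norm (F (x + t n *\<^sub>R e) - F x) / t n"
          using t[of n] by (simp add: G_def add.commute)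
        also have "\<dots> \<le> 8 * B / (1 + norm x) ^ 3"
          using * t[of n] by (simp add: pos_divide_le_eq mult.commute)
        finally show ?thesis .
      qed
    qed
  qed
  moreover have "(\<integral>x. G n x \<partial>lborel) = 0" for n
    unfolding G_def using F integrable_shift[OF F, of "t n *\<^sub>R e"] integral_shift[of F "t n *\<^sub>R e"] by simp
  ultimately show "(\<integral>x. F' x e \<partial>lborel) = 0" by (simp add: LIMSEQ_const_iff)
qed

section \<open>Test functions, symmetry of second derivatives and integration by parts\<close>

lemma partial_deriv_eq: "(f has_derivative f') (at x) \<Longrightarrow> partial_deriv i f x = f' (axis i 1)"
  unfolding partial_deriv_def using frechet_derivative_at by metis

lemma plane_vec: "(h::real^2) = h$1 *\<^sub>R axis 1 1 + h$2 *\<^sub>R axis 2 (1::real)"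
  by (simp add: vec_eq_iff forall_2 axis_def)

text \<open>Compact support is recorded as vanishing outside some ball, a form that passes to
  partial derivatives and products without handling closures.\<close>

definition tfun :: "(real^2 \<Rightarrow> real) \<Rightarrow> bool" where
  "tfun \<phi> \<longleftrightarrow> (\<forall>k. Ck k \<phi>) \<and> (\<exists>R. \<forall>x. R < norm x \<longrightarrow> \<phi> x = 0)"

lemma test_function_tfun: "test_function \<phi> \<Longrightarrow> tfun \<phi>"
proof -
  assume t: "test_function \<phi>"
  then have "bounded (closure {x. \<phi> x \<noteq> 0})" by (auto simp: test_function_def compact_imp_bounded)
  then obtain R where "\<forall>x\<in>closure {x. \<phi> x \<noteq> 0}. norm x \<le> R" by (auto simp: bounded_iff)
  moreover have "x \<in> closure {x. \<phi> x \<noteq> 0}" if "\<phi> x \<noteq> 0" for x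
    using that by (intro subsetD[OF closure_subset]) simp
  ultimately have "\<forall>x. R < norm x \<longrightarrow> \<phi> x = 0" by (meson not_le)
  then show ?thesis using t unfolding tfun_def test_function_def by blast
qed

lemma tfun_has_derivative:
  assumes "tfun \<phi>"
  shows "(\<phi> has_derivative (\<lambda>h. h$1 * partial_deriv 1 \<phi> x + h$2 * partial_deriv 2 \<phi> x)) (at x)"
proof -
  have "Ck (Suc 0) \<phi>" using assms unfolding tfun_def by blast
  then have d: "\<phi> differentiable (at x)" unfolding Ck.simps differentiable_on_def by simp
  let ?D = "frechet_derivative \<phi> (at x)"
  have D: "(\<phi> has_derivative ?D) (at x)" using d by (simp add: frechet_derivative_works)
  then have l: "linear ?D" by (rule has_derivative_linear)
  have "?D h = h$1 * partial_deriv 1 \<phi> x + h$2 * partial_deriv 2 \<phi> x" for h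
    by (subst (1) plane_vec[of h]) (simp add: l linear_add linear_scale partial_deriv_def)
  then show ?thesis using D by (metis (no_types, lifting) ext has_derivative_eq_rhs)
qed

lemma tfun_continuous: "tfun \<phi> \<Longrightarrow> continuous_on UNIV \<phi>"
  unfolding tfun_def by (metis Ck.simps(1))

lemma tfun_partial_deriv: "tfun \<phi> \<Longrightarrow> tfun (partial_deriv i \<phi>)"
proof -
  assume t: "tfun \<phi>"
  have "Ck k (partial_deriv i \<phi>)" for k using t unfolding tfun_def by (metis Ck.simps(2))
  moreover obtain R where R: "\<And>x. R < norm x \<Longrightarrow> \<phi> x = 0" using t by (auto simp: tfun_def)
  have "partial_deriv i \<phi> x = 0" if "R < norm x" for x
  proof -
    have "(\<phi> has_derivative (\<lambda>h. 0)) (at x)"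
    proof (rule has_derivative_transform_within_open[of "\<lambda>x. 0"])
      show "open {x::real^2. R < norm x}" by (intro open_Collect_less continuous_intros)
    qed (use that R in auto)
    from partial_deriv_eq[OF this] show ?thesis by simp
  qed
  ultimately show ?thesis unfolding tfun_def by blast
qed

text \<open>Phrased with the cubic weight so that it feeds \<open>integrable_cube\<close> and
  \<open>integral_deriv_eq_0\<close> directly.\<close>

lemma compact_support_bound:
  fixes g :: "real^2 \<Rightarrow> 'b::real_normed_vector"
  assumes "continuous_on UNIV g" "\<And>x. R < norm x \<Longrightarrow> g x = 0"
  obtains B where "B \<ge> 0" "\<And>x. norm (g x) \<le> B / (1 + norm x) ^ 3"
proof -
  have "compact ((\<lambda>x. (1 + norm x) ^ 3 *\<^sub>R g x) ` cball 0 R)"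
    by (intro compact_continuous_image continuous_intros continuous_on_subset[OF assms(1)]) auto
  from compact_imp_bounded[OF this]
  obtain B where B: "B > 0" "\<forall>y\<in>(\<lambda>x. (1 + norm x) ^ 3 *\<^sub>R g x) ` cball 0 R. norm y \<le> B"
    unfolding bounded_pos by blast
  have "norm (g x) \<le> B / (1 + norm x) ^ 3" for x
  proof (cases "R < norm x")
    case False
    have p: "1 + norm x > 0" by (simp add: add_pos_nonneg)
    have "x \<in> cball 0 R" using False by simp
    then have "norm ((1 + norm x) ^ 3 *\<^sub>R g x) \<le> B" using B(2) by blast
    then have "(1 + norm x) ^ 3 * norm (g x) \<le> B" using p by simp
    then show ?thesis using p by (simp add: field_simps)
  qed (use assms B in auto)
  then show thesis using that B by (meson less_imp_le)
qed

lemma tfun_line_DERIV: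
  assumes "tfun \<phi>"
  shows "((\<lambda>s. \<phi> (y + s *\<^sub>R axis i 1)) has_real_derivative partial_deriv i \<phi> (y + s *\<^sub>R axis i 1)) (at s)"
proof -
  have "((\<lambda>s. \<phi> (y + s *\<^sub>R axis i 1)) has_derivative
     (\<lambda>h. (h *\<^sub>R axis i 1)$1 * partial_deriv 1 \<phi> (y + s *\<^sub>R axis i 1) + (h *\<^sub>R axis i 1)$2 * partial_deriv 2 \<phi> (y + s *\<^sub>R axis i 1))) (at s)"
    by (rule has_derivative_compose[OF _ tfun_has_derivative[OF assms]]) (auto intro!: derivative_eq_intros)
  then show ?thesis
    unfolding has_field_derivative_def
    by (rule has_derivative_eq_rhs) (use exhaust_2[of i] in \<open>auto simp: axis_def fun_eq_iff\<close>)
qed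

text \<open>The mean value theorem in direction \<open>i\<close>, applied to a difference in
  direction \<open>j\<close>, and then once more in direction \<open>j\<close>. The left side is
  symmetric in \<open>i\<close> and \<open>j\<close>, the right side is not.\<close>

lemma second_difference:
  assumes t: "tfun \<phi>" and h: "h > 0"
  shows "\<exists>r s. 0 < r \<and> r < h \<and> 0 < s \<and> s < h \<and>
    \<phi> (x + h *\<^sub>R axis i 1 + h *\<^sub>R axis j 1) - \<phi> (x + h *\<^sub>R axis i 1) - \<phi> (x + h *\<^sub>R axis j 1) + \<phi> x
      = h * (h * partial_deriv j (partial_deriv i \<phi>) (x + r *\<^sub>R axis i 1 + s *\<^sub>R axis j 1))"
proof -
  let ?g = "\<lambda>r. \<phi> (x + h *\<^sub>R axis j 1 + r *\<^sub>R axis i 1) - \<phi> (x + r *\<^sub>R axis i 1)"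
  let ?d = "\<lambda>r. partial_deriv i \<phi> (x + h *\<^sub>R axis j 1 + r *\<^sub>R axis i 1) - partial_deriv i \<phi> (x + r *\<^sub>R axis i 1)"
  have "\<exists>r>0. r < h \<and> ?g h - ?g 0 = (h - 0) * ?d r"
    by (rule MVT2[OF h, where f="?g" and f'="?d"]) (intro DERIV_diff tfun_line_DERIV[OF t])
  then obtain r where r: "0 < r" "r < h" "?g h - ?g 0 = h * ?d r" by auto
  let ?k = "\<lambda>s. partial_deriv i \<phi> (x + r *\<^sub>R axis i 1 + s *\<^sub>R axis j 1)"
  have "\<exists>s>0. s < h \<and> ?k h - ?k 0 = (h - 0) * partial_deriv j (partial_deriv i \<phi>) (x + r *\<^sub>R axis i 1 + s *\<^sub>R axis j 1)"
    by (rule MVT2[OF h, where f="?k"]) (intro tfun_line_DERIV[OF tfun_partial_deriv[OF t]])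
  then obtain s where s: "0 < s" "s < h" "?k h - ?k 0 = h * partial_deriv j (partial_deriv i \<phi>) (x + r *\<^sub>R axis i 1 + s *\<^sub>R axis j 1)" by auto
  have "?d r = ?k h - ?k 0" by (simp add: algebra_simps)
  then have "?g h - ?g 0 = h * (h * partial_deriv j (partial_deriv i \<phi>) (x + r *\<^sub>R axis i 1 + s *\<^sub>R axis j 1))"
    using r(3) s(3) by simp
  then show ?thesis using r(1,2) s(1,2) by (intro exI[of _ r] exI[of _ s]) (simp add: algebra_simps)
qed

text \<open>Schwarz's theorem: by \<open>second_difference\<close> the symmetric second difference
  is \<open>h^2\<close> times either mixed derivative at points close to \<open>x\<close>, and both
  are continuous.\<close>

lemma partial_deriv_commute:
  assumes t: "tfun \<phi>"
  shows "partial_deriv i (partial_deriv j \<phi>) x = partial_deriv j (partial_deriv i \<phi>) x"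
proof -
  let ?D = "\<lambda>i j. partial_deriv j (partial_deriv i \<phi>)"
  have close: "\<exists>d>0. \<forall>r s. 0 < r \<and> r < d \<and> 0 < s \<and> s < d \<longrightarrow> \<bar>?D i j (x + r *\<^sub>R axis i 1 + s *\<^sub>R axis j 1) - ?D i j x\<bar> < e"
    if "e > 0" for e i j
  proof -
    have "continuous_on UNIV (?D i j)" by (intro tfun_continuous tfun_partial_deriv t)
    then have "\<exists>d>0. \<forall>y. dist y x < d \<longrightarrow> dist (?D i j y) (?D i j x) < e"
      using that unfolding continuous_on_iff by blast
    then obtain d where d: "d > 0" "\<And>y. dist y x < d \<Longrightarrow> dist (?D i j y) (?D i j x) < e"
      by blast
    show ?thesis
    proof (intro exI[of _ "d/2"] conjI allI impI)
      fix r s assume *: "0 < r \<and> r < d/2 \<and> 0 < s \<and> s < d/2"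
      have "norm (r *\<^sub>R axis i (1::real) + s *\<^sub>R axis j 1) \<le> norm (r *\<^sub>R axis i (1::real)) + norm (s *\<^sub>R axis j (1::real))"
        by (rule norm_triangle_ineq)
      then have "norm (r *\<^sub>R axis i (1::real) + s *\<^sub>R axis j 1) < d" using * by simp
      then have "dist (x + r *\<^sub>R axis i 1 + s *\<^sub>R axis j 1) x < d" by (simp add: dist_norm add.assoc)
      from d(2)[OF this] show "\<bar>?D i j (x + r *\<^sub>R axis i 1 + s *\<^sub>R axis j 1) - ?D i j x\<bar> < e" by (simp add: dist_norm)
    qed (use d in auto)
  qed
  have "\<bar>?D i j x - ?D j i x\<bar> < e" if e: "e > 0" for e
  proof -
    obtain d1 where d1: "d1 > 0" "\<forall>r s. 0 < r \<and> r < d1 \<and> 0 < s \<and> s < d1 \<longrightarrow> \<bar>?D i j (x + r *\<^sub>R axis i 1 + s *\<^sub>R axis j 1) - ?D i j x\<bar> < e/2"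
      using close[OF half_gt_zero[OF e], where i=i and j=j] by blast
    obtain d2 where d2: "d2 > 0" "\<forall>r s. 0 < r \<and> r < d2 \<and> 0 < s \<and> s < d2 \<longrightarrow> \<bar>?D j i (x + r *\<^sub>R axis j 1 + s *\<^sub>R axis i 1) - ?D j i x\<bar> < e/2"
      using close[OF half_gt_zero[OF e], where i=j and j=i] by blast
    define h where "h = min d1 d2"
    have h: "h > 0" "h \<le> d1" "h \<le> d2" using d1 d2 by (auto simp: h_def)
    obtain r s where 1: "0 < r" "r < h" "0 < s" "s < h"
      "\<phi> (x + h *\<^sub>R axis i 1 + h *\<^sub>R axis j 1) - \<phi> (x + h *\<^sub>R axis i 1) - \<phi> (x + h *\<^sub>R axis j 1) + \<phi> x
      = h * (h * ?D i j (x + r *\<^sub>R axis i 1 + s *\<^sub>R axis j 1))"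
      using second_difference[OF t h(1), of x i j] by blast
    obtain r' s' where 2: "0 < r'" "r' < h" "0 < s'" "s' < h"
      "\<phi> (x + h *\<^sub>R axis j 1 + h *\<^sub>R axis i 1) - \<phi> (x + h *\<^sub>R axis j 1) - \<phi> (x + h *\<^sub>R axis i 1) + \<phi> x
      = h * (h * ?D j i (x + r' *\<^sub>R axis j 1 + s' *\<^sub>R axis i 1))"
      using second_difference[OF t h(1), of x j i] by blast
    have sw: "x + h *\<^sub>R axis j 1 + h *\<^sub>R axis i 1 = x + h *\<^sub>R axis i 1 + h *\<^sub>R axis j 1" by simp
    have "h * (h * ?D i j (x + r *\<^sub>R axis i 1 + s *\<^sub>R axis j 1)) = h * (h * ?D j i (x + r' *\<^sub>R axis j 1 + s' *\<^sub>R axis i 1))"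
      using 1(5) 2(5) unfolding sw by linarith
    then have "?D i j (x + r *\<^sub>R axis i 1 + s *\<^sub>R axis j 1) = ?D j i (x + r' *\<^sub>R axis j 1 + s' *\<^sub>R axis i 1)" using h by simp
    moreover have "\<bar>?D i j (x + r *\<^sub>R axis i 1 + s *\<^sub>R axis j 1) - ?D i j x\<bar> < e/2" using 1 h by (intro d1(2)[rule_format]) auto
    moreover have "\<bar>?D j i (x + r' *\<^sub>R axis j 1 + s' *\<^sub>R axis i 1) - ?D j i x\<bar> < e/2" using 2 h by (intro d2(2)[rule_format]) auto
    ultimately show ?thesis by linarith
  qed
  from this[of "\<bar>?D i j x - ?D j i x\<bar>"] have "?D i j x = ?D j i x" by auto
  then show ?thesis by simp
qed

text \<open>The derivative of the product of \<phi> and \<open>U\<close> has integral zero. The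
  compact support of \<phi> supplies the cubic bounds, so \<open>U\<close> may grow.\<close>

lemma integral_by_parts:
  fixes U :: "real^2 \<Rightarrow> complex"
  assumes t: "tfun \<phi>" and U: "\<And>x. (U has_derivative U' x) (at x)"
    and cU': "continuous_on UNIV (\<lambda>x. U' x (axis i 1))"
  shows "(\<integral>x. partial_deriv i \<phi> x *\<^sub>R U x \<partial>lborel) = - (\<integral>x. \<phi> x *\<^sub>R U' x (axis i 1) \<partial>lborel)"
    and "integrable lborel (\<lambda>x. \<phi> x *\<^sub>R U' x (axis i 1))"
    and "integrable lborel (\<lambda>x. partial_deriv i \<phi> x *\<^sub>R U x)"
proof -
  have cU: "continuous_on UNIV U" using U by (meson has_derivative_continuous continuous_at_imp_continuous_on)
  have cint: "integrable lborel g" "\<exists>B. \<forall>x. norm (g x) \<le> B / (1 + norm x) ^ 3"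
    if g: "continuous_on UNIV g" "\<And>x. R < norm x \<Longrightarrow> g x = 0" for g :: "real^2 \<Rightarrow> complex" and R
  proof -
    from compact_support_bound[OF g] obtain B where B: "\<And>x. norm (g x) \<le> B / (1 + norm x) ^ 3" by blast
    show "integrable lborel g"
      by (rule integrable_cube[OF _ B]) (use g(1) in \<open>simp add: borel_measurable_continuous_onI\<close>)
    show "\<exists>B. \<forall>x. norm (g x) \<le> B / (1 + norm x) ^ 3" using B by blast
  qed
  have c: "continuous_on UNIV \<phi>" "continuous_on UNIV (partial_deriv i \<phi>)"
    by (intro tfun_continuous tfun_partial_deriv t)+
  obtain R where R: "\<And>x. R < norm x \<Longrightarrow> \<phi> x = 0" using t by (auto simp: tfun_def)
  obtain R' where R': "\<And>x. R' < norm x \<Longrightarrow> partial_deriv i \<phi> x = 0"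
    using tfun_partial_deriv[OF t, of i] by (auto simp: tfun_def)
  have i1: "integrable lborel (\<lambda>x. \<phi> x *\<^sub>R U' x (axis i 1))"
    by (rule cint(1)[of _ R]) (auto intro!: continuous_intros c cU' simp: R)
  have i2: "integrable lborel (\<lambda>x. partial_deriv i \<phi> x *\<^sub>R U x)"
    by (rule cint(1)[of _ R']) (auto intro!: continuous_intros c cU simp: R')
  have i3: "integrable lborel (\<lambda>x. \<phi> x *\<^sub>R U x)"
    by (rule cint(1)[of _ R]) (auto intro!: continuous_intros c cU simp: R)
  let ?F' = "\<lambda>x h. \<phi> x *\<^sub>R U' x h + (h$1 * partial_deriv 1 \<phi> x + h$2 * partial_deriv 2 \<phi> x) *\<^sub>R U x"
  have d: "((\<lambda>x. \<phi> x *\<^sub>R U x) has_derivative ?F' x) (at x)" for x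
    by (rule has_derivative_scaleR[OF tfun_has_derivative[OF t] U])
  have e: "?F' x (axis i 1) = \<phi> x *\<^sub>R U' x (axis i 1) + partial_deriv i \<phi> x *\<^sub>R U x" for x
    using exhaust_2[of i] by (auto simp: axis_def)
  have "continuous_on UNIV (\<lambda>x. ?F' x (axis i 1))"
    unfolding e by (intro continuous_intros c cU cU')
  moreover have "?F' x (axis i 1) = 0" if "max R R' < norm x" for x unfolding e using that R R' by simp
  ultimately obtain B where "\<And>x. norm (?F' x (axis i 1)) \<le> B / (1 + norm x) ^ 3"
    using cint(2)[of "\<lambda>x. ?F' x (axis i 1)" "max R R'"] by blast
  from integral_deriv_eq_0(2)[OF d i3 this]
  have "(\<integral>x. \<phi> x *\<^sub>R U' x (axis i 1) + partial_deriv i \<phi> x *\<^sub>R U x \<partial>lborel) = 0"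
    unfolding e using i1 i2 by (simp add: borel_measurable_integrable)
  then show "(\<integral>x. partial_deriv i \<phi> x *\<^sub>R U x \<partial>lborel) = - (\<integral>x. \<phi> x *\<^sub>R U' x (axis i 1) \<partial>lborel)"
    using i1 i2 by (simp add: add_eq_0_iff)
  show "integrable lborel (\<lambda>x. \<phi> x *\<^sub>R U' x (axis i 1))" "integrable lborel (\<lambda>x. partial_deriv i \<phi> x *\<^sub>R U x)"
    by fact+
qed

section \<open>Integrals of decaying densities\<close>

definition cx :: "real^2 \<Rightarrow> complex" where "cx x = Complex (x$1) (x$2)"

lemma cx_simps[simp]: "Re (cx x) = x$1" "Im (cx x) = x$2" "cmod (cx x) = norm x"
  "cx (x + y) = cx x + cx y" "cx (x - y) = cx x - cx y" "cx (- x) = - cx x" "cx 0 = 0" "cx (r *\<^sub>R x) = r *\<^sub>R cx x"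
  "cx x = 0 \<longleftrightarrow> x = 0" "cx x = cx y \<longleftrightarrow> x = y"
  by (auto simp: cx_def norm_plane cmod_def complex_eq_iff vec_eq_iff forall_2)

lemma bounded_linear_cx: "bounded_linear cx"
  by (rule bounded_linear_intro[where K=1]) auto

lemmas continuous_on_cx[continuous_intros] = bounded_linear.continuous_on[OF bounded_linear_cx]

lemma measurable_cx[measurable]: "cx \<in> borel_measurable borel"
  by (rule borel_measurable_continuous_onI) (intro continuous_intros)

lemma measurable_cnj[measurable]: "cnj \<in> borel_measurable borel"
  by (rule borel_measurable_continuous_onI) (intro continuous_intros)

lemma measurable_kernels:
  assumes [measurable]: "a \<in> borel_measurable M" "b \<in> borel_measurable M" "f \<in> borel_measurable M"
  shows "(\<lambda>y. stokes_kernel (a y) (f y)) \<in> borel_measurable M"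
    and "(\<lambda>y. stokes_kernel' (a y) (b y) (f y)) \<in> borel_measurable M"
  unfolding stokes_kernel_def stokes_kernel'_def by measurable

text \<open>The ball of radius \<open>M\<close> in the weighted space of exponent \<open>q\<close>,
  for complex-valued fields. \<open>M\<close> is an explicit argument because the contraction
  argument relies on every estimate being linear in it.\<close>

definition decaying :: "real \<Rightarrow> real \<Rightarrow> (real^2 \<Rightarrow> complex) \<Rightarrow> bool" where
  "decaying q M f \<longleftrightarrow> continuous_on UNIV f \<and> (\<forall>y. cmod (f y) \<le> M / (1 + norm y powr q))"

lemma decaying_measurable: "decaying q M f \<Longrightarrow> f \<in> borel_measurable borel"
  by (simp add: decaying_def borel_measurable_continuous_onI)

lemma decaying_nonneg: "decaying q M f \<Longrightarrow> M \<ge> 0"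
proof -
  assume "decaying q M f"
  then have "0 \<le> M / (1 + norm (0::real^2) powr q)"
    unfolding decaying_def using norm_ge_zero order_trans by blast
  then show ?thesis by simp
qed

text \<open>Decay may be given away: each exponent \<open>a\<close> between \<open>0\<close> and
  \<open>q\<close> is available, at the price of a singularity at the origin. This is the freedom
  that selects the exponent in the Riesz bound.\<close>

lemma decaying_powr:
  assumes "decaying q M f" "0 \<le> a" "a \<le> q" "y \<noteq> 0"
  shows "cmod (f y) \<le> M * norm y powr (-a)"
proof -
  have "norm y powr a \<le> 1 + norm y powr q"
  proof (cases "norm y \<le> 1")
    case True
    then have "norm y powr a \<le> 1" using assms by (intro powr_le1) auto
    then show ?thesis by (simp add: add_increasing2)
  next
    case False
    then have "norm y powr a \<le> norm y powr q" using assms by (intro powr_mono) auto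
    then show ?thesis by simp
  qed
  then have "M / (1 + norm y powr q) \<le> M / norm y powr a"
    using assms decaying_nonneg[OF assms(1)] by (intro frac_le) auto
  also have "\<dots> = M * norm y powr (-a)" by (simp add: powr_minus divide_inverse)
  finally show ?thesis using assms(1) unfolding decaying_def by (meson order_trans)
qed

lemma square_le_weight:
  assumes "2 \<le> q" "0 \<le> (t::real)"
  shows "(1 + t)\<^sup>2 \<le> 4 * (1 + t powr q)"
proof (cases "t \<le> 1")
  case True
  have "(1 + t)\<^sup>2 \<le> 2\<^sup>2" using True assms by (intro power_mono) auto
  then show ?thesis by (simp add: add_increasing2)
next
  case False
  have "(1 + t)\<^sup>2 \<le> (2 * t)\<^sup>2" using False by (intro power_mono) auto
  also have "\<dots> = 4 * t powr 2" using False by (simp add: power_mult_distrib)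
  also have "\<dots> \<le> 4 * t powr q" using False assms by (intro mult_left_mono powr_mono) auto
  finally show ?thesis by simp
qed

text \<open>Moves the centre of the decay from the origin to an arbitrary \<open>p\<close>, so that
  a factor \<open>norm (y - p) powr (-a)\<close> can be produced wherever the Riesz bound wants one.
  The price is polynomial in \<open>p\<close>.\<close>

lemma decaying_shift_bound:
  assumes d: "decaying q M f" and q: "2 \<le> q" and a: "0 \<le> a" "a \<le> 2"
  shows "cmod (f y) * norm (y - p) powr a \<le> 4 * M * (1 + norm p)\<^sup>2"
proof -
  have M: "M \<ge> 0" using d by (rule decaying_nonneg)
  have "norm (y - p) powr a \<le> (1 + norm (y - p)) powr a" using a by (intro powr_mono2) auto
  also have "\<dots> \<le> (1 + norm (y - p)) powr 2" using a by (intro powr_mono) auto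
  also have "\<dots> = (1 + norm (y - p))\<^sup>2" by (simp add: add_pos_nonneg)
  also have "\<dots> \<le> ((1 + norm p) * (1 + norm y))\<^sup>2"
  proof (intro power_mono)
    have "norm (y - p) \<le> norm y + norm p" by (rule norm_triangle_ineq4)
    also have "\<dots> \<le> norm y + norm p + norm p * norm y" by simp
    finally show "1 + norm (y - p) \<le> (1 + norm p) * (1 + norm y)" by (simp add: algebra_simps)
  qed simp
  also have "\<dots> = (1 + norm p)\<^sup>2 * (1 + norm y)\<^sup>2" by (simp add: power_mult_distrib)
  also have "\<dots> \<le> (1 + norm p)\<^sup>2 * (4 * (1 + norm y powr q))"
    by (intro mult_left_mono square_le_weight q) auto
  finally have 1: "norm (y - p) powr a \<le> (1 + norm p)\<^sup>2 * (4 * (1 + norm y powr q))" .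
  have p: "1 + norm y powr q > 0" by (simp add: add_pos_nonneg)
  have "cmod (f y) * norm (y - p) powr a \<le> (M / (1 + norm y powr q)) * ((1 + norm p)\<^sup>2 * (4 * (1 + norm y powr q)))"
    using d M 1 p unfolding decaying_def by (intro mult_mono) (auto intro: less_imp_le)
  also have "\<dots> = 4 * M * (1 + norm p)\<^sup>2"
    using p by (simp only: mult.assoc times_divide_eq_left nonzero_eq_divide_eq less_imp_neq[OF p, symmetric]
        not_False_eq_True divide_eq_eq) (simp add: mult_ac)
  finally show ?thesis .
qed

text \<open>Here \<open>q > 4\<close> enters: a quadratic weight leaves decay of order
  \<open>q - 2 > 2\<close>, so all moments up to order two exist.\<close>

lemma decaying_moment_integrable:
  assumes "4 < q"
  obtains C where "C > 0" "\<And>f M B (g :: real^2 \<Rightarrow> 'b::{banach, second_countable_topology}).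
    \<lbrakk>decaying q M f; g \<in> borel_measurable borel; B \<ge> 0; \<And>y. y \<noteq> 0 \<Longrightarrow> norm (g y) \<le> B * ((1 + norm y)\<^sup>2 * cmod (f y))\<rbrakk>
    \<Longrightarrow> integrable lborel g \<and> norm (integral\<^sup>L lborel g) \<le> B * M * C"
proof -
  obtain C where C: "C \<ge> 0" "\<And>B (g :: real^2 \<Rightarrow> 'b). \<lbrakk>g \<in> borel_measurable borel; B \<ge> 0;
      \<And>x. x \<noteq> 0 \<Longrightarrow> norm (g x) \<le> B * ppow 1 (q-2) (norm x)\<rbrakk>
    \<Longrightarrow> integrable lborel g \<and> norm (integral\<^sup>L lborel g) \<le> B * C"
    by (rule integrable_ppow_bound[of 1 "q-2"]) (use assms in simp_all, blast)
  show thesis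
  proof (rule that[of "4 * C + 1"])
    fix f M B and g :: "real^2 \<Rightarrow> 'b"
    assume d: "decaying q M f" and g: "g \<in> borel_measurable borel" and B: "B \<ge> 0"
      and b: "\<And>y. y \<noteq> 0 \<Longrightarrow> norm (g y) \<le> B * ((1 + norm y)\<^sup>2 * cmod (f y))"
    have M: "M \<ge> 0" using d by (rule decaying_nonneg)
    have "norm (g y) \<le> 4 * B * M * ppow 1 (q-2) (norm y)" if y: "y \<noteq> 0" for y
    proof -
      have "(1 + norm y)\<^sup>2 * cmod (f y) \<le> 4 * M * ppow 1 (q-2) (norm y)"
      proof (cases "norm y < 1")
        case True
        have "(1 + norm y)\<^sup>2 * cmod (f y) \<le> 2\<^sup>2 * (M * norm y powr (-1))"
          using True assms y by (intro mult_mono power_mono decaying_powr[OF d]) auto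
        then show ?thesis using True by (simp add: ppow_def)
      next
        case False
        have "(1 + norm y)\<^sup>2 * cmod (f y) \<le> (2 * norm y)\<^sup>2 * (M * norm y powr (-q))"
          using False assms y by (intro mult_mono power_mono decaying_powr[OF d]) auto
        also have "\<dots> = 4 * M * (norm y powr 2 * norm y powr (-q))"
          using y by (simp add: power_mult_distrib)
        also have "norm y powr 2 * norm y powr (-q) = norm y powr (2 - q)" by (subst powr_add[symmetric]) simp
        finally show ?thesis using False by (simp add: ppow_def)
      qed
      then have "B * ((1 + norm y)\<^sup>2 * cmod (f y)) \<le> B * (4 * M * ppow 1 (q-2) (norm y))"
        using B by (rule mult_left_mono)
      then show ?thesis using b[OF y] by (simp add: mult_ac)
    qed
    from C(2)[OF g _ this] have *: "integrable lborel g \<and> norm (integral\<^sup>L lborel g) \<le> 4 * B * M * C" using B M by simp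
    have "4 * B * M * C \<le> B * M * (4 * C + 1)" using B M by (simp add: algebra_simps)
    with * show "integrable lborel g \<and> norm (integral\<^sup>L lborel g) \<le> B * M * (4 * C + 1)" by linarith
  qed (use C in simp)
qed

text \<open>The growth in \<open>x\<close> is crude; the bound is meant for integrability and for
  rough control in \<open>x\<close>, while the true decay is the subject of
  \<open>vel_decay\<close>.\<close>

lemma decaying_one_singularity:
  assumes "4 < q"
  obtains C where "C > 0" "\<And>f M B x (g :: real^2 \<Rightarrow> 'b::{banach, second_countable_topology}).
    \<lbrakk>decaying q M f; g \<in> borel_measurable borel; B \<ge> 0; \<And>y. y \<noteq> x \<Longrightarrow> norm (g y) \<le> B * (cmod (f y) / norm (y - x))\<rbrakk>
    \<Longrightarrow> integrable lborel g \<and> norm (integral\<^sup>L lborel g) \<le> B * M * C * (1 + norm x)\<^sup>2"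
proof -
  obtain C where C: "C > 0" "\<And>p q B (g :: real^2 \<Rightarrow> 'b).
      \<lbrakk>g \<in> borel_measurable borel; p \<noteq> q; B \<ge> 0;
       \<And>y. y \<noteq> p \<Longrightarrow> y \<noteq> q \<Longrightarrow> norm (g y) \<le> B * (norm (y - p) powr (-(3/2)) / norm (y - q))\<rbrakk>
      \<Longrightarrow> integrable lborel g \<and> norm (integral\<^sup>L lborel g) \<le> B * (C * norm (p - q) powr (1 - (3/2)))"
    by (rule riesz_bound[of "3/2"]) (simp_all, blast)
  show thesis
  proof (rule that[of "16 * C"])
    fix f M B x and g :: "real^2 \<Rightarrow> 'b"
    assume d: "decaying q M f" and g: "g \<in> borel_measurable borel" and B: "B \<ge> 0"
      and b: "\<And>y. y \<noteq> x \<Longrightarrow> norm (g y) \<le> B * (cmod (f y) / norm (y - x))"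
    have M: "M \<ge> 0" using d by (rule decaying_nonneg)
    \<comment> \<open>At the auxiliary point \<open>p\<close> the decay of \<open>f\<close> is traded for a singularity of order \<open>3/2\<close>.\<close>
    define p where "p = x + axis 1 1"
    have px: "norm (p - x) = 1" "p \<noteq> x" by (auto simp: p_def)
    have "norm (g y) \<le> B * (4 * M * (1 + norm p)\<^sup>2) * (norm (y - p) powr (-(3/2)) / norm (y - x))"
      if y: "y \<noteq> p" "y \<noteq> x" for y
    proof -
      have "cmod (f y) = cmod (f y) * norm (y - p) powr (3/2) * norm (y - p) powr (-(3/2))"
        using y by (simp add: powr_minus)
      also have "\<dots> \<le> 4 * M * (1 + norm p)\<^sup>2 * norm (y - p) powr (-(3/2))"
        using decaying_shift_bound[OF d, of "3/2" y p] assms by (intro mult_right_mono) auto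
      finally have "B * (cmod (f y) / norm (y - x)) \<le> B * (4 * M * (1 + norm p)\<^sup>2 * norm (y - p) powr (-(3/2)) / norm (y - x))"
        using B by (intro mult_left_mono divide_right_mono) auto
      then show ?thesis using b[OF y(2)] by simp
    qed
    from C(2)[OF g px(2) _ this] B M px
    have *: "integrable lborel g" "norm (integral\<^sup>L lborel g) \<le> B * (4 * M * (1 + norm p)\<^sup>2) * C" by auto
    \<comment> \<open>Moving from \<open>p\<close> back to \<open>x\<close> costs a factor 2,
      squared to 4; with the 4 of \<open>decaying_shift_bound\<close> this makes 16.\<close>
    have "norm p \<le> norm x + 1" using norm_triangle_ineq[of x "axis 1 1"] by (simp add: p_def)
    then have "1 + norm p \<le> 2 * (1 + norm x)" unfolding distrib_left using norm_ge_zero[of x] by linarith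
    from power_mono[OF this, of 2] have "(1 + norm p)\<^sup>2 \<le> 4 * (1 + norm x)\<^sup>2"
      unfolding power_mult_distrib by simp
    then have "B * (4 * M * (1 + norm p)\<^sup>2) * C \<le> B * (4 * M * (4 * (1 + norm x)\<^sup>2)) * C"
      using B M C(1) by (intro mult_right_mono mult_left_mono) auto
    with * show "integrable lborel g \<and> norm (integral\<^sup>L lborel g) \<le> B * M * (16 * C) * (1 + norm x)\<^sup>2"
      by (simp add: mult_ac)
  qed (use C in simp)
qed

text \<open>The two-point bound wants an order above one at one of the points, so half an order is
  borrowed from \<open>f\<close> recentred at \<open>x\<close>. The resulting
  \<open>norm (x - x') powr (-1/2)\<close> still leaves a positive power once the numerator carries
  a factor \<open>norm (x - x')\<close>.\<close>

lemma decaying_two_singularities: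
  assumes "4 < q"
  obtains C where "C > 0" "\<And>f M B x x' (g :: real^2 \<Rightarrow> 'b::{banach, second_countable_topology}).
    \<lbrakk>decaying q M f; g \<in> borel_measurable borel; B \<ge> 0; x \<noteq> x';
      \<And>y. y \<noteq> x \<Longrightarrow> y \<noteq> x' \<Longrightarrow> norm (g y) \<le> B * (cmod (f y) / (norm (y - x) * norm (y - x')))\<rbrakk>
    \<Longrightarrow> integrable lborel g \<and> norm (integral\<^sup>L lborel g) \<le> B * M * C * (1 + norm x)\<^sup>2 * norm (x - x') powr (-1/2)"
proof -
  obtain C where C: "C > 0" "\<And>p q B (g :: real^2 \<Rightarrow> 'b).
      \<lbrakk>g \<in> borel_measurable borel; p \<noteq> q; B \<ge> 0;
       \<And>y. y \<noteq> p \<Longrightarrow> y \<noteq> q \<Longrightarrow> norm (g y) \<le> B * (norm (y - p) powr (-(3/2)) / norm (y - q))\<rbrakk>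
      \<Longrightarrow> integrable lborel g \<and> norm (integral\<^sup>L lborel g) \<le> B * (C * norm (p - q) powr (1 - (3/2)))"
    by (rule riesz_bound[of "3/2"]) (simp_all, blast)
  show thesis
  proof (rule that[of "4 * C"])
    fix f M B x x' and g :: "real^2 \<Rightarrow> 'b"
    assume d: "decaying q M f" and g: "g \<in> borel_measurable borel" and B: "B \<ge> 0" and x: "x \<noteq> x'"
      and b: "\<And>y. y \<noteq> x \<Longrightarrow> y \<noteq> x' \<Longrightarrow> norm (g y) \<le> B * (cmod (f y) / (norm (y - x) * norm (y - x')))"
    have M: "M \<ge> 0" using d by (rule decaying_nonneg)
    have "norm (g y) \<le> B * (4 * M * (1 + norm x)\<^sup>2) * (norm (y - x) powr (-(3/2)) / norm (y - x'))"
      if y: "y \<noteq> x" "y \<noteq> x'" for y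
    proof -
      have "cmod (f y) / norm (y - x) = cmod (f y) * norm (y - x) powr (1/2) * norm (y - x) powr (-(3/2))"
      proof -
        have "norm (y - x) powr (1/2) * norm (y - x) powr (-(3/2)) = norm (y - x) powr (-1)"
          by (simp flip: powr_add)
        also have "\<dots> = 1 / norm (y - x)" using y by (simp add: powr_minus_divide)
        finally show ?thesis unfolding mult.assoc by simp
      qed
      also have "\<dots> \<le> 4 * M * (1 + norm x)\<^sup>2 * norm (y - x) powr (-(3/2))"
        using decaying_shift_bound[OF d, of "1/2" y x] assms by (intro mult_right_mono) auto
      finally have "B * ((cmod (f y) / norm (y - x)) / norm (y - x')) \<le> B * (4 * M * (1 + norm x)\<^sup>2 * norm (y - x) powr (-(3/2)) / norm (y - x'))"
        using B by (intro mult_left_mono divide_right_mono) auto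
      then show ?thesis using b[OF y] by simp
    qed
    from C(2)[OF g x _ this] B M
    have *: "integrable lborel g" "norm (integral\<^sup>L lborel g) \<le> B * (4 * M * (1 + norm x)\<^sup>2) * (C * norm (x - x') powr (-1/2))" by auto
    then show "integrable lborel g \<and> norm (integral\<^sup>L lborel g) \<le> B * M * (4 * C) * (1 + norm x)\<^sup>2 * norm (x - x') powr (-1/2)"
      by (simp add: mult_ac)
  qed (use C in simp)
qed

text \<open>Of the decay of \<open>f\<close>, \<open>n\<close> orders absorb the weight
  \<open>norm y ^ n\<close>, and \<open>\<gamma>\<close> orders become the singularity at
  \<open>0\<close> in the Riesz bound with the points \<open>0\<close> and \<open>x\<close>.\<close>

lemma decaying_far_field:
  assumes "1 < \<gamma>" "\<gamma> < 2"
  obtains C where "C > 0" "\<And>f M B q x n (g :: real^2 \<Rightarrow> 'b::{banach, second_countable_topology}).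
    \<lbrakk>decaying q M f; g \<in> borel_measurable borel; B \<ge> 0; x \<noteq> 0; \<gamma> + real n \<le> q;
      \<And>y. y \<noteq> 0 \<Longrightarrow> y \<noteq> x \<Longrightarrow> norm (g y) \<le> B * (norm y ^ n * cmod (f y) / norm (x - y))\<rbrakk>
    \<Longrightarrow> integrable lborel g \<and> norm (integral\<^sup>L lborel g) \<le> B * M * C * norm x powr (1 - \<gamma>)"
proof -
  obtain C where C: "C > 0" "\<And>p q B (g :: real^2 \<Rightarrow> 'b).
      \<lbrakk>g \<in> borel_measurable borel; p \<noteq> q; B \<ge> 0;
       \<And>y. y \<noteq> p \<Longrightarrow> y \<noteq> q \<Longrightarrow> norm (g y) \<le> B * (norm (y - p) powr (-\<gamma>) / norm (y - q))\<rbrakk>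
      \<Longrightarrow> integrable lborel g \<and> norm (integral\<^sup>L lborel g) \<le> B * (C * norm (p - q) powr (1 - \<gamma>))"
    using assms by (rule riesz_bound) blast
  show thesis
  proof (rule that[OF C(1)])
    fix f M B q x n and g :: "real^2 \<Rightarrow> 'b"
    assume d: "decaying q M f" and g: "g \<in> borel_measurable borel" and B: "B \<ge> 0" and x: "x \<noteq> 0" and n: "\<gamma> + real n \<le> q"
      and b: "\<And>y. y \<noteq> 0 \<Longrightarrow> y \<noteq> x \<Longrightarrow> norm (g y) \<le> B * (norm y ^ n * cmod (f y) / norm (x - y))"
    have M: "M \<ge> 0" using d by (rule decaying_nonneg)
    have "norm (g y) \<le> B * M * (norm (y - 0) powr (-\<gamma>) / norm (y - x))"
      if y: "y \<noteq> 0" "y \<noteq> x" for y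
    proof -
      have "norm y ^ n * cmod (f y) \<le> norm y ^ n * (M * norm y powr (-(\<gamma> + real n)))"
        using assms n y by (intro mult_left_mono decaying_powr[OF d]) auto
      also have "\<dots> = M * (norm y powr real n * norm y powr (-(\<gamma> + real n)))"
        using y by (simp add: powr_realpow)
      also have "\<dots> = M * norm y powr (-\<gamma>)" by (simp flip: powr_add)
      finally have "B * (norm y ^ n * cmod (f y) / norm (x - y)) \<le> B * (M * norm y powr (-\<gamma>) / norm (x - y))"
        using B by (intro mult_left_mono divide_right_mono) auto
      then show ?thesis using b[OF y] by (simp add: norm_minus_commute)
    qed
    from C(2)[OF g x[symmetric] _ this] B M
    show "integrable lborel g \<and> norm (integral\<^sup>L lborel g) \<le> B * M * C * norm x powr (1 - \<gamma>)"
      by (simp add: mult_ac)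
  qed
qed

section \<open>Potentials of decaying densities\<close>

text \<open>No normalising constant is included: \<open>vel f\<close> belongs to the force
  \<open>8 * poisson_mass\<close> times \<open>f\<close> (see \<open>stokes_weak\<close>), and the
  factor is divided out in the theorem.\<close>

definition vel :: "(real^2 \<Rightarrow> complex) \<Rightarrow> real^2 \<Rightarrow> complex" where
  "vel f x = (\<integral>y. stokes_kernel (cx x - cx y) (f y) \<partial>lborel)"

definition vel' :: "(real^2 \<Rightarrow> complex) \<Rightarrow> real^2 \<Rightarrow> complex \<Rightarrow> complex" where
  "vel' f x h = (\<integral>y. stokes_kernel' (cx x - cx y) h (f y) \<partial>lborel)"

definition cauchy :: "(real^2 \<Rightarrow> complex) \<Rightarrow> real^2 \<Rightarrow> complex" where
  "cauchy f x = (\<integral>y. f y / (cx x - cx y) \<partial>lborel)"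

section \<open>Linearity of the kernels and auxiliary facts on integrals and continuity\<close>

lemma stokes_kernel_diff: "stokes_kernel z (f - g) = stokes_kernel z f - stokes_kernel z g"
  by (simp add: stokes_kernel_def algebra_simps)

lemma stokes_kernel'_diff_right: "stokes_kernel' z h (f - g) = stokes_kernel' z h f - stokes_kernel' z h g"
proof -
  have "a * (f - g) - b * (f' - g') = a * f - b * f' - (a * g - b * g')" for a b f g f' g' :: complex
    by (simp add: algebra_simps)
  then show ?thesis unfolding stokes_kernel'_def complex_cnj_diff .
qed

lemma stokes_kernel'_add: "stokes_kernel' z (h + k) f = stokes_kernel' z h f + stokes_kernel' z k f"
  by (simp add: stokes_kernel'_def add_divide_distrib ring_distribs)

lemma stokes_kernel'_scaleR: "stokes_kernel' z (r *\<^sub>R h) f = r *\<^sub>R stokes_kernel' z h f"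
proof -
  have "r *\<^sub>R h / z = r *\<^sub>R (h / z)" by (simp add: scaleR_conv_of_real)
  then have "2 * Re (r *\<^sub>R h / z) = r * (2 * Re (h / z))" by simp
  then show ?thesis
    unfolding stokes_kernel'_def by (simp add: scaleR_conv_of_real right_diff_distrib left_diff_distrib mult_ac)
qed

lemma stokes_kernel'_minus: "stokes_kernel' z (- h) f = - stokes_kernel' z h f"
  using stokes_kernel'_scaleR[of z "-1" h f] by simp

lemma integral_dominated:
  fixes g :: "'a \<Rightarrow> 'b::{banach, second_countable_topology}"
  assumes "g \<in> borel_measurable M" "integrable M h" "AE x in M. norm (g x) \<le> h x"
  shows "integrable M g" "norm (integral\<^sup>L M g) \<le> integral\<^sup>L M h"
proof -
  show i: "integrable M g"
    using assms by (intro Bochner_Integration.integrable_bound[OF assms(2) assms(1)]) auto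
  have "norm (integral\<^sup>L M g) \<le> (\<integral>x. norm (g x) \<partial>M)" by (rule integral_norm_bound)
  also have "\<dots> \<le> integral\<^sup>L M h" using i assms by (intro integral_mono_AE) auto
  finally show "norm (integral\<^sup>L M g) \<le> integral\<^sup>L M h" .
qed

lemma mult_powr_sqrt: "0 \<le> t \<Longrightarrow> t * t powr (-1/2) = sqrt t"
proof -
  assume t: "0 \<le> t"
  have "t * t powr (-1/2) = t powr 1 * t powr (-1/2)" using t by simp
  also have "\<dots> = t powr (1/2)" by (subst powr_add[symmetric]) simp
  finally show ?thesis using t by (simp add: powr_half_sqrt)
qed

text \<open>The square root is what remains when a numerator \<open>norm h\<close> is integrated
  against two singularities at distance \<open>norm h\<close>, which yields
  \<open>norm h * norm h powr (-1/2)\<close>.\<close>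

lemma continuous_from_holder:
  fixes g :: "real^2 \<Rightarrow> complex"
  assumes "\<And>x h. h \<noteq> 0 \<Longrightarrow> cmod (g (x + h) - g x) \<le> K x * sqrt (norm h)"
  shows "continuous_on UNIV g"
proof -
  have "isCont g x" for x
  proof -
    have "((\<lambda>h. g (x + h) - g x) \<longlongrightarrow> 0) (at 0)"
    proof (rule Lim_null_comparison)
      show "eventually (\<lambda>h. cmod (g (x + h) - g x) \<le> K x * sqrt (norm h)) (at 0)"
        using assms by (auto simp: eventually_at_filter)
      have "((\<lambda>h::real^2. K x * sqrt (norm h)) \<longlongrightarrow> K x * sqrt (norm (0::real^2))) (at 0)"
        by (intro tendsto_intros)
      then show "((\<lambda>h::real^2. K x * sqrt (norm h)) \<longlongrightarrow> 0) (at 0)" by simp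
    qed
    then show ?thesis unfolding isCont_iff by (simp add: LIM_zero_iff)
  qed
  then show ?thesis by (simp add: continuous_at_imp_continuous_on)
qed

lemma integrable_mult_decaying:
  assumes q: "4 < q" and f: "decaying q M f" and g: "g \<in> borel_measurable borel" and b: "\<And>y. cmod (g y) \<le> (1 + norm y)\<^sup>2"
  shows "integrable lborel (\<lambda>y. g y * f y)"
proof -
  note [measurable] = g decaying_measurable[OF f]
  obtain C where "C > 0" "\<And>f M B (g :: real^2 \<Rightarrow> complex).
    \<lbrakk>decaying q M f; g \<in> borel_measurable borel; B \<ge> 0; \<And>y. y \<noteq> 0 \<Longrightarrow> norm (g y) \<le> B * ((1 + norm y)\<^sup>2 * cmod (f y))\<rbrakk>
    \<Longrightarrow> integrable lborel g \<and> norm (integral\<^sup>L lborel g) \<le> B * M * C"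
    by (rule decaying_moment_integrable[OF q]) blast
  from this(2)[OF f, of "\<lambda>y. g y * f y" 1] show ?thesis
    using b by (simp add: norm_mult mult_right_mono)
qed

lemma sq_weight_bounds: "1 \<le> (1 + norm y)\<^sup>2" "norm y \<le> (1 + norm y)\<^sup>2" "(norm y)\<^sup>2 \<le> (1 + norm y)\<^sup>2"
proof -
  show "1 \<le> (1 + norm y)\<^sup>2" by (rule one_le_power) simp
  show "(norm y)\<^sup>2 \<le> (1 + norm y)\<^sup>2" by (rule power_mono) auto
  have "1 + norm y \<le> (1 + norm y)\<^sup>2" by (rule self_le_power) auto
  then show "norm y \<le> (1 + norm y)\<^sup>2" by simp
qed

context
  fixes q :: real
  assumes q: "4 < q" "q < 5"
begin

text \<open>The kernel bound has a growing part \<open>2 |z| + 1\<close>, controlled by the moments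
  of \<open>f\<close>, and a singular part \<open>2 / |z|\<close>, controlled by
  \<open>decaying_one_singularity\<close>.\<close>

lemma vel_bound:
  obtains C where "C > 0" "\<And>f M x. decaying q M f \<Longrightarrow> integrable lborel (\<lambda>y. stokes_kernel (cx x - cx y) (f y))"
    "\<And>f M x. decaying q M f \<Longrightarrow> cmod (vel f x) \<le> C * M * (1 + norm x)\<^sup>2"
proof -
  obtain C1 where C1: "C1 > 0" "\<And>f M B (g :: real^2 \<Rightarrow> real).
    \<lbrakk>decaying q M f; g \<in> borel_measurable borel; B \<ge> 0; \<And>y. y \<noteq> 0 \<Longrightarrow> norm (g y) \<le> B * ((1 + norm y)\<^sup>2 * cmod (f y))\<rbrakk>
    \<Longrightarrow> integrable lborel g \<and> norm (integral\<^sup>L lborel g) \<le> B * M * C1"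
    by (rule decaying_moment_integrable[OF q(1)]) blast
  obtain C2 where C2: "C2 > 0" "\<And>f M B x (g :: real^2 \<Rightarrow> real).
    \<lbrakk>decaying q M f; g \<in> borel_measurable borel; B \<ge> 0; \<And>y. y \<noteq> x \<Longrightarrow> norm (g y) \<le> B * (cmod (f y) / norm (y - x))\<rbrakk>
    \<Longrightarrow> integrable lborel g \<and> norm (integral\<^sup>L lborel g) \<le> B * M * C2 * (1 + norm x)\<^sup>2"
    by (rule decaying_one_singularity[OF q(1)]) blast
  have *: "integrable lborel (\<lambda>y. stokes_kernel (cx x - cx y) (f y)) \<and> cmod (vel f x) \<le> (2 * C1 + 2 * C2) * M * (1 + norm x)\<^sup>2"
    if f: "decaying q M f" for f M x
  proof -
    note [measurable] = decaying_measurable[OF f]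
    have M: "M \<ge> 0" using f by (rule decaying_nonneg)
    let ?g1 = "\<lambda>y. (2 * norm (x - y) + 1) * cmod (f y)"
    let ?g2 = "\<lambda>y. 2 * (cmod (f y) / norm (y - x))"
    have "norm (?g1 y) \<le> (2 * (1 + norm x)) * ((1 + norm y)\<^sup>2 * cmod (f y))" for y
    proof -
      have "2 * norm (x - y) + 1 \<le> 2 * (norm x + norm y) + 1" using norm_triangle_ineq4[of x y] by simp
      also have "\<dots> \<le> 2 * ((1 + norm x) * (1 + norm y))" by (simp add: algebra_simps)
      also have "\<dots> \<le> 2 * ((1 + norm x) * (1 + norm y)\<^sup>2)"
        by (intro mult_left_mono self_le_power) auto
      finally have "2 * norm (x - y) + 1 \<le> 2 * (1 + norm x) * (1 + norm y)\<^sup>2" by (simp only: mult.assoc)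
      then have "(2 * norm (x - y) + 1) * cmod (f y) \<le> 2 * (1 + norm x) * (1 + norm y)\<^sup>2 * cmod (f y)"
        by (rule mult_right_mono) simp
      then show ?thesis by (simp add: mult.assoc abs_mult)
    qed
    with C1(2)[OF f, of ?g1 "2 * (1 + norm x)"]
    have 1: "integrable lborel ?g1" "integral\<^sup>L lborel ?g1 \<le> 2 * (1 + norm x) * M * C1" by auto
    have 2: "integrable lborel ?g2" "integral\<^sup>L lborel ?g2 \<le> 2 * M * C2 * (1 + norm x)\<^sup>2"
      using C2(2)[OF f, of ?g2 2 x] by auto
    have m: "(\<lambda>y. stokes_kernel (cx x - cx y) (f y)) \<in> borel_measurable lborel"
      unfolding stokes_kernel_def by measurable
    have "AE y in lborel. cmod (stokes_kernel (cx x - cx y) (f y)) \<le> ?g1 y + ?g2 y"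
      using AE_lborel_singleton[of x]
    proof eventually_elim
      case (elim y)
      then have "cx x - cx y \<noteq> 0" by simp
      from norm_stokes_kernel[OF this, of "f y"] show ?case
        by (simp flip: cx_simps(5) add: norm_minus_commute[of y x] algebra_simps del: cx_simps(5))
    qed
    note d = integral_dominated[OF m Bochner_Integration.integrable_add[OF 1(1) 2(1)] this]
    have "cmod (vel f x) \<le> integral\<^sup>L lborel (\<lambda>y. ?g1 y + ?g2 y)" unfolding vel_def by (rule d(2))
    also have "\<dots> = integral\<^sup>L lborel ?g1 + integral\<^sup>L lborel ?g2" by (rule Bochner_Integration.integral_add[OF 1(1) 2(1)])
    also have "\<dots> \<le> 2 * (1 + norm x) * M * C1 + 2 * M * C2 * (1 + norm x)\<^sup>2" using 1(2) 2(2) by (rule add_mono)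
    also have "2 * (1 + norm x) * M * C1 \<le> 2 * (1 + norm x)\<^sup>2 * M * C1"
      using M C1(1) by (intro mult_right_mono mult_left_mono self_le_power) auto
    finally have "cmod (vel f x) \<le> 2 * (1 + norm x)\<^sup>2 * M * C1 + 2 * M * C2 * (1 + norm x)\<^sup>2" by simp
    then have "cmod (vel f x) \<le> (2 * C1 + 2 * C2) * M * (1 + norm x)\<^sup>2" by (simp add: algebra_simps)
    moreover have "integrable lborel (\<lambda>y. stokes_kernel (cx x - cx y) (f y))" by (rule d(1))
    ultimately show ?thesis by blast
  qed
  show thesis by (rule that[of "2 * C1 + 2 * C2"]) (use * C1(1) C2(1) in auto)
qed

lemma vel'_bound:
  obtains C where "C > 0" "\<And>f M x h. decaying q M f \<Longrightarrow> integrable lborel (\<lambda>y. stokes_kernel' (cx x - cx y) h (f y))"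
    "\<And>f M x h. decaying q M f \<Longrightarrow> cmod (vel' f x h) \<le> C * M * (1 + norm x)\<^sup>2 * cmod h"
proof -
  obtain C where C: "C > 0" "\<And>f M B x (g :: real^2 \<Rightarrow> complex).
    \<lbrakk>decaying q M f; g \<in> borel_measurable borel; B \<ge> 0; \<And>y. y \<noteq> x \<Longrightarrow> norm (g y) \<le> B * (cmod (f y) / norm (y - x))\<rbrakk>
    \<Longrightarrow> integrable lborel g \<and> norm (integral\<^sup>L lborel g) \<le> B * M * C * (1 + norm x)\<^sup>2"
    by (rule decaying_one_singularity[OF q(1)]) blast
  have *: "integrable lborel (\<lambda>y. stokes_kernel' (cx x - cx y) h (f y)) \<and> cmod (vel' f x h) \<le> (4 * cmod h) * M * C * (1 + norm x)\<^sup>2"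
    if f: "decaying q M f" for f M x h
    unfolding vel'_def
  proof (rule C(2)[OF f])
    note [measurable] = decaying_measurable[OF f]
    show "(\<lambda>y. stokes_kernel' (cx x - cx y) h (f y)) \<in> borel_measurable borel"
      by (rule measurable_kernels(2)) measurable
    show "cmod (stokes_kernel' (cx x - cx y) h (f y)) \<le> 4 * cmod h * (cmod (f y) / norm (y - x))" for y
      using norm_stokes_kernel'[of "cx x - cx y" h "f y"]
      by (simp flip: cx_simps(5) add: norm_minus_commute[of y x] del: cx_simps(5))
  qed simp
  have "cmod (vel' f x h) \<le> 4 * C * M * (1 + norm x)\<^sup>2 * cmod h" if "decaying q M f" for f M x h
    using conjunct2[OF *[OF that, of x h]] by (simp add: mult_ac)
  then show thesis by (intro that[of "4 * C"]) (use * C(1) in auto)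
qed

lemma bounded_linear_vel':
  assumes f: "decaying q M f"
  shows "bounded_linear (vel' f x)"
proof -
  obtain C where C: "\<And>f M x h. decaying q M f \<Longrightarrow> integrable lborel (\<lambda>y. stokes_kernel' (cx x - cx y) h (f y))"
    "\<And>f M x h. decaying q M f \<Longrightarrow> cmod (vel' f x h) \<le> C * M * (1 + norm x)\<^sup>2 * cmod h"
    by (rule vel'_bound) blast
  note i = C(1)[OF f]
  show ?thesis
  proof (rule bounded_linear_intro)
    show "vel' f x (h + k) = vel' f x h + vel' f x k" for h k
      unfolding vel'_def stokes_kernel'_add using i by (intro Bochner_Integration.integral_add)
    show "vel' f x (r *\<^sub>R h) = r *\<^sub>R vel' f x h" for r h
      unfolding vel'_def stokes_kernel'_scaleR by simp
    show "norm (vel' f x h) \<le> norm h * (C * M * (1 + norm x)\<^sup>2)" for h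
      using C(2)[OF f, of x h] by (simp add: mult_ac)
  qed
qed

lemma vel_diff:
  assumes f: "decaying q M f" "decaying q N g"
  shows "vel (\<lambda>y. f y - g y) x = vel f x - vel g x" "vel' (\<lambda>y. f y - g y) x h = vel' f x h - vel' g x h"
proof -
  obtain C where C: "\<And>f M x. decaying q M f \<Longrightarrow> integrable lborel (\<lambda>y. stokes_kernel (cx x - cx y) (f y))"
    by (rule vel_bound) blast
  obtain C' where C': "\<And>f M x h. decaying q M f \<Longrightarrow> integrable lborel (\<lambda>y. stokes_kernel' (cx x - cx y) h (f y))"
    by (rule vel'_bound) blast
  show "vel (\<lambda>y. f y - g y) x = vel f x - vel g x"
    unfolding vel_def stokes_kernel_diff using C f by (intro Bochner_Integration.integral_diff)
  show "vel' (\<lambda>y. f y - g y) x h = vel' f x h - vel' g x h"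
    unfolding vel'_def stokes_kernel'_diff_right using C' f by (intro Bochner_Integration.integral_diff)
qed

text \<open>Dominated convergence is awkward because the singularity of the difference quotients
  moves with \<open>h\<close>. Instead the explicit first-order remainder of the kernel is
  integrated: \<open>|h|^2\<close> over two singularities, hence of order
  \<open>|h|^(3/2)\<close>.\<close>

lemma vel_has_derivative:
  assumes f: "decaying q M f"
  shows "(vel f has_derivative (\<lambda>h. vel' f x (cx h))) (at x)"
proof -
  note [measurable] = decaying_measurable[OF f]
  have M: "M \<ge> 0" using f by (rule decaying_nonneg)
  obtain C where C: "C > 0" "\<And>f M B x x' (g :: real^2 \<Rightarrow> complex).
    \<lbrakk>decaying q M f; g \<in> borel_measurable borel; B \<ge> 0; x \<noteq> x';
      \<And>y. y \<noteq> x \<Longrightarrow> y \<noteq> x' \<Longrightarrow> norm (g y) \<le> B * (cmod (f y) / (norm (y - x) * norm (y - x')))\<rbrakk>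
    \<Longrightarrow> integrable lborel g \<and> norm (integral\<^sup>L lborel g) \<le> B * M * C * (1 + norm x)\<^sup>2 * norm (x - x') powr (-1/2)"
    by (rule decaying_two_singularities[OF q(1)]) blast
  obtain C1 where i1: "\<And>f M x. decaying q M f \<Longrightarrow> integrable lborel (\<lambda>y. stokes_kernel (cx x - cx y) (f y))"
    by (rule vel_bound) blast
  obtain C2 where i2: "\<And>f M x h. decaying q M f \<Longrightarrow> integrable lborel (\<lambda>y. stokes_kernel' (cx x - cx y) h (f y))"
    by (rule vel'_bound) blast
  have key: "cmod (vel f (x + h) - vel f x - vel' f x (cx h)) / norm h \<le> 34 * M * C * (1 + norm x)\<^sup>2 * sqrt (norm h)"
    if h: "h \<noteq> 0" for h
  proof -
    let ?g = "\<lambda>y. stokes_kernel (cx (x + h) - cx y) (f y) - stokes_kernel (cx x - cx y) (f y) - stokes_kernel' (cx x - cx y) (cx h) (f y)"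
    have m: "?g \<in> borel_measurable borel" by (intro borel_measurable_diff measurable_kernels) measurable
    have "cmod (?g y) \<le> (34 * (norm h)\<^sup>2) * (cmod (f y) / (norm (y - x) * norm (y - (x + h))))"
      if y: "y \<noteq> x" "y \<noteq> x + h" for y
    proof -
      \<comment> \<open>The remainder estimate is applied with \<open>z = cx x - cx y\<close> and
        \<open>w = - cx h\<close>, so that \<open>z - w\<close> measures the distance to the second
        singular point \<open>x + h\<close>.\<close>
      have z: "cx x - cx y \<noteq> 0" "cx x - cx y \<noteq> - cx h"
        using y by (simp_all flip: cx_simps(5,6) del: cx_simps(5,6)) (simp add: algebra_simps)
      have e: "cx x - cx y - - cx h = cx (x + h) - cx y" by simp
      have n: "cmod (cx x - cx y) = norm (y - x)" "cmod (cx (x + h) - cx y) = norm (y - (x + h))"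
        by (simp_all only: cx_simps(5)[symmetric] cx_simps(3) norm_minus_commute)
      show ?thesis using stokes_kernel_remainder1[OF z, of "f y"] unfolding e n stokes_kernel'_minus by simp
    qed
    from C(2)[OF f m _ _ this] h
    have "cmod (integral\<^sup>L lborel ?g) \<le> 34 * (norm h)\<^sup>2 * M * C * (1 + norm x)\<^sup>2 * norm h powr (-1/2)"
      by auto
    moreover have "integral\<^sup>L lborel ?g = vel f (x + h) - vel f x - vel' f x (cx h)"
      unfolding vel_def vel'_def using i1[OF f] i2[OF f] by (simp del: cx_simps(4))
    ultimately have "cmod (vel f (x + h) - vel f x - vel' f x (cx h)) / norm h
       \<le> (34 * (norm h)\<^sup>2 * M * C * (1 + norm x)\<^sup>2 * norm h powr (-1/2)) / norm h"
      by (intro divide_right_mono) auto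
    also have "\<dots> = 34 * M * C * (1 + norm x)\<^sup>2 * (norm h * norm h powr (-1/2))"
      using h by (simp add: power2_eq_square)
    also have "norm h * norm h powr (-1/2) = sqrt (norm h)"
      by (rule mult_powr_sqrt) simp
    finally show ?thesis .
  qed
  have "((\<lambda>h. cmod (vel f (x + h) - vel f x - vel' f x (cx h)) / norm h) \<longlongrightarrow> 0) (at 0)"
  proof (rule Lim_null_comparison)
    show "eventually (\<lambda>h. norm (cmod (vel f (x + h) - vel f x - vel' f x (cx h)) / norm h)
       \<le> 34 * M * C * (1 + norm x)\<^sup>2 * sqrt (norm h)) (at 0)"
      using key by (auto simp: eventually_at_filter)
    have "((\<lambda>h::real^2. 34 * M * C * (1 + norm x)\<^sup>2 * sqrt (norm h)) \<longlongrightarrow> 34 * M * C * (1 + norm x)\<^sup>2 * sqrt (norm (0::real^2))) (at 0)"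
      by (intro tendsto_intros)
    then show "((\<lambda>h::real^2. 34 * M * C * (1 + norm x)\<^sup>2 * sqrt (norm h)) \<longlongrightarrow> 0) (at 0)" by simp
  qed
  moreover have "bounded_linear (\<lambda>h. vel' f x (cx h))"
    by (rule bounded_linear_compose[OF bounded_linear_vel'[OF f] bounded_linear_cx])
  ultimately show ?thesis unfolding has_derivative_at by blast
qed

lemma continuous_vel': 
  assumes f: "decaying q M f"
  shows "continuous_on UNIV (\<lambda>x. vel' f x h)"
proof -
  note [measurable] = decaying_measurable[OF f]
  obtain C where C: "C > 0" "\<And>f M B x x' (g :: real^2 \<Rightarrow> complex).
    \<lbrakk>decaying q M f; g \<in> borel_measurable borel; B \<ge> 0; x \<noteq> x';
      \<And>y. y \<noteq> x \<Longrightarrow> y \<noteq> x' \<Longrightarrow> norm (g y) \<le> B * (cmod (f y) / (norm (y - x) * norm (y - x')))\<rbrakk>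
    \<Longrightarrow> integrable lborel g \<and> norm (integral\<^sup>L lborel g) \<le> B * M * C * (1 + norm x)\<^sup>2 * norm (x - x') powr (-1/2)"
    by (rule decaying_two_singularities[OF q(1)]) blast
  obtain C2 where i2: "\<And>f M x h. decaying q M f \<Longrightarrow> integrable lborel (\<lambda>y. stokes_kernel' (cx x - cx y) h (f y))"
    by (rule vel'_bound) blast
  show ?thesis
  proof (rule continuous_from_holder)
    fix x k :: "real^2"
    assume k: "k \<noteq> 0"
    let ?g = "\<lambda>y. stokes_kernel' (cx (x + k) - cx y) h (f y) - stokes_kernel' (cx x - cx y) h (f y)"
    have m: "?g \<in> borel_measurable borel" by (intro borel_measurable_diff measurable_kernels) measurable
    have "cmod (?g y) \<le> (6 * (cmod h * norm k)) * (cmod (f y) / (norm (y - x) * norm (y - (x + k))))"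
      if y: "y \<noteq> x" "y \<noteq> x + k" for y
    proof -
      have z: "cx x - cx y \<noteq> 0" "cx x - cx y \<noteq> - cx k"
        using y by (simp_all flip: cx_simps(5,6) del: cx_simps(5,6)) (simp add: algebra_simps)
      have e: "cx x - cx y - - cx k = cx (x + k) - cx y" by simp
      have n: "cmod (cx x - cx y) = norm (y - x)" "cmod (cx (x + k) - cx y) = norm (y - (x + k))"
        by (simp_all only: cx_simps(5)[symmetric] cx_simps(3) norm_minus_commute)
      show ?thesis using stokes_kernel'_diff[OF z, of h "f y"] unfolding e n by simp
    qed
    from C(2)[OF f m _ _ this] k
    have "cmod (integral\<^sup>L lborel ?g) \<le> 6 * (cmod h * norm k) * M * C * (1 + norm x)\<^sup>2 * norm k powr (-1/2)"
      by auto
    moreover have "integral\<^sup>L lborel ?g = vel' f (x + k) h - vel' f x h"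
      unfolding vel'_def using i2[OF f] by (intro Bochner_Integration.integral_diff)
    moreover have "6 * (cmod h * norm k) * M * C * (1 + norm x)\<^sup>2 * norm k powr (-1/2)
      = 6 * cmod h * M * C * (1 + norm x)\<^sup>2 * (norm k * norm k powr (-1/2))" by (simp only: mult_ac)
    ultimately show "cmod (vel' f (x + k) h - vel' f x h) \<le> 6 * cmod h * M * C * (1 + norm x)\<^sup>2 * sqrt (norm k)"
      by (simp only: mult_powr_sqrt[OF norm_ge_zero])
  qed
qed

text \<open>The growth bound for the integral of the absolute value prepares the Fubini argument in
  \<open>cauchy_weak\<close>.\<close>

lemma cauchy_integrable:
  assumes f: "decaying q M f"
  shows "integrable lborel (\<lambda>y. f y / (cx x - cx y))"
    and "\<exists>C. \<forall>x. (\<integral>y. cmod (f y / (cx x - cx y)) \<partial>lborel) \<le> C * (1 + norm x)\<^sup>2"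
proof -
  note [measurable] = decaying_measurable[OF f]
  have n: "cmod (f y / (cx x - cx y)) = cmod (f y) / norm (y - x)" for x y
    by (simp only: norm_divide cx_simps(5)[symmetric] cx_simps(3) norm_minus_commute)
  obtain C where C: "C > 0" "\<And>f M B x (g :: real^2 \<Rightarrow> real).
    \<lbrakk>decaying q M f; g \<in> borel_measurable borel; B \<ge> 0; \<And>y. y \<noteq> x \<Longrightarrow> norm (g y) \<le> B * (cmod (f y) / norm (y - x))\<rbrakk>
    \<Longrightarrow> integrable lborel g \<and> norm (integral\<^sup>L lborel g) \<le> B * M * C * (1 + norm x)\<^sup>2"
    by (rule decaying_one_singularity[OF q(1)]) blast
  have *: "integrable lborel (\<lambda>y. cmod (f y / (cx x - cx y))) \<and> norm (\<integral>y. cmod (f y / (cx x - cx y)) \<partial>lborel) \<le> 1 * M * C * (1 + norm x)\<^sup>2" for x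
    by (rule C(2)[OF f]) (auto simp: n simp del: cx_simps(5))
  show "integrable lborel (\<lambda>y. f y / (cx x - cx y))"
    using conjunct1[OF *] by (subst (asm) integrable_norm_iff) auto
  show "\<exists>C. \<forall>x. (\<integral>y. cmod (f y / (cx x - cx y)) \<partial>lborel) \<le> C * (1 + norm x)\<^sup>2"
    using * by (intro exI[of _ "M * C"]) (auto intro: order_trans[OF abs_ge_self])
qed

lemma continuous_cauchy:
  assumes f: "decaying q M f"
  shows "continuous_on UNIV (cauchy f)"
proof -
  note [measurable] = decaying_measurable[OF f]
  obtain C where C: "C > 0" "\<And>f M B x x' (g :: real^2 \<Rightarrow> complex).
    \<lbrakk>decaying q M f; g \<in> borel_measurable borel; B \<ge> 0; x \<noteq> x';
      \<And>y. y \<noteq> x \<Longrightarrow> y \<noteq> x' \<Longrightarrow> norm (g y) \<le> B * (cmod (f y) / (norm (y - x) * norm (y - x')))\<rbrakk>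
    \<Longrightarrow> integrable lborel g \<and> norm (integral\<^sup>L lborel g) \<le> B * M * C * (1 + norm x)\<^sup>2 * norm (x - x') powr (-1/2)"
    by (rule decaying_two_singularities[OF q(1)]) blast
  show ?thesis
  proof (rule continuous_from_holder)
    fix x k :: "real^2"
    assume k: "k \<noteq> 0"
    let ?g = "\<lambda>y. f y / (cx (x + k) - cx y) - f y / (cx x - cx y)"
    have "cmod (?g y) \<le> norm k * (cmod (f y) / (norm (y - x) * norm (y - (x + k))))"
      if y: "y \<noteq> x" "y \<noteq> x + k" for y
    proof -
      have z: "cx x - cx y \<noteq> 0" "cx (x + k) - cx y \<noteq> 0"
        using y by (simp_all only: cx_simps(5)[symmetric] cx_simps(9)) auto
      have n: "cmod (cx x - cx y) = norm (y - x)" "cmod (cx (x + k) - cx y) = norm (y - (x + k))"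
        by (simp_all only: cx_simps(5)[symmetric] cx_simps(3) norm_minus_commute)
      have "f / b - f / a = (a - b) * f / (a * b)" if "a \<noteq> 0" "b \<noteq> 0" for a b f :: complex
        using that by (simp add: field_simps)
      from this[OF z] have "?g y = (cx x - cx y - (cx (x + k) - cx y)) * f y / ((cx x - cx y) * (cx (x + k) - cx y))" .
      then have "cmod (?g y) = cmod (cx x - cx y - (cx (x + k) - cx y)) * cmod (f y) / (norm (y - x) * norm (y - (x + k)))"
        by (simp only: norm_divide norm_mult n)
      also have "cx x - cx y - (cx (x + k) - cx y) = - cx k" by simp
      finally show ?thesis by simp
    qed
    from C(2)[OF f _ _ _ this] k
    have "cmod (integral\<^sup>L lborel ?g) \<le> norm k * M * C * (1 + norm x)\<^sup>2 * norm k powr (-1/2)" by auto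
    moreover have "integral\<^sup>L lborel ?g = cauchy f (x + k) - cauchy f x"
      unfolding cauchy_def using cauchy_integrable(1)[OF f] by (intro Bochner_Integration.integral_diff)
    moreover have "norm k * M * C * (1 + norm x)\<^sup>2 * norm k powr (-1/2) = M * C * (1 + norm x)\<^sup>2 * (norm k * norm k powr (-1/2))"
      by (simp only: mult_ac)
    ultimately show "cmod (cauchy f (x + k) - cauchy f x) \<le> M * C * (1 + norm x)\<^sup>2 * sqrt (norm k)"
      by (simp only: mult_powr_sqrt[OF norm_ge_zero])
  qed
qed

end

section \<open>Decay and far field\<close>

text \<open>The first moments that have to vanish for the velocity to decay faster than \<open>1/r\<close>.\<close>

definition balanced :: "(real^2 \<Rightarrow> complex) \<Rightarrow> bool" where
  "balanced f \<longleftrightarrow> (\<integral>y. f y \<partial>lborel) = 0 \<and> (\<integral>y. cx y * f y \<partial>lborel) = 0 \<and> Im (\<integral>y. cnj (cx y) * f y \<partial>lborel) = 0"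

text \<open>The second-order Taylor term of the kernel at \<open>z\<close>, integrated against
  \<open>f\<close>. It is homogeneous of degree -2 and depends on four real numbers only: two from
  the moment of \<open>(cx y)^2\<close>, two from the total coefficient of
  \<open>1 / (cnj z)^2\<close>.\<close>

definition far_profile :: "(real^2 \<Rightarrow> complex) \<Rightarrow> complex \<Rightarrow> complex" where
  "far_profile f z = - (\<integral>y. (cx y)\<^sup>2 * f y \<partial>lborel) / (2 * z\<^sup>2) - (\<integral>y. (cnj (cx y))\<^sup>2 * f y \<partial>lborel) / (2 * (cnj z)\<^sup>2)
     + cnj (\<integral>y. (cx y * cnj (cx y)) * f y \<partial>lborel) / (cnj z)\<^sup>2
     - z * cnj (\<integral>y. (cx y)\<^sup>2 * f y \<partial>lborel) / (cnj z) ^ 3"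

lemma of_real_2Re: "complex_of_real (2 * Re t) = t + cnj t"
  by (simp add: complex_eq_iff)

lemma moment_integrals:
  assumes q: "4 < q" and f: "decaying q M f"
  shows "integrable lborel f" "integrable lborel (\<lambda>y. cx y * f y)" "integrable lborel (\<lambda>y. cnj (cx y) * f y)"
    "integrable lborel (\<lambda>y. (cx y)\<^sup>2 * f y)" "integrable lborel (\<lambda>y. (cnj (cx y))\<^sup>2 * f y)"
    "integrable lborel (\<lambda>y. (cx y * cnj (cx y)) * f y)"
proof -
  have "integrable lborel (\<lambda>y. 1 * f y)"
    by (rule integrable_mult_decaying[OF q f]) (use sq_weight_bounds in auto)
  then show "integrable lborel f" by simp
  show "integrable lborel (\<lambda>y. cx y * f y)"
    by (rule integrable_mult_decaying[OF q f]) (use sq_weight_bounds in auto)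
  show "integrable lborel (\<lambda>y. cnj (cx y) * f y)"
    by (rule integrable_mult_decaying[OF q f]) (use sq_weight_bounds in auto)
  show "integrable lborel (\<lambda>y. (cx y)\<^sup>2 * f y)"
    by (rule integrable_mult_decaying[OF q f]) (use sq_weight_bounds in \<open>auto simp: norm_power\<close>)
  show "integrable lborel (\<lambda>y. (cnj (cx y))\<^sup>2 * f y)"
    by (rule integrable_mult_decaying[OF q f]) (use sq_weight_bounds in \<open>auto simp: norm_power\<close>)
  show "integrable lborel (\<lambda>y. (cx y * cnj (cx y)) * f y)"
    by (rule integrable_mult_decaying[OF q f]) (use sq_weight_bounds in \<open>auto simp: norm_mult power2_eq_square\<close>)
qed

lemma has_bochner_integral_cmult:
  "has_bochner_integral M f x \<Longrightarrow> has_bochner_integral M (\<lambda>y. c * f y) (c * (x::complex))"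
  using has_bochner_integral_bounded_linear[OF bounded_linear_mult_right] .

lemma has_bochner_integral_cnj:
  "has_bochner_integral M f x \<Longrightarrow> has_bochner_integral M (\<lambda>y. cnj (f y)) (cnj x)"
  using has_bochner_integral_bounded_linear[OF bounded_linear_cnj] .

text \<open>In the Taylor coefficients the point \<open>y\<close> enters only through monomials in
  \<open>cx y\<close> and \<open>cnj (cx y)\<close>, so their integrals are combinations of moments.
  \<open>has_bochner_integral\<close> carries integrability and value through these combinations
  together.\<close>

lemma kernel_moments:
  assumes q: "4 < q" and f: "decaying q M f"
  defines "m \<equiv> (\<integral>y. f y \<partial>lborel)" and "a \<equiv> (\<integral>y. cx y * f y \<partial>lborel)" and "b \<equiv> (\<integral>y. cnj (cx y) * f y \<partial>lborel)"
    and "c \<equiv> (\<integral>y. (cx y)\<^sup>2 * f y \<partial>lborel)" and "d \<equiv> (\<integral>y. (cnj (cx y))\<^sup>2 * f y \<partial>lborel)"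
    and "e \<equiv> (\<integral>y. (cx y * cnj (cx y)) * f y \<partial>lborel)"
  shows "has_bochner_integral lborel (\<lambda>y. stokes_kernel z (f y)) (stokes_kernel z m)"
    and "has_bochner_integral lborel (\<lambda>y. stokes_kernel' z h (f y)) (stokes_kernel' z h m)"
    and "has_bochner_integral lborel (\<lambda>y. stokes_kernel' z (cx y) (f y))
      (1 / z * a + 1 / cnj z * b - (1 / cnj z * cnj b - z / (cnj z)\<^sup>2 * cnj a))"
    and "has_bochner_integral lborel (\<lambda>y. stokes_kernel'' z (cx y) h (f y))
      (- (h / z\<^sup>2 * a + cnj h / (cnj z)\<^sup>2 * b) + (h / (cnj z)\<^sup>2 * cnj a + cnj h / (cnj z)\<^sup>2 * cnj b - 2 * z * cnj h / (cnj z) ^ 3 * cnj a))"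
    and "has_bochner_integral lborel (\<lambda>y. stokes_kernel'' z (cx y) (cx y) (f y))
      (- (1 / z\<^sup>2 * c + 1 / (cnj z)\<^sup>2 * d) + (2 / (cnj z)\<^sup>2 * cnj e - 2 * z / (cnj z) ^ 3 * cnj c))"
proof -
  note i = moment_integrals[OF q f]
  have m: "has_bochner_integral lborel f m" and a: "has_bochner_integral lborel (\<lambda>y. cx y * f y) a"
    and b: "has_bochner_integral lborel (\<lambda>y. cnj (cx y) * f y) b"
    and c: "has_bochner_integral lborel (\<lambda>y. (cx y)\<^sup>2 * f y) c"
    and d: "has_bochner_integral lborel (\<lambda>y. (cnj (cx y))\<^sup>2 * f y) d"
    and e: "has_bochner_integral lborel (\<lambda>y. (cx y * cnj (cx y)) * f y) e"
    unfolding m_def a_def b_def c_def d_def e_def by (intro has_bochner_integral_integrable i)+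
  note hb = has_bochner_integral_cmult has_bochner_integral_cnj has_bochner_integral_add has_bochner_integral_diff has_bochner_integral_minus
  have "has_bochner_integral lborel (\<lambda>y. of_real (ln ((cmod z)\<^sup>2)) * f y - z / cnj z * cnj (f y))
      (of_real (ln ((cmod z)\<^sup>2)) * m - z / cnj z * cnj m)"
    by (intro hb m)
  then show "has_bochner_integral lborel (\<lambda>y. stokes_kernel z (f y)) (stokes_kernel z m)"
    unfolding stokes_kernel_def .
  show "has_bochner_integral lborel (\<lambda>y. stokes_kernel' z h (f y)) (stokes_kernel' z h m)"
    unfolding stokes_kernel'_def by (intro hb m)
  have "has_bochner_integral lborel (\<lambda>y. 1 / z * (cx y * f y) + 1 / cnj z * (cnj (cx y) * f y)
      - (1 / cnj z * cnj (cnj (cx y) * f y) - z / (cnj z)\<^sup>2 * cnj (cx y * f y)))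
      (1 / z * a + 1 / cnj z * b - (1 / cnj z * cnj b - z / (cnj z)\<^sup>2 * cnj a))"
    by (intro hb a b)
  moreover have "stokes_kernel' z w g = 1 / z * (w * g) + 1 / cnj z * (cnj w * g)
      - (1 / cnj z * cnj (cnj w * g) - z / (cnj z)\<^sup>2 * cnj (w * g))" for w g
    unfolding stokes_kernel'_def of_real_2Re by (simp add: algebra_simps)
  ultimately show "has_bochner_integral lborel (\<lambda>y. stokes_kernel' z (cx y) (f y))
      (1 / z * a + 1 / cnj z * b - (1 / cnj z * cnj b - z / (cnj z)\<^sup>2 * cnj a))" by simp
  have "has_bochner_integral lborel (\<lambda>y. - (h / z\<^sup>2 * (cx y * f y) + cnj h / (cnj z)\<^sup>2 * (cnj (cx y) * f y))
      + (h / (cnj z)\<^sup>2 * cnj (cx y * f y) + cnj h / (cnj z)\<^sup>2 * cnj (cnj (cx y) * f y) - 2 * z * cnj h / (cnj z) ^ 3 * cnj (cx y * f y)))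
      (- (h / z\<^sup>2 * a + cnj h / (cnj z)\<^sup>2 * b) + (h / (cnj z)\<^sup>2 * cnj a + cnj h / (cnj z)\<^sup>2 * cnj b - 2 * z * cnj h / (cnj z) ^ 3 * cnj a))"
    by (intro hb a b)
  moreover have "stokes_kernel'' z w h g = - (h / z\<^sup>2 * (w * g) + cnj h / (cnj z)\<^sup>2 * (cnj w * g))
      + (h / (cnj z)\<^sup>2 * cnj (w * g) + cnj h / (cnj z)\<^sup>2 * cnj (cnj w * g) - 2 * z * cnj h / (cnj z) ^ 3 * cnj (w * g))" for w g
    unfolding stokes_kernel''_def of_real_2Re by (simp add: algebra_simps add_divide_distrib)
  ultimately show "has_bochner_integral lborel (\<lambda>y. stokes_kernel'' z (cx y) h (f y))
      (- (h / z\<^sup>2 * a + cnj h / (cnj z)\<^sup>2 * b) + (h / (cnj z)\<^sup>2 * cnj a + cnj h / (cnj z)\<^sup>2 * cnj b - 2 * z * cnj h / (cnj z) ^ 3 * cnj a))"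
    by simp
  have "has_bochner_integral lborel (\<lambda>y. - (1 / z\<^sup>2 * ((cx y)\<^sup>2 * f y) + 1 / (cnj z)\<^sup>2 * ((cnj (cx y))\<^sup>2 * f y))
      + (2 / (cnj z)\<^sup>2 * cnj ((cx y * cnj (cx y)) * f y) - 2 * z / (cnj z) ^ 3 * cnj ((cx y)\<^sup>2 * f y)))
      (- (1 / z\<^sup>2 * c + 1 / (cnj z)\<^sup>2 * d) + (2 / (cnj z)\<^sup>2 * cnj e - 2 * z / (cnj z) ^ 3 * cnj c))"
    by (intro hb c d e)
  moreover have "stokes_kernel'' z w w g = - (1 / z\<^sup>2 * (w\<^sup>2 * g) + 1 / (cnj z)\<^sup>2 * ((cnj w)\<^sup>2 * g))
      + (2 / (cnj z)\<^sup>2 * cnj ((w * cnj w) * g) - 2 * z / (cnj z) ^ 3 * cnj (w\<^sup>2 * g))" for w g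
  proof -
    have "- (w * w / Z + W * W / Y) * g + ((w * W + w * W) / Y - 2 * z * W * W / X) * G
      = - (1 / Z * (w\<^sup>2 * g) + 1 / Y * (W\<^sup>2 * g)) + (2 / Y * ((W * w) * G) - 2 * z / X * (W\<^sup>2 * G))" for Z W Y X G
      by (simp add: power2_eq_square algebra_simps add_divide_distrib)
    then show ?thesis
      unfolding stokes_kernel''_def of_real_2Re complex_cnj_mult complex_cnj_divide complex_cnj_power complex_cnj_cnj .
  qed
  ultimately show "has_bochner_integral lborel (\<lambda>y. stokes_kernel'' z (cx y) (cx y) (f y))
      (- (1 / z\<^sup>2 * c + 1 / (cnj z)\<^sup>2 * d) + (2 / (cnj z)\<^sup>2 * cnj e - 2 * z / (cnj z) ^ 3 * cnj c))"
    by (simp only:)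
qed

text \<open>The moment \<open>b\<close> of \<open>cnj (cx y) * f y\<close> enters the first-order
  terms only through \<open>b - cnj b\<close>. Its real part, which is the part that adding a
  gradient force can change, does not affect them; so besides the mean just three real conditions
  are imposed.\<close>

lemma balanced_kernel_moments:
  assumes q: "4 < q" and f: "decaying q M f" and bal: "balanced f"
  shows "has_bochner_integral lborel (\<lambda>y. stokes_kernel z (f y)) 0"
    and "has_bochner_integral lborel (\<lambda>y. stokes_kernel' z h (f y)) 0"
    and "has_bochner_integral lborel (\<lambda>y. stokes_kernel' z (cx y) (f y)) 0"
    and "has_bochner_integral lborel (\<lambda>y. stokes_kernel'' z (cx y) h (f y)) 0"
    and "has_bochner_integral lborel (\<lambda>y. stokes_kernel'' z (cx y) (cx y) (f y) / 2) (far_profile f z)"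
proof -
  have m: "(\<integral>y. f y \<partial>lborel) = 0" "(\<integral>y. cx y * f y \<partial>lborel) = 0"
    "cnj (\<integral>y. cnj (cx y) * f y \<partial>lborel) = (\<integral>y. cnj (cx y) * f y \<partial>lborel)"
    using bal by (auto simp: balanced_def complex_eq_iff)
  note k = kernel_moments[OF q f, unfolded m]
  show "has_bochner_integral lborel (\<lambda>y. stokes_kernel z (f y)) 0"
    using k(1)[of z] by (simp add: stokes_kernel_def)
  show "has_bochner_integral lborel (\<lambda>y. stokes_kernel' z h (f y)) 0"
    using k(2)[of z h] by (simp add: stokes_kernel'_def)
  show "has_bochner_integral lborel (\<lambda>y. stokes_kernel' z (cx y) (f y)) 0"
    using k(3)[of z] by simp
  show "has_bochner_integral lborel (\<lambda>y. stokes_kernel'' z (cx y) h (f y)) 0"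
    using k(4)[of z h] by simp
  have eq: "1/2 * (- (1 / Z * c + 1 / Y * d) + (2 / Y * e - 2 * z / X * c'))
     = - c / (2 * Z) - d / (2 * Y) + e / Y - z * c' / X" for c d e c' X Y Z z :: complex
    by (simp add: right_diff_distrib distrib_left)
  show "has_bochner_integral lborel (\<lambda>y. stokes_kernel'' z (cx y) (cx y) (f y) / 2) (far_profile f z)"
    using has_bochner_integral_cmult[OF k(5)[of z], of "1/2", unfolded eq] unfolding far_profile_def by simp
qed

context
  fixes q :: real
  assumes q: "4 < q" "q < 5"
begin

text \<open>Each potential is rewritten as the integral of a Taylor remainder, since the lower
  Taylor terms integrate to zero. The Riesz exponent \<open>(q - 1) / 2\<close> makes the rates of
  velocity and gradient add up to exactly \<open>q\<close>. The third bound uses the exponent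
  \<open>q - 3\<close> with a cubic weight; this exhausts the decay of \<open>f\<close> and gives
  the error exponent \<open>2 - q\<close>.\<close>

lemma vel_decay:
  obtains C where "C > 0" "\<And>f M x. \<lbrakk>decaying q M f; balanced f; x \<noteq> 0\<rbrakk> \<Longrightarrow> cmod (vel f x) \<le> C * M * norm x powr (-(q-1)/2)"
    "\<And>f M x h. \<lbrakk>decaying q M f; balanced f; x \<noteq> 0\<rbrakk> \<Longrightarrow> cmod (vel' f x h) \<le> C * M * norm x powr (-(q+1)/2) * cmod h"
    "\<And>f M x. \<lbrakk>decaying q M f; balanced f; x \<noteq> 0\<rbrakk> \<Longrightarrow> cmod (vel f x - far_profile f (cx x)) \<le> C * M * norm x powr (2-q)"
proof -
  have e: "1 < (q-1)/2" "(q-1)/2 < 2" "1 < q - 3" "q - 3 < 2" using q by auto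
  have e2: "(q-1)/2 + real 2 \<le> q" "q - 3 + real 3 \<le> q" using q by (auto simp: field_simps)
  obtain C1 where C1: "C1 > 0" "\<And>f M B x n (g :: real^2 \<Rightarrow> complex).
    \<lbrakk>decaying q M f; g \<in> borel_measurable borel; B \<ge> 0; x \<noteq> 0; (q-1)/2 + real n \<le> q;
      \<And>y. y \<noteq> 0 \<Longrightarrow> y \<noteq> x \<Longrightarrow> norm (g y) \<le> B * (norm y ^ n * cmod (f y) / norm (x - y))\<rbrakk>
    \<Longrightarrow> integrable lborel g \<and> norm (integral\<^sup>L lborel g) \<le> B * M * C1 * norm x powr (1 - (q-1)/2)"
    by (rule decaying_far_field[OF e(1,2)]) blast
  obtain C2 where C2: "C2 > 0" "\<And>f M B x n (g :: real^2 \<Rightarrow> complex).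
    \<lbrakk>decaying q M f; g \<in> borel_measurable borel; B \<ge> 0; x \<noteq> 0; q - 3 + real n \<le> q;
      \<And>y. y \<noteq> 0 \<Longrightarrow> y \<noteq> x \<Longrightarrow> norm (g y) \<le> B * (norm y ^ n * cmod (f y) / norm (x - y))\<rbrakk>
    \<Longrightarrow> integrable lborel g \<and> norm (integral\<^sup>L lborel g) \<le> B * M * C2 * norm x powr (1 - (q-3))"
    by (rule decaying_far_field[OF e(3,4)]) blast
  obtain K1 where i1: "\<And>f M x. decaying q M f \<Longrightarrow> integrable lborel (\<lambda>y. stokes_kernel (cx x - cx y) (f y))"
    by (rule vel_bound[OF q]) blast
  obtain K2 where i2: "\<And>f M x h. decaying q M f \<Longrightarrow> integrable lborel (\<lambda>y. stokes_kernel' (cx x - cx y) h (f y))"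
    by (rule vel'_bound[OF q]) blast
  have n: "cmod (cx x - cx y) = norm (x - y)" for x y
    by (simp only: cx_simps(5)[symmetric] cx_simps(3))
  have a1: "cmod (vel f x) \<le> 34 * C1 * M * norm x powr (-(q-1)/2)"
    if f: "decaying q M f" and bal: "balanced f" and x: "x \<noteq> 0" for f M x
  proof -
    note [measurable] = decaying_measurable[OF f]
    note h = balanced_kernel_moments[OF q(1) f bal]
    let ?g = "\<lambda>y. stokes_kernel (cx x - cx y) (f y) - stokes_kernel (cx x) (f y) + stokes_kernel' (cx x) (cx y) (f y)"
    have "has_bochner_integral lborel ?g (vel f x - 0 + 0)"
      unfolding vel_def by (intro has_bochner_integral_add has_bochner_integral_diff h has_bochner_integral_integrable i1[OF f])
    then have v: "vel f x = integral\<^sup>L lborel ?g" by (simp add: has_bochner_integral_iff)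
    have m: "?g \<in> borel_measurable borel"
      unfolding stokes_kernel_def stokes_kernel'_def by measurable
    have "cmod (?g y) \<le> 34 / norm x * (norm y ^ 2 * cmod (f y) / norm (x - y))" if "y \<noteq> x" for y
    proof -
      have "cx x \<noteq> 0" "cx x \<noteq> cx y" using x that by auto
      from stokes_kernel_remainder1[OF this, of "f y"] show ?thesis by (simp add: n del: cx_simps(5))
    qed
    from C1(2)[OF f m _ x e2(1) this] have "cmod (vel f x) \<le> 34 / norm x * M * C1 * norm x powr (1 - (q-1)/2)"
      using q unfolding v by simp
    also have "\<dots> = 34 * C1 * M * (norm x powr (1 - (q-1)/2) / norm x)" by simp
    also have "norm x powr (1 - (q-1)/2) / norm x = norm x powr (-(q-1)/2)"
    proof -
      have "norm x powr (1 - (q-1)/2) / norm x = norm x powr (1 - (q-1)/2) / norm x powr 1" by simp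
      also have "\<dots> = norm x powr (1 - (q-1)/2 - 1)" by (rule powr_diff[symmetric])
      also have "1 - (q-1)/2 - 1 = -(q-1)/2" by (simp add: field_simps)
      finally show ?thesis .
    qed
    finally show ?thesis .
  qed
  have a2: "cmod (vel' f x h) \<le> 8 * C1 * M * norm x powr (-(q+1)/2) * cmod h"
    if f: "decaying q M f" and bal: "balanced f" and x: "x \<noteq> 0" for f M x h
  proof -
    note [measurable] = decaying_measurable[OF f]
    note b = balanced_kernel_moments[OF q(1) f bal]
    let ?g = "\<lambda>y. stokes_kernel' (cx x - cx y) h (f y) - stokes_kernel' (cx x) h (f y) + stokes_kernel'' (cx x) (cx y) h (f y)"
    have "has_bochner_integral lborel ?g (vel' f x h - 0 + 0)"
      unfolding vel'_def by (intro has_bochner_integral_add has_bochner_integral_diff b has_bochner_integral_integrable i2[OF f])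
    then have v: "vel' f x h = integral\<^sup>L lborel ?g" by (simp add: has_bochner_integral_iff)
    have m: "?g \<in> borel_measurable borel"
      unfolding stokes_kernel''_def stokes_kernel'_def by measurable
    have "cmod (?g y) \<le> 8 * cmod h / (norm x)\<^sup>2 * (norm y ^ 2 * cmod (f y) / norm (x - y))" if "y \<noteq> x" for y
    proof -
      have "cx x \<noteq> 0" "cx x \<noteq> cx y" using x that by auto
      from stokes_kernel'_remainder[OF this, of h "f y"] show ?thesis by (simp add: n mult_ac del: cx_simps(5))
    qed
    from C1(2)[OF f m _ x e2(1) this] have "cmod (vel' f x h) \<le> 8 * cmod h / (norm x)\<^sup>2 * M * C1 * norm x powr (1 - (q-1)/2)"
      using q unfolding v by simp
    also have "\<dots> = 8 * C1 * M * (norm x powr (1 - (q-1)/2) / (norm x)\<^sup>2) * cmod h" by simp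
    also have "norm x powr (1 - (q-1)/2) / (norm x)\<^sup>2 = norm x powr (-(q+1)/2)"
    proof -
      have "norm x powr (1 - (q-1)/2) / (norm x)\<^sup>2 = norm x powr (1 - (q-1)/2) / norm x powr 2" using x by simp
      also have "\<dots> = norm x powr (1 - (q-1)/2 - 2)" by (rule powr_diff[symmetric])
      also have "1 - (q-1)/2 - 2 = -(q+1)/2" by (simp add: field_simps)
      finally show ?thesis .
    qed
    finally show ?thesis .
  qed
  have a3: "cmod (vel f x - far_profile f (cx x)) \<le> 69 * C2 * M * norm x powr (2-q)"
    if f: "decaying q M f" and bal: "balanced f" and x: "x \<noteq> 0" for f M x
  proof -
    note [measurable] = decaying_measurable[OF f]
    note b = balanced_kernel_moments[OF q(1) f bal]
    let ?g = "\<lambda>y. stokes_kernel (cx x - cx y) (f y) - stokes_kernel (cx x) (f y) + stokes_kernel' (cx x) (cx y) (f y)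
        - stokes_kernel'' (cx x) (cx y) (cx y) (f y) / 2"
    have "has_bochner_integral lborel ?g (vel f x - 0 + 0 - far_profile f (cx x))"
      unfolding vel_def by (intro has_bochner_integral_add has_bochner_integral_diff b has_bochner_integral_integrable i1[OF f])
    then have v: "vel f x - far_profile f (cx x) = integral\<^sup>L lborel ?g" by (simp add: has_bochner_integral_iff)
    have m: "?g \<in> borel_measurable borel"
      unfolding stokes_kernel''_def stokes_kernel'_def stokes_kernel_def by measurable
    have "cmod (?g y) \<le> 69 / (norm x)\<^sup>2 * (norm y ^ 3 * cmod (f y) / norm (x - y))" if "y \<noteq> x" for y
    proof -
      have "cx x \<noteq> 0" "cx x \<noteq> cx y" using x that by auto
      from stokes_kernel_remainder2[OF this, of "f y"] show ?thesis by (simp add: n del: cx_simps(5))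
    qed
    from C2(2)[OF f m _ x e2(2) this]
    have "cmod (vel f x - far_profile f (cx x)) \<le> 69 / (norm x)\<^sup>2 * M * C2 * norm x powr (1 - (q-3))"
      using q unfolding v by simp
    also have "\<dots> = 69 * C2 * M * (norm x powr (1 - (q-3)) / (norm x)\<^sup>2)" by simp
    also have "norm x powr (1 - (q-3)) / (norm x)\<^sup>2 = norm x powr (2-q)"
    proof -
      have "norm x powr (1 - (q-3)) / (norm x)\<^sup>2 = norm x powr (1 - (q-3)) / norm x powr 2" using x by simp
      also have "\<dots> = norm x powr (1 - (q-3) - 2)" by (rule powr_diff[symmetric])
      also have "1 - (q-3) - 2 = 2 - q" by simp
      finally show ?thesis .
    qed
    finally show ?thesis .
  qed
  have up: "A * M * r \<le> (34 * C1 + 69 * C2) * M * r" if "decaying q M f" "r \<ge> 0" "A \<le> 34 * C1 + 69 * C2" for A M r f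
    using that decaying_nonneg[OF that(1)] by (intro mult_right_mono) auto
  show thesis
  proof (rule that[of "34 * C1 + 69 * C2"])
    show "34 * C1 + 69 * C2 > 0" using C1(1) C2(1) by simp
    show "cmod (vel f x) \<le> (34 * C1 + 69 * C2) * M * norm x powr (-(q-1)/2)"
      if "decaying q M f" "balanced f" "x \<noteq> 0" for f M x
      using C2(1) by (intro order_trans[OF a1[OF that] up[OF that(1)]]) auto
    show "cmod (vel' f x h) \<le> (34 * C1 + 69 * C2) * M * norm x powr (-(q+1)/2) * cmod h"
      if "decaying q M f" "balanced f" "x \<noteq> 0" for f M x h
      using C1(1) C2(1) by (intro order_trans[OF a2[OF that] mult_right_mono[OF up[OF that(1)]]]) auto
    show "cmod (vel f x - far_profile f (cx x)) \<le> (34 * C1 + 69 * C2) * M * norm x powr (2-q)"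
      if "decaying q M f" "balanced f" "x \<noteq> 0" for f M x
      using C1(1) by (intro order_trans[OF a3[OF that] up[OF that(1)]]) auto
  qed
qed

end

section \<open>The Cauchy transform and the weak Stokes equation\<close>

lemma integral_affine:
  fixes f :: "'a::euclidean_space \<Rightarrow> 'b::{banach, second_countable_topology}"
  assumes [measurable]: "f \<in> borel_measurable borel" and c: "c \<noteq> 0"
  shows "(\<integral>x. f x \<partial>lborel) = (\<bar>c\<bar> ^ DIM('a)) *\<^sub>R (\<integral>x. f (t + c *\<^sub>R x) \<partial>lborel)"
proof -
  have "(\<integral>x. f x \<partial>lborel) = (\<integral>x. f x \<partial>density (distr lborel borel (\<lambda>x. t + c *\<^sub>R x)) (\<lambda>_. ennreal (\<bar>c\<bar> ^ DIM('a))))"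
    by (subst lborel_affine[OF c, of t]) (rule refl)
  also have "\<dots> = (\<integral>x. (\<bar>c\<bar> ^ DIM('a)) *\<^sub>R f x \<partial>distr lborel borel (\<lambda>x. t + c *\<^sub>R x))"
    by (subst integral_density) auto
  also have "\<dots> = (\<integral>x. (\<bar>c\<bar> ^ DIM('a)) *\<^sub>R f (t + c *\<^sub>R x) \<partial>lborel)"
    by (subst integral_distr) auto
  finally show ?thesis by simp
qed

text \<open>This constant is \<open>\<pi>\<close>, but only its positivity matters: it normalises the Cauchy kernel.\<close>

definition poisson_mass :: real where
  "poisson_mass = (\<integral>w. 1 / (1 + (norm (w::real^2))\<^sup>2)\<^sup>2 \<partial>lborel)"

lemma poisson_kernel_bound: "1 / (1 + (norm (w::real^2))\<^sup>2)\<^sup>2 \<le> 4 / (1 + norm w) ^ 3"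
proof -
  let ?t = "norm w"
  have p: "0 < 1 + ?t" by (simp add: add_pos_nonneg)
  have "0 \<le> (1 - ?t)\<^sup>2" by simp
  then have "(1 + ?t)\<^sup>2 \<le> 2 * (1 + ?t\<^sup>2)" by (simp add: power2_eq_square algebra_simps)
  from power_mono[OF this, of 2] have "((1 + ?t)\<^sup>2)\<^sup>2 \<le> 4 * (1 + ?t\<^sup>2)\<^sup>2" unfolding power_mult_distrib by simp
  moreover have "(1 + ?t) ^ 3 \<le> (1 + ?t) ^ 4" by (rule power_increasing) auto
  ultimately have "(1 + ?t) ^ 3 \<le> 4 * (1 + ?t\<^sup>2)\<^sup>2" by (simp flip: power_mult)
  then have "4 / (4 * (1 + ?t\<^sup>2)\<^sup>2) \<le> 4 / (1 + ?t) ^ 3"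
    using p by (intro frac_le zero_less_power) auto
  then show ?thesis by simp
qed

lemma poisson_kernel_integrable: "integrable lborel (\<lambda>w::real^2. 1 / (1 + (norm w)\<^sup>2)\<^sup>2)"
  by (rule integrable_cube[of _ 4]) (use poisson_kernel_bound in auto)

lemma poisson_mass_pos: "poisson_mass > 0"
proof -
  have p: "0 < 1 / (1 + (norm (w::real^2))\<^sup>2)\<^sup>2" for w
    by (intro divide_pos_pos zero_less_power add_pos_nonneg) auto
  have "poisson_mass \<noteq> 0"
  proof
    assume "poisson_mass = 0"
    then have "AE w::real^2 in lborel. 1 / (1 + (norm w)\<^sup>2)\<^sup>2 = 0"
      unfolding poisson_mass_def using poisson_kernel_integrable p
      by (subst (asm) integral_nonneg_eq_0_iff_AE) (auto intro: less_imp_le)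
    then have "AE w::real^2 in lborel. False" using p by (auto elim!: eventually_mono simp: less_le)
    then show False using AE_iff_measurable[of UNIV "lborel :: (real^2) measure" "\<lambda>_. False"] by simp
  qed
  moreover have "poisson_mass \<ge> 0" unfolding poisson_mass_def by (intro integral_nonneg_AE) auto
  ultimately show ?thesis by simp
qed

definition dbar :: "(real^2 \<Rightarrow> real) \<Rightarrow> real^2 \<Rightarrow> complex" where
  "dbar \<phi> x = Complex (partial_deriv 1 \<phi> x) (partial_deriv 2 \<phi> x) / 2"

lemma continuous_on_Complex[continuous_intros]:
  "continuous_on S f \<Longrightarrow> continuous_on S g \<Longrightarrow> continuous_on S (\<lambda>x. Complex (f x) (g x))"
  unfolding Complex_eq by (intro continuous_intros)

lemma dbar_tfun:
  assumes "tfun \<phi>"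
  shows "continuous_on UNIV (dbar \<phi>)" "\<exists>R. \<forall>x. R < norm x \<longrightarrow> dbar \<phi> x = 0"
proof -
  note t = tfun_partial_deriv[OF assms]
  show "continuous_on UNIV (dbar \<phi>)" unfolding dbar_def by (intro continuous_intros tfun_continuous t) auto
  obtain R where R: "\<And>x. R < norm x \<Longrightarrow> partial_deriv 1 \<phi> x = 0" using t[of 1] by (auto simp: tfun_def)
  obtain R' where R': "\<And>x. R' < norm x \<Longrightarrow> partial_deriv 2 \<phi> x = 0" using t[of 2] by (auto simp: tfun_def)
  show "\<exists>R. \<forall>x. R < norm x \<longrightarrow> dbar \<phi> x = 0"
    using R R' by (intro exI[of _ "max R R'"]) (auto simp: dbar_def Complex_eq_0)
qed

lemma compact_support_decaying:
  fixes g :: "real^2 \<Rightarrow> complex"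
  assumes c: "continuous_on UNIV g" and R: "\<And>x. R < norm x \<Longrightarrow> g x = 0" and q: "q > 0"
  obtains M where "decaying q M g"
proof -
  have "continuous_on UNIV (\<lambda>x. (1 + norm x powr q) *\<^sub>R g x)" using q by (intro continuous_intros c continuous_on_powr') auto
  then obtain B where B: "B \<ge> 0" "\<And>x. norm ((1 + norm x powr q) *\<^sub>R g x) \<le> B / (1 + norm x) ^ 3"
    using compact_support_bound[of "\<lambda>x. (1 + norm x powr q) *\<^sub>R g x" R] R by auto
  have "cmod (g x) \<le> B / (1 + norm x powr q)" for x
  proof -
    have p: "0 < 1 + norm x powr q" by (simp add: add_pos_nonneg)
    have "B / (1 + norm x) ^ 3 \<le> B / 1" using B(1) by (intro frac_le one_le_power) auto
    then have "(1 + norm x powr q) * cmod (g x) \<le> B" using B(2)[of x] p by simp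
    then show ?thesis using p by (simp add: pos_le_divide_eq mult.commute)
  qed
  then show thesis using that c by (auto simp: decaying_def)
qed

context
  fixes q :: real
  assumes q: "4 < q" "q < 5"
begin

text \<open>The Cauchy-Pompeiu formula for compactly supported functions. Integrating by parts
  against a smoothed kernel replaces the excision of a small disc and its boundary integral; both
  sides then converge by dominated convergence.\<close>

lemma cauchy_dbar:
  assumes t: "tfun \<phi>"
  shows "cauchy (dbar \<phi>) y = poisson_mass * \<phi> y"
proof -
  obtain R where R: "\<And>x. R < norm x \<Longrightarrow> dbar \<phi> x = 0" using dbar_tfun(2)[OF t] by blast
  obtain M where M: "decaying q M (dbar \<phi>)"
    using compact_support_decaying[OF dbar_tfun(1)[OF t] R, of R q] q by auto
  note [measurable] = decaying_measurable[OF M]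
  have ci: "integrable lborel (\<lambda>x. dbar \<phi> x / (cx y - cx x))" by (rule cauchy_integrable(1)[OF q M])
  define \<delta> where "\<delta> n = inverse (real (Suc n))" for n
  have d: "\<delta> n > 0" for n by (simp add: \<delta>_def)
  have d0: "\<delta> \<longlonglongrightarrow> 0" unfolding \<delta>_def by (rule LIMSEQ_inverse_real_of_nat)
  define s where "s n x = (norm (x - y))\<^sup>2 + (\<delta> n)\<^sup>2" for n x
  have s: "s n x > 0" for n x using d[of n] by (simp add: s_def add_nonneg_pos)
  have cs[continuous_intros]: "continuous_on UNIV (s n)" for n unfolding s_def by (intro continuous_intros)
  \<comment> \<open>A smooth regularisation of \<open>1 / z\<close> whose \<open>dbar\<close> derivative is an approximate identity.\<close>
  define G where "G n x = (1 / s n x) *\<^sub>R cnj (cx (x - y))" for n x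
  define G' where "G' n x h = (1 / s n x) *\<^sub>R cnj (cx h) + (- (2 * ((x - y) \<bullet> h)) / (s n x)\<^sup>2) *\<^sub>R cnj (cx (x - y))" for n x h
  have "bounded_linear (\<lambda>h. cnj (cx h))"
    by (rule bounded_linear_compose[OF bounded_linear_cnj bounded_linear_cx])
  note dcx = bounded_linear.has_derivative[OF this]
  have dG: "(G n has_derivative G' n x) (at x)" for n x
  proof -
    have 1: "((\<lambda>x. (norm (x - y))\<^sup>2) has_derivative (\<lambda>h. 2 * ((x - y) \<bullet> h))) (at x)"
      unfolding power2_norm_eq_inner by (auto intro!: derivative_eq_intros simp: inner_commute)
    have 2: "((\<lambda>x. s n x) has_derivative (\<lambda>h. 2 * ((x - y) \<bullet> h))) (at x)"
      unfolding s_def by (rule has_derivative_eq_rhs[OF has_derivative_add[OF 1 has_derivative_const]]) simp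
    have 3: "((\<lambda>x. 1 / s n x) has_derivative (\<lambda>h. - (2 * ((x - y) \<bullet> h)) / (s n x)\<^sup>2)) (at x)"
      using s[of n x] by (auto intro!: derivative_eq_intros 2 simp: power2_eq_square divide_inverse)
    have 4: "((\<lambda>x. cnj (cx (x - y))) has_derivative (\<lambda>h. cnj (cx h))) (at x)"
      by (rule has_derivative_eq_rhs[OF dcx]) (auto intro!: derivative_eq_intros)
    show ?thesis
      unfolding G_def G'_def by (rule has_derivative_eq_rhs[OF has_derivative_scaleR[OF 3 4]]) simp
  qed
  have cG': "continuous_on UNIV (\<lambda>x. G' n x h)" for n h
    unfolding G'_def using s by (intro continuous_intros) (auto simp: less_imp_neq[symmetric])
  have ax: "cx (axis 1 1) = 1" "cx (axis 2 1) = \<i>" by (simp_all add: complex_eq_iff axis_def)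
  \<comment> \<open>The left side is twice the \<open>dbar\<close> derivative of \<open>G n\<close>;
    subtracting the squared distance from \<open>s n x\<close> leaves only the square of
    \<open>\<delta> n\<close> in the numerator.\<close>
  have dbarG: "G' n x (axis 1 1) + \<i> * G' n x (axis 2 1) = of_real (2 * ((\<delta> n)\<^sup>2 / (s n x)\<^sup>2))" for n x
  proof -
    let ?z = "cx (x - y)"
    have in12: "(x - y) \<bullet> axis 1 1 = Re ?z" "(x - y) \<bullet> axis 2 1 = Im ?z" by (simp_all add: inner_axis)
    have zz: "Re ?z * Re ?z + Im ?z * Im ?z = s n x - (\<delta> n)\<^sup>2"
      by (simp add: s_def norm_plane power2_eq_square)
    have "G' n x (axis 1 1) + \<i> * G' n x (axis 2 1)
      = of_real (2 / s n x - 2 * (Re ?z * Re ?z + Im ?z * Im ?z) / (s n x)\<^sup>2)"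
      unfolding G'_def in12 ax by (simp add: complex_eq_iff algebra_simps add_divide_distrib diff_divide_distrib del: cx_simps(5))
    also have "\<dots> = of_real (2 * ((\<delta> n)\<^sup>2 / (s n x)\<^sup>2))"
      unfolding zz using s[of n x] by (simp add: field_simps power2_eq_square)
    finally show ?thesis .
  qed
  have ibp: "(\<integral>x. dbar \<phi> x * G n x \<partial>lborel) = - (\<integral>x. of_real (\<phi> x * ((\<delta> n)\<^sup>2 / (s n x)\<^sup>2)) \<partial>lborel)" for n
  proof -
    note p1 = integral_by_parts[OF t dG[of n] cG'[of n "axis 1 1"]]
      and p2 = integral_by_parts[OF t dG[of n] cG'[of n "axis 2 1"]]
    have e: "(1/2) * (partial_deriv 1 \<phi> x *\<^sub>R G n x) + (\<i>/2) * (partial_deriv 2 \<phi> x *\<^sub>R G n x) = dbar \<phi> x * G n x" for x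
      by (simp add: dbar_def Complex_eq scaleR_conv_of_real algebra_simps add_divide_distrib)
    note hb = has_bochner_integral_add[OF has_bochner_integral_cmult[OF has_bochner_integral_integrable]
        has_bochner_integral_cmult[OF has_bochner_integral_integrable]]
    from hb[OF p1(3) p2(3), of "1/2" "\<i>/2", unfolded e]
    have "(\<integral>x. dbar \<phi> x * G n x \<partial>lborel) = (1/2) * (\<integral>x. partial_deriv 1 \<phi> x *\<^sub>R G n x \<partial>lborel) + (\<i>/2) * (\<integral>x. partial_deriv 2 \<phi> x *\<^sub>R G n x \<partial>lborel)"
      by (rule has_bochner_integral_integral_eq)
    also have "\<dots> = - ((1/2) * (\<integral>x. \<phi> x *\<^sub>R G' n x (axis 1 1) \<partial>lborel) + (\<i>/2) * (\<integral>x. \<phi> x *\<^sub>R G' n x (axis 2 1) \<partial>lborel))"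
      unfolding p1(1) p2(1) by simp
    also have "(1/2) * (\<integral>x. \<phi> x *\<^sub>R G' n x (axis 1 1) \<partial>lborel) + (\<i>/2) * (\<integral>x. \<phi> x *\<^sub>R G' n x (axis 2 1) \<partial>lborel)
       = (\<integral>x. (1/2) * (\<phi> x *\<^sub>R G' n x (axis 1 1)) + (\<i>/2) * (\<phi> x *\<^sub>R G' n x (axis 2 1)) \<partial>lborel)"
      using hb[OF p1(2) p2(2), of "1/2" "\<i>/2"] by (rule has_bochner_integral_integral_eq[symmetric])
    also have "(\<lambda>x. (1/2) * (\<phi> x *\<^sub>R G' n x (axis 1 1)) + (\<i>/2) * (\<phi> x *\<^sub>R G' n x (axis 2 1)))
      = (\<lambda>x. of_real (\<phi> x * ((\<delta> n)\<^sup>2 / (s n x)\<^sup>2)))"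
    proof
      fix x
      have "(1/2) * (\<phi> x *\<^sub>R G' n x (axis 1 1)) + (\<i>/2) * (\<phi> x *\<^sub>R G' n x (axis 2 1))
        = \<phi> x *\<^sub>R ((G' n x (axis 1 1) + \<i> * G' n x (axis 2 1)) / 2)"
        by (simp add: scaleR_conv_of_real algebra_simps add_divide_distrib)
      then show "(1/2) * (\<phi> x *\<^sub>R G' n x (axis 1 1)) + (\<i>/2) * (\<phi> x *\<^sub>R G' n x (axis 2 1)) = of_real (\<phi> x * ((\<delta> n)\<^sup>2 / (s n x)\<^sup>2))"
        unfolding dbarG by (simp add: scaleR_conv_of_real)
    qed
    finally show ?thesis .
  qed
  have lim1: "(\<lambda>n. \<integral>x. dbar \<phi> x * G n x \<partial>lborel) \<longlonglongrightarrow> (\<integral>x. - (dbar \<phi> x / (cx y - cx x)) \<partial>lborel)"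
  \<comment> \<open>The singular limit dominates the whole sequence, since
    \<open>t / (t^2 + \<delta>^2) <= 1 / t\<close>.\<close>
  proof (rule integral_dominated_convergence[where w="\<lambda>x. cmod (dbar \<phi> x / (cx y - cx x))"])
    show "(\<lambda>x. - (dbar \<phi> x / (cx y - cx x))) \<in> borel_measurable lborel" by measurable
    have "G n \<in> borel_measurable borel" for n
      using dG by (intro borel_measurable_continuous_onI) (meson has_derivative_continuous continuous_at_imp_continuous_on)
    then show "(\<lambda>x. dbar \<phi> x * G n x) \<in> borel_measurable lborel" for n by measurable
    show "integrable lborel (\<lambda>x. cmod (dbar \<phi> x / (cx y - cx x)))" using ci by simp
    show "AE x in lborel. (\<lambda>n. dbar \<phi> x * G n x) \<longlonglongrightarrow> - (dbar \<phi> x / (cx y - cx x))"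
      using AE_lborel_singleton[of y]
    proof eventually_elim
      case (elim x)
      have nz: "(norm (x - y))\<^sup>2 \<noteq> 0" using elim by simp
      have "(\<lambda>n. dbar \<phi> x * ((1 / ((norm (x - y))\<^sup>2 + (\<delta> n)\<^sup>2)) *\<^sub>R cnj (cx (x - y)))) \<longlonglongrightarrow> dbar \<phi> x * ((1 / ((norm (x - y))\<^sup>2 + 0\<^sup>2)) *\<^sub>R cnj (cx (x - y)))"
        by (intro tendsto_intros d0) (use nz in auto)
      moreover have "dbar \<phi> x * ((1 / ((norm (x - y))\<^sup>2 + 0\<^sup>2)) *\<^sub>R cnj (cx (x - y))) = - (dbar \<phi> x / (cx y - cx x))"
      proof -
        have "complex_of_real ((norm (x - y))\<^sup>2) = cx (x - y) * cnj (cx (x - y))"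
          using complex_norm_square[of "cx (x - y)"] by (simp only: cx_simps(3))
        moreover have "cx (x - y) \<noteq> 0" using elim by (simp del: cx_simps(5))
        ultimately have "(1 / ((norm (x - y))\<^sup>2 + 0\<^sup>2)) *\<^sub>R cnj (cx (x - y)) = 1 / cx (x - y)"
          by (simp add: scaleR_conv_of_real del: cx_simps(5) of_real_power)
        moreover have "cx y - cx x = - cx (x - y)" by simp
        ultimately show ?thesis by (simp del: cx_simps(5))
      qed
      ultimately show ?case unfolding G_def s_def by simp
    qed
    show "AE x in lborel. cmod (dbar \<phi> x * G n x) \<le> cmod (dbar \<phi> x / (cx y - cx x))" for n
      using AE_lborel_singleton[of y]
    proof eventually_elim
      case (elim x)
      have "cmod (G n x) = norm (x - y) / s n x"
        using s[of n x] by (simp add: G_def del: cx_simps(5))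
      also have "\<dots> \<le> norm (x - y) / (norm (x - y))\<^sup>2"
        using elim by (intro divide_left_mono) (auto simp: s_def intro!: add_pos_nonneg mult_pos_pos)
      also have "\<dots> = 1 / norm (x - y)" using elim by (simp add: power2_eq_square)
      finally have "cmod (dbar \<phi> x) * cmod (G n x) \<le> cmod (dbar \<phi> x) * (1 / norm (x - y))" by (intro mult_left_mono) auto
      then show ?case
        by (simp only: norm_mult norm_divide cx_simps(5)[symmetric] cx_simps(3) norm_minus_commute[of y]) simp
    qed
  qed
  obtain B where B: "\<And>x. \<bar>\<phi> x\<bar> \<le> B"
  proof -
    obtain R where R: "\<And>x. R < norm x \<Longrightarrow> \<phi> x = 0" using t by (auto simp: tfun_def)
    obtain B where B: "B \<ge> 0" "\<And>x. norm (\<phi> x) \<le> B / (1 + norm x) ^ 3"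
      using compact_support_bound[OF tfun_continuous[OF t] R] by blast
    have "\<bar>\<phi> x\<bar> \<le> B" for x
    proof -
      have "B / (1 + norm x) ^ 3 \<le> B / 1" using B(1) by (intro frac_le one_le_power) auto
      then show ?thesis using B(2)[of x] by simp
    qed
    then show thesis by (rule that)
  qed
  have c\<phi>: "continuous_on UNIV \<phi>" by (rule tfun_continuous[OF t])
  then have m\<phi>[measurable]: "\<phi> \<in> borel_measurable borel" by (rule borel_measurable_continuous_onI)
  \<comment> \<open>With \<open>x = y + \<delta> w\<close> the area factor cancels, and the
    concentrating kernel becomes one fixed integrable function.\<close>
  have scale: "(\<integral>x. \<phi> x * ((\<delta> n)\<^sup>2 / (s n x)\<^sup>2) \<partial>lborel) = (\<integral>w. \<phi> (y + \<delta> n *\<^sub>R w) * (1 / (1 + (norm w)\<^sup>2)\<^sup>2) \<partial>lborel)" for n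
  proof -
    have [measurable]: "s n \<in> borel_measurable borel" by (rule borel_measurable_continuous_onI[OF cs])
    have e: "(\<delta> n)\<^sup>2 * (\<phi> (y + \<delta> n *\<^sub>R w) * ((\<delta> n)\<^sup>2 / (s n (y + \<delta> n *\<^sub>R w))\<^sup>2)) = \<phi> (y + \<delta> n *\<^sub>R w) * (1 / (1 + (norm w)\<^sup>2)\<^sup>2)" for w
    proof -
      have "s n (y + \<delta> n *\<^sub>R w) = (\<delta> n)\<^sup>2 * (1 + (norm w)\<^sup>2)"
        using d[of n] by (simp add: s_def power_mult_distrib algebra_simps)
      then show ?thesis using d[of n] by (simp add: power_mult_distrib power2_eq_square)
    qed
    have "(\<integral>x. \<phi> x * ((\<delta> n)\<^sup>2 / (s n x)\<^sup>2) \<partial>lborel)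
      = \<bar>\<delta> n\<bar> ^ DIM(real^2) *\<^sub>R (\<integral>w. \<phi> (y + \<delta> n *\<^sub>R w) * ((\<delta> n)\<^sup>2 / (s n (y + \<delta> n *\<^sub>R w))\<^sup>2) \<partial>lborel)"
      by (rule integral_affine) (use d[of n] in auto)
    also have "\<dots> = (\<integral>w. (\<delta> n)\<^sup>2 * (\<phi> (y + \<delta> n *\<^sub>R w) * ((\<delta> n)\<^sup>2 / (s n (y + \<delta> n *\<^sub>R w))\<^sup>2)) \<partial>lborel)"
      by (simp only: integral_mult_right_zero) (simp add: DIM_cart)
    finally show ?thesis unfolding e .
  qed
  have lim2: "(\<lambda>n. \<integral>w. \<phi> (y + \<delta> n *\<^sub>R w) * (1 / (1 + (norm w)\<^sup>2)\<^sup>2) \<partial>lborel) \<longlonglongrightarrow> (\<integral>w. \<phi> y * (1 / (1 + (norm (w::real^2))\<^sup>2)\<^sup>2) \<partial>lborel)"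
  proof (rule integral_dominated_convergence[where w="\<lambda>w. B * (1 / (1 + (norm w)\<^sup>2)\<^sup>2)"])
    show "integrable lborel (\<lambda>w::real^2. B * (1 / (1 + (norm w)\<^sup>2)\<^sup>2))" by (intro integrable_mult_right poisson_kernel_integrable)
    show "AE w in lborel. (\<lambda>n. \<phi> (y + \<delta> n *\<^sub>R w) * (1 / (1 + (norm w)\<^sup>2)\<^sup>2)) \<longlonglongrightarrow> \<phi> y * (1 / (1 + (norm w)\<^sup>2)\<^sup>2)"
    proof (rule AE_I2, intro tendsto_mult_right)
      fix w
      have "(\<lambda>n. y + \<delta> n *\<^sub>R w) \<longlonglongrightarrow> y + 0 *\<^sub>R w" by (intro tendsto_intros d0)
      moreover have "isCont \<phi> y" using c\<phi> by (simp add: continuous_on_eq_continuous_at)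
      ultimately show "(\<lambda>n. \<phi> (y + \<delta> n *\<^sub>R w)) \<longlonglongrightarrow> \<phi> y" using isCont_tendsto_compose by fastforce
    qed
    show "AE w in lborel. norm (\<phi> (y + \<delta> n *\<^sub>R w) * (1 / (1 + (norm w)\<^sup>2)\<^sup>2)) \<le> B * (1 / (1 + (norm w)\<^sup>2)\<^sup>2)" for n
      using B by (intro AE_I2) (auto simp: abs_mult intro!: divide_right_mono)
  qed auto
  have "(\<lambda>n. - complex_of_real (\<integral>w. \<phi> (y + \<delta> n *\<^sub>R w) * (1 / (1 + (norm w)\<^sup>2)\<^sup>2) \<partial>lborel)) \<longlonglongrightarrow> - of_real (\<integral>w. \<phi> y * (1 / (1 + (norm (w::real^2))\<^sup>2)\<^sup>2) \<partial>lborel)"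
    by (intro tendsto_intros lim2)
  moreover have "- complex_of_real (\<integral>w. \<phi> (y + \<delta> n *\<^sub>R w) * (1 / (1 + (norm w)\<^sup>2)\<^sup>2) \<partial>lborel) = (\<integral>x. dbar \<phi> x * G n x \<partial>lborel)" for n
    unfolding ibp scale[symmetric] integral_complex_of_real ..
  ultimately have "(\<integral>x. - (dbar \<phi> x / (cx y - cx x)) \<partial>lborel) = - of_real (\<integral>w. \<phi> y * (1 / (1 + (norm (w::real^2))\<^sup>2)\<^sup>2) \<partial>lborel)"
    using LIMSEQ_unique[OF lim1] by simp
  moreover have "(\<integral>x. - (dbar \<phi> x / (cx y - cx x)) \<partial>lborel) = - cauchy (dbar \<phi>) y" by (simp add: cauchy_def)
  moreover have "(\<integral>w. \<phi> y * (1 / (1 + (norm (w::real^2))\<^sup>2)\<^sup>2) \<partial>lborel) = \<phi> y * poisson_mass"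
    unfolding poisson_mass_def by (rule integral_mult_right_zero)
  ultimately show ?thesis by (simp add: mult.commute)
qed

text \<open>Fubini moves the Cauchy transform from \<open>f\<close> to \<open>dbar \<phi>\<close>,
  where \<open>cauchy_dbar\<close> evaluates it; the minus sign is the antisymmetry of the
  kernel.\<close>

lemma cauchy_weak:
  assumes f: "decaying q M f" and t: "tfun \<phi>"
  shows "(\<integral>x. cauchy f x * dbar \<phi> x \<partial>lborel) = - (poisson_mass *\<^sub>R (\<integral>y. \<phi> y *\<^sub>R f y \<partial>lborel))"
    and "integrable lborel (\<lambda>x. cauchy f x * dbar \<phi> x)"
proof -
  obtain R where R: "\<And>x. R < norm x \<Longrightarrow> dbar \<phi> x = 0" using dbar_tfun(2)[OF t] by blast
  obtain N where N: "decaying q N (dbar \<phi>)"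
    using compact_support_decaying[OF dbar_tfun(1)[OF t] R, of R q] q by auto
  note [measurable] = decaying_measurable[OF f] decaying_measurable[OF N]
  obtain C where C: "\<And>x. (\<integral>y. cmod (f y / (cx x - cx y)) \<partial>lborel) \<le> C * (1 + norm x)\<^sup>2"
    using cauchy_integrable(2)[OF q f] by blast
  note ci = cauchy_integrable(1)[OF q f]
  let ?F = "\<lambda>x y. f y / (cx x - cx y) * dbar \<phi> x"
  \<comment> \<open>The integral over \<open>y\<close> grows at most quadratically in
    \<open>x\<close>, which the compact support of \<open>dbar \<phi>\<close> absorbs.\<close>
  have wi: "integrable lborel (\<lambda>x. C * cmod (of_real ((1 + norm x)\<^sup>2) * dbar \<phi> x))"
  proof (intro integrable_mult_right integrable_norm integrable_mult_decaying[OF q(1) N])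
    show "cmod (of_real ((1 + norm x)\<^sup>2)) \<le> (1 + norm x)\<^sup>2" for x :: "real^2" unfolding norm_of_real by simp
  qed measurable
  have "integrable (lborel \<Otimes>\<^sub>M lborel) (case_prod ?F)"
  proof (rule lborel_pair.Fubini_integrable)
    show "case_prod ?F \<in> borel_measurable (lborel \<Otimes>\<^sub>M lborel)" by measurable
    have "AE x in lborel. norm (\<integral>y. norm (case_prod ?F (x, y)) \<partial>lborel) \<le> C * cmod (of_real ((1 + norm x)\<^sup>2) * dbar \<phi> x)"
    proof (rule AE_I2)
      fix x
      have "(\<integral>y. norm (case_prod ?F (x, y)) \<partial>lborel) = (\<integral>y. cmod (f y / (cx x - cx y)) \<partial>lborel) * cmod (dbar \<phi> x)"
        by (simp only: prod.case norm_mult integral_mult_left_zero)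
      moreover have "\<dots> \<le> C * (1 + norm x)\<^sup>2 * cmod (dbar \<phi> x)" by (intro mult_right_mono C) auto
      moreover have "0 \<le> (\<integral>y. norm (case_prod ?F (x, y)) \<partial>lborel)" by simp
      moreover have "cmod (of_real ((1 + norm x)\<^sup>2) * dbar \<phi> x) = (1 + norm x)\<^sup>2 * cmod (dbar \<phi> x)"
        by (simp only: norm_mult norm_of_real) simp
      ultimately show "norm (\<integral>y. norm (case_prod ?F (x, y)) \<partial>lborel) \<le> C * cmod (of_real ((1 + norm x)\<^sup>2) * dbar \<phi> x)"
        by (simp only: real_norm_def abs_of_nonneg mult.assoc)
    qed
    then show "integrable lborel (\<lambda>x. \<integral>y. norm (case_prod ?F (x, y)) \<partial>lborel)"
      by (intro integral_dominated(1)[OF _ wi]) measurable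
    show "AE x in lborel. integrable lborel (\<lambda>y. case_prod ?F (x, y))"
      unfolding prod.case by (intro AE_I2 integrable_mult_left ci)
  qed
  note F = this
  have eq: "cauchy f x * dbar \<phi> x = (\<integral>y. ?F x y \<partial>lborel)" for x
    unfolding cauchy_def by (rule integral_mult_left_zero[symmetric])
  show "integrable lborel (\<lambda>x. cauchy f x * dbar \<phi> x)"
    unfolding eq using lborel_pair.integrable_fst'[OF F] by simp
  have "(\<integral>x. cauchy f x * dbar \<phi> x \<partial>lborel) = (\<integral>x. (\<integral>y. ?F x y \<partial>lborel) \<partial>lborel)"
    unfolding eq ..
  also have "\<dots> = (\<integral>y. (\<integral>x. ?F x y \<partial>lborel) \<partial>lborel)"
    by (rule lborel_pair.Fubini_integral[OF F, symmetric])
  also have "\<dots> = (\<integral>y. - (poisson_mass *\<^sub>R (\<phi> y *\<^sub>R f y)) \<partial>lborel)"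
  proof (rule Bochner_Integration.integral_cong)
    fix y
    have "(\<lambda>x. ?F x y) = (\<lambda>x. - f y * (dbar \<phi> x / (cx y - cx x)))"
    proof
      fix x
      have "cx x - cx y = - (cx y - cx x)" by simp
      then show "?F x y = - f y * (dbar \<phi> x / (cx y - cx x))" by (simp only: divide_minus_right) simp
    qed
    then have "(\<integral>x. ?F x y \<partial>lborel) = - f y * cauchy (dbar \<phi>) y"
      unfolding cauchy_def by (simp only: integral_mult_right_zero)
    also have "\<dots> = - (poisson_mass *\<^sub>R (\<phi> y *\<^sub>R f y))"
      unfolding cauchy_dbar[OF t] by (simp add: scaleR_conv_of_real)
    finally show "(\<integral>x. ?F x y \<partial>lborel) = - (poisson_mass *\<^sub>R (\<phi> y *\<^sub>R f y))" .
  qed simp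
  finally show "(\<integral>x. cauchy f x * dbar \<phi> x \<partial>lborel) = - (poisson_mass *\<^sub>R (\<integral>y. \<phi> y *\<^sub>R f y \<partial>lborel))"
    by (simp only: integral_minus integral_scaleR_right)
qed

text \<open>Up to a factor, the holomorphic Wirtinger derivative of the velocity is \<open>H - cnj H\<close> for the Cauchy transform \<open>H\<close>:
  the real part of \<open>H\<close> gives the pressure and its imaginary part the vorticity.\<close>

lemma vel'_cauchy:
  assumes f: "decaying q M f"
  shows "vel' f x 1 - \<i> * vel' f x \<i> = 2 * (cauchy f x - cnj (cauchy f x))"
proof -
  obtain K :: real where i: "\<And>f M x h. decaying q M f \<Longrightarrow> integrable lborel (\<lambda>y. stokes_kernel' (cx x - cx y) h (f y))"
    by (rule vel'_bound[OF q]) blast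
  have "stokes_kernel' z 1 g - \<i> * stokes_kernel' z \<i> g = 2 * (g / z) - 2 * cnj (g / z)" for z g
  proof -
    have "complex_of_real (2 * Re (1 / z)) - \<i> * of_real (2 * Re (\<i> / z)) = 2 / z"
      unfolding of_real_2Re by (simp add: algebra_simps)
    then have "complex_of_real (2 * Re (1 / z)) * g - \<i> * of_real (2 * Re (\<i> / z)) * g = 2 / z * g"
      by (simp flip: left_diff_distrib)
    then show ?thesis unfolding stokes_kernel'_def by (simp add: algebra_simps)
  qed
  then have "(\<lambda>y. stokes_kernel' (cx x - cx y) 1 (f y) - \<i> * stokes_kernel' (cx x - cx y) \<i> (f y))
     = (\<lambda>y. 2 * (f y / (cx x - cx y)) - 2 * cnj (f y / (cx x - cx y)))" by simp
  moreover have "(\<integral>y. stokes_kernel' (cx x - cx y) 1 (f y) - \<i> * stokes_kernel' (cx x - cx y) \<i> (f y) \<partial>lborel) = vel' f x 1 - \<i> * vel' f x \<i>"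
    unfolding vel'_def using i[OF f] by simp
  moreover have "(\<integral>y. 2 * (f y / (cx x - cx y)) - 2 * cnj (f y / (cx x - cx y)) \<partial>lborel) = 2 * (cauchy f x - cnj (cauchy f x))"
  proof -
    have "has_bochner_integral lborel (\<lambda>y. f y / (cx x - cx y)) (cauchy f x)"
      unfolding cauchy_def by (intro has_bochner_integral_integrable cauchy_integrable(1)[OF q f])
    then have "has_bochner_integral lborel (\<lambda>y. 2 * (f y / (cx x - cx y)) - 2 * cnj (f y / (cx x - cx y))) (2 * cauchy f x - 2 * cnj (cauchy f x))"
      by (intro has_bochner_integral_diff has_bochner_integral_cmult has_bochner_integral_cnj)
    then show ?thesis by (simp add: has_bochner_integral_iff algebra_simps)
  qed
  ultimately show ?thesis by simp
qed

text \<open>The Laplacian is four times \<open>dbar\<close> after the holomorphic derivative. One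
  integration by parts puts a derivative on the velocity, \<open>vel'_cauchy\<close> expresses the
  holomorphic part by the Cauchy transform \<open>H\<close>, and \<open>cauchy_weak\<close>
  identifies the weak \<open>dbar\<close> derivative of \<open>H\<close> with a multiple of the
  density. The part with \<open>Re H\<close> is left over and becomes the pressure.\<close>

lemma stokes_weak:
  assumes f: "decaying q M f" and t: "tfun \<phi>"
  shows "(\<integral>x. (partial_deriv 1 (partial_deriv 1 \<phi>) x + partial_deriv 2 (partial_deriv 2 \<phi>) x) *\<^sub>R vel f x \<partial>lborel)
     - 8 * (\<integral>x. of_real (Re (cauchy f x)) * dbar \<phi> x \<partial>lborel) = 8 * poisson_mass *\<^sub>R (\<integral>y. \<phi> y *\<^sub>R f y \<partial>lborel)"
    and "integrable lborel (\<lambda>x. partial_deriv i (partial_deriv i \<phi>) x *\<^sub>R vel f x)"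
proof -
  have ax: "cx (axis 1 1) = 1" "cx (axis 2 1) = \<i>" by (simp_all add: complex_eq_iff axis_def)
  have tp: "tfun (partial_deriv i \<phi>)" for i by (rule tfun_partial_deriv[OF t])
  have ibp: "(\<integral>x. partial_deriv j (partial_deriv i \<phi>) x *\<^sub>R vel f x \<partial>lborel) = - (\<integral>x. partial_deriv i \<phi> x *\<^sub>R vel' f x (cx (axis j 1)) \<partial>lborel)"
    "integrable lborel (\<lambda>x. partial_deriv i \<phi> x *\<^sub>R vel' f x (cx (axis j 1)))"
    "integrable lborel (\<lambda>x. partial_deriv j (partial_deriv i \<phi>) x *\<^sub>R vel f x)" for i j
    using integral_by_parts[OF tp[of i] vel_has_derivative[OF q f] continuous_vel'[OF q f], of j] by auto
  show "integrable lborel (\<lambda>x. partial_deriv i (partial_deriv i \<phi>) x *\<^sub>R vel f x)" by (rule ibp(3))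
  define I where "I i j = (\<integral>x. partial_deriv i \<phi> x *\<^sub>R vel' f x (cx (axis j 1)) \<partial>lborel)" for i j
  have sym: "I 1 2 = I 2 1"
    using ibp(1)[of 2 1] ibp(1)[of 1 2] partial_deriv_commute[OF t, of 1 2] by (simp add: I_def)
  have "(\<integral>x. (partial_deriv 1 (partial_deriv 1 \<phi>) x + partial_deriv 2 (partial_deriv 2 \<phi>) x) *\<^sub>R vel f x \<partial>lborel) = - (I 1 1 + I 2 2)"
    unfolding scaleR_add_left using ibp(3) by (simp add: ibp(1) I_def)
  \<comment> \<open>The added mixed terms cancel by \<open>sym\<close>; they complete the
    combination that \<open>vel'_cauchy\<close> evaluates.\<close>
  also have "I 1 1 + I 2 2 = (I 1 1 - \<i> * I 1 2) + \<i> * (I 2 1 - \<i> * I 2 2)" using sym by (simp add: algebra_simps)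
  also have "\<dots> = (\<integral>x. (partial_deriv 1 \<phi> x *\<^sub>R vel' f x 1 - \<i> * (partial_deriv 1 \<phi> x *\<^sub>R vel' f x \<i>))
       + \<i> * (partial_deriv 2 \<phi> x *\<^sub>R vel' f x 1 - \<i> * (partial_deriv 2 \<phi> x *\<^sub>R vel' f x \<i>)) \<partial>lborel)"
  proof -
    note hb = ibp(2)[THEN has_bochner_integral_integrable]
    have "has_bochner_integral lborel (\<lambda>x. (partial_deriv 1 \<phi> x *\<^sub>R vel' f x (cx (axis 1 1)) - \<i> * (partial_deriv 1 \<phi> x *\<^sub>R vel' f x (cx (axis 2 1))))
       + \<i> * (partial_deriv 2 \<phi> x *\<^sub>R vel' f x (cx (axis 1 1)) - \<i> * (partial_deriv 2 \<phi> x *\<^sub>R vel' f x (cx (axis 2 1)))))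
       ((I 1 1 - \<i> * I 1 2) + \<i> * (I 2 1 - \<i> * I 2 2))"
      unfolding I_def by (intro has_bochner_integral_add has_bochner_integral_diff has_bochner_integral_cmult hb)
    then show ?thesis unfolding ax by (rule has_bochner_integral_integral_eq[symmetric])
  qed
  also have "\<dots> = (\<integral>x. 4 * ((cauchy f x - cnj (cauchy f x)) * dbar \<phi> x) \<partial>lborel)"
  proof (rule Bochner_Integration.integral_cong)
    fix x
    have "(partial_deriv 1 \<phi> x *\<^sub>R vel' f x 1 - \<i> * (partial_deriv 1 \<phi> x *\<^sub>R vel' f x \<i>))
       + \<i> * (partial_deriv 2 \<phi> x *\<^sub>R vel' f x 1 - \<i> * (partial_deriv 2 \<phi> x *\<^sub>R vel' f x \<i>))
      = (vel' f x 1 - \<i> * vel' f x \<i>) * (2 * dbar \<phi> x)"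
      by (simp add: dbar_def Complex_eq scaleR_conv_of_real algebra_simps)
    then show "(partial_deriv 1 \<phi> x *\<^sub>R vel' f x 1 - \<i> * (partial_deriv 1 \<phi> x *\<^sub>R vel' f x \<i>))
       + \<i> * (partial_deriv 2 \<phi> x *\<^sub>R vel' f x 1 - \<i> * (partial_deriv 2 \<phi> x *\<^sub>R vel' f x \<i>)) = 4 * ((cauchy f x - cnj (cauchy f x)) * dbar \<phi> x)"
      unfolding vel'_cauchy[OF f] by simp
  qed simp
  also have "(\<lambda>x. 4 * ((cauchy f x - cnj (cauchy f x)) * dbar \<phi> x)) = (\<lambda>x. 8 * (cauchy f x * dbar \<phi> x) - 8 * (of_real (Re (cauchy f x)) * dbar \<phi> x))"
  proof
    fix x
    \<comment> \<open>The weak equation of \<open>cauchy_weak\<close> is about \<open>H\<close>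
      itself, so \<open>cnj H\<close> is eliminated in favour of \<open>Re H\<close>.\<close>
    have H: "H - cnj H = 2 * H - 2 * of_real (Re H)" for H by (simp add: complex_eq_iff)
    show "4 * ((cauchy f x - cnj (cauchy f x)) * dbar \<phi> x) = 8 * (cauchy f x * dbar \<phi> x) - 8 * (of_real (Re (cauchy f x)) * dbar \<phi> x)"
      unfolding H by (simp only: left_diff_distrib right_diff_distrib mult.assoc[symmetric]) simp
  qed
  also have "(\<integral>x. 8 * (cauchy f x * dbar \<phi> x) - 8 * (of_real (Re (cauchy f x)) * dbar \<phi> x) \<partial>lborel)
     = 8 * (\<integral>x. cauchy f x * dbar \<phi> x \<partial>lborel) - 8 * (\<integral>x. of_real (Re (cauchy f x)) * dbar \<phi> x \<partial>lborel)"
  proof -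
    obtain R where R: "\<And>x. R < norm x \<Longrightarrow> dbar \<phi> x = 0" using dbar_tfun(2)[OF t] by blast
    have "continuous_on UNIV (\<lambda>x. of_real (Re (cauchy f x)) * dbar \<phi> x)"
      by (intro continuous_intros continuous_cauchy[OF q f] dbar_tfun(1)[OF t])
    from compact_support_decaying[OF this, of R q] R q
    obtain N where "decaying q N (\<lambda>x. of_real (Re (cauchy f x)) * dbar \<phi> x)" by auto
    from moment_integrals(1)[OF q(1) this] show ?thesis using cauchy_weak(2)[OF f t] by simp
  qed
  finally show "(\<integral>x. (partial_deriv 1 (partial_deriv 1 \<phi>) x + partial_deriv 2 (partial_deriv 2 \<phi>) x) *\<^sub>R vel f x \<partial>lborel)
     - 8 * (\<integral>x. of_real (Re (cauchy f x)) * dbar \<phi> x \<partial>lborel) = 8 * poisson_mass *\<^sub>R (\<integral>y. \<phi> y *\<^sub>R f y \<partial>lborel)"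
    unfolding cauchy_weak(1)[OF f t] by (simp add: algebra_simps)
qed

end

section \<open>Removing the low moments\<close>

definition gauss :: "real^2 \<Rightarrow> real" where "gauss y = exp (- (norm y)\<^sup>2)"

lemma gauss_pos: "gauss y > 0" by (simp add: gauss_def)

lemma continuous_gauss[continuous_intros]: "continuous_on S gauss"
  unfolding gauss_def by (intro continuous_intros)

lemma measurable_gauss[measurable]: "gauss \<in> borel_measurable borel"
  by (rule borel_measurable_continuous_onI[OF continuous_gauss])

text \<open>From \<open>t^2 / 3 <= exp (t^2 / 3)\<close>, cubed; the constant is
  \<open>64 * (1 + 27)\<close>. Of the six orders, five dominate the weight since
  \<open>q < 5\<close>, and one covers the linear factor in fields such as
  \<open>cx y * gauss y\<close>.\<close>

lemma gauss_bound: "gauss y \<le> 1792 / (1 + norm y) ^ 6"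
proof -
  let ?t = "norm y" and ?E = "exp ((norm y)\<^sup>2)"
  have E: "1 \<le> ?E" by simp
  have "?t ^ 6 \<le> 27 * ?E"
  proof -
    have "?t\<^sup>2 / 3 \<le> exp (?t\<^sup>2 / 3)" using exp_ge_add_one_self[of "?t\<^sup>2 / 3"] by linarith
    then have "(?t\<^sup>2 / 3) ^ 3 \<le> exp (?t\<^sup>2 / 3) ^ 3" by (intro power_mono) auto
    then show ?thesis by (simp add: power_divide exp_of_nat_mult[symmetric] flip: power_mult)
  qed
  have "(1 + ?t) ^ 6 \<le> 64 * (1 + ?t ^ 6)"
  proof (cases "?t \<le> 1")
    case True
    have "(1 + ?t) ^ 6 \<le> 2 ^ 6" using True by (intro power_mono) auto
    then show ?thesis by (simp add: add_increasing2)
  next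
    case False
    have "(1 + ?t) ^ 6 \<le> (2 * ?t) ^ 6" using False by (intro power_mono) auto
    then show ?thesis by (simp add: power_mult_distrib)
  qed
  also have "\<dots> \<le> 64 * (?E + 27 * ?E)" using E \<open>?t ^ 6 \<le> 27 * ?E\<close> by (intro mult_left_mono add_mono) auto
  finally have "(1 + ?t) ^ 6 \<le> 1792 * ?E" by simp
  moreover have "0 < (1 + ?t) ^ 6" by (intro zero_less_power add_pos_nonneg) auto
  ultimately show ?thesis unfolding gauss_def exp_minus by (simp add: field_simps)
qed

lemma gauss_cube: "(1 + norm y) ^ 3 * gauss y \<le> 1792 / (1 + norm y) ^ 3"
proof -
  have p: "0 < (1 + norm y) ^ 3" by (intro zero_less_power add_pos_nonneg) auto
  have "(1 + norm y) ^ 3 * gauss y \<le> (1 + norm y) ^ 3 * (1792 / (1 + norm y) ^ 6)"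
    using p by (intro mult_left_mono gauss_bound) auto
  also have "(1 + norm y) ^ 6 = (1 + norm y) ^ 3 * (1 + norm y) ^ 3" by (simp flip: power_add)
  also have "P * (1792 / (P * P)) = 1792 / P" if "P > 0" for P :: real using that by simp
  note this[OF p]
  finally show ?thesis .
qed

lemma integrable_gauss_mult:
  fixes g :: "real^2 \<Rightarrow> complex"
  assumes [measurable]: "g \<in> borel_measurable borel" and b: "\<And>y. cmod (g y) \<le> 2 * (1 + norm y)\<^sup>2"
  shows "integrable lborel (\<lambda>y. g y * gauss y)" "cmod (g y * gauss y) \<le> 3584 / (1 + norm y) ^ 3"
proof -
  show *: "cmod (g y * gauss y) \<le> 3584 / (1 + norm y) ^ 3" for y
  proof -
    have "(1 + norm y)\<^sup>2 \<le> (1 + norm y) ^ 3" by (rule power_increasing) auto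
    then have "cmod (g y) * gauss y \<le> 2 * (1 + norm y) ^ 3 * gauss y"
      using b[of y] gauss_pos[of y] by (intro mult_right_mono) auto
    also have "\<dots> = 2 * ((1 + norm y) ^ 3 * gauss y)" by simp
    also have "\<dots> \<le> 2 * (1792 / (1 + norm y) ^ 3)" by (intro mult_left_mono gauss_cube) auto
    finally show ?thesis using gauss_pos[of y] by (simp add: norm_mult)
  qed
  show "integrable lborel (\<lambda>y. g y * gauss y)" by (rule integrable_cube[OF _ *]) measurable
qed

text \<open>Like \<open>poisson_mass\<close> this equals pi and is kept symbolic; the ratio
  \<open>pi / gauss_mass\<close> reappears in the coefficients of the corrected force.\<close>

definition gauss_mass :: real where "gauss_mass = (\<integral>y. gauss y \<partial>lborel)"

lemma integrable_gauss: "integrable lborel gauss"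
proof (rule integrable_cube[of _ 1792])
  show "norm (gauss y) \<le> 1792 / (1 + norm y) ^ 3" for y
  proof -
    have "1 * gauss y \<le> (1 + norm y) ^ 3 * gauss y"
      using gauss_pos[of y] by (intro mult_right_mono one_le_power) auto
    also note gauss_cube[of y]
    finally show ?thesis using gauss_pos[of y] by simp
  qed
qed measurable

lemma gauss_mass_pos: "gauss_mass > 0"
proof -
  have "gauss_mass \<noteq> 0"
  proof
    assume "gauss_mass = 0"
    then have "AE y in lborel. gauss y = 0"
      unfolding gauss_mass_def using integrable_gauss gauss_pos
      by (subst (asm) integral_nonneg_eq_0_iff_AE) (auto intro: less_imp_le)
    then have "AE y::real^2 in lborel. False" using gauss_pos by (auto elim!: eventually_mono simp: less_le)
    then show False using AE_iff_measurable[of UNIV "lborel :: (real^2) measure" "\<lambda>_. False"] by simp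
  qed
  moreover have "gauss_mass \<ge> 0" unfolding gauss_mass_def using gauss_pos by (intro integral_nonneg_AE) (auto intro: less_imp_le)
  ultimately show ?thesis by simp
qed

lemma odd_integral:
  fixes g :: "real^2 \<Rightarrow> complex"
  assumes "g \<in> borel_measurable borel" "\<And>y. g (- y) = - g y"
  shows "(\<integral>y. g y \<partial>lborel) = 0"
  using integral_affine[OF assms(1), of "-1" 0] assms(2) by simp

text \<open>Integrating the derivatives of \<open>cx y * gauss y\<close> gives the second moments of the Gaussian.\<close>

lemma gauss_moments:
  shows "(\<integral>y. of_real (gauss y) \<partial>lborel) = complex_of_real gauss_mass"
    and "(\<integral>y. cx y * of_real (gauss y) \<partial>lborel) = 0"
    and "(\<integral>y. cnj (cx y) * of_real (gauss y) \<partial>lborel) = 0"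
    and "(\<integral>y. (cx y)\<^sup>2 * of_real (gauss y) \<partial>lborel) = 0"
    and "(\<integral>y. (cnj (cx y))\<^sup>2 * of_real (gauss y) \<partial>lborel) = 0"
    and "(\<integral>y. (cx y * cnj (cx y)) * of_real (gauss y) \<partial>lborel) = of_real gauss_mass"
proof -
  show g0: "(\<integral>y. of_real (gauss y) \<partial>lborel) = complex_of_real gauss_mass"
    unfolding gauss_mass_def by (rule integral_complex_of_real)
  have ge: "gauss (- y) = gauss y" for y by (simp add: gauss_def)
  show "(\<integral>y. cx y * of_real (gauss y) \<partial>lborel) = 0"
    by (rule odd_integral) (measurable, simp add: ge)
  show "(\<integral>y. cnj (cx y) * of_real (gauss y) \<partial>lborel) = 0"
    by (rule odd_integral) (measurable, simp add: ge)
  have t2: "1 + 2 * (norm y)\<^sup>2 \<le> 2 * (1 + norm y)\<^sup>2" for y :: "real^2"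
    by (simp add: power2_eq_square algebra_simps)
  \<comment> \<open>The integrand is the derivative of \<open>cx y * gauss y\<close> in the
    direction \<open>e\<close>.\<close>
  have D: "(\<integral>y. (cx e - of_real (2 * (y \<bullet> e)) * cx y) * of_real (gauss y) \<partial>lborel) = 0"
    and Di: "integrable lborel (\<lambda>y. (cx e - of_real (2 * (y \<bullet> e)) * cx y) * of_real (gauss y))"
    if e: "norm e = 1" for e
  proof -
    let ?F' = "\<lambda>y h. (cx h - of_real (2 * (y \<bullet> h)) * cx y) * of_real (gauss y)"
    have d: "((\<lambda>y. cx y * of_real (gauss y)) has_derivative ?F' y) (at y)" for y
    proof -
      have 1: "((\<lambda>y::real^2. (norm y)\<^sup>2) has_derivative (\<lambda>h. 2 * (y \<bullet> h))) (at y)"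
        unfolding power2_norm_eq_inner by (auto intro!: derivative_eq_intros simp: inner_commute)
      have 2: "(gauss has_derivative (\<lambda>h. gauss y * - (2 * (y \<bullet> h)))) (at y)"
        unfolding gauss_def
        by (rule has_derivative_eq_rhs[OF has_derivative_exp[OF has_derivative_minus[OF 1]]]) (simp add: mult.commute)
      have 3: "((\<lambda>y. complex_of_real (gauss y)) has_derivative (\<lambda>h. of_real (gauss y * - (2 * (y \<bullet> h))))) (at y)"
        by (rule has_derivative_of_real[OF 2])
      have 4: "(cx has_derivative cx) (at y)" by (rule bounded_linear_imp_has_derivative[OF bounded_linear_cx])
      show ?thesis by (rule has_derivative_eq_rhs[OF has_derivative_mult[OF 4 3]]) (simp add: fun_eq_iff algebra_simps)
    qed
    have "norm (?F' y e) \<le> 3584 / (1 + norm y) ^ 3" for y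
    proof (rule integrable_gauss_mult(2))
      fix y :: "real^2"
      have "\<bar>y \<bullet> e\<bar> \<le> norm y" using Cauchy_Schwarz_ineq2[of y e] e by simp
      then have "cmod (of_real (2 * (y \<bullet> e)) * cx y) \<le> 2 * norm y * norm y"
        by (simp add: norm_mult abs_mult mult_right_mono)
      then have "cmod (cx e - of_real (2 * (y \<bullet> e)) * cx y) \<le> 1 + 2 * norm y * norm y"
        using norm_triangle_ineq4[of "cx e" "of_real (2 * (y \<bullet> e)) * cx y"] e by simp
      then show "cmod (cx e - of_real (2 * (y \<bullet> e)) * cx y) \<le> 2 * (1 + norm y)\<^sup>2"
        using t2[of y] by (simp add: power2_eq_square)
    qed measurable
    note b = this
    have "cmod (cx y) \<le> 2 * (1 + norm y)\<^sup>2" for y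
      using sq_weight_bounds(2)[of y] zero_le_power2[of "1 + norm y"] unfolding cx_simps by linarith
    then have i: "integrable lborel (\<lambda>y. cx y * of_real (gauss y))" by (rule integrable_gauss_mult(1)[rotated]) measurable
    have m: "(\<lambda>y. ?F' y e) \<in> borel_measurable borel" by measurable
    show "(\<integral>y. ?F' y e \<partial>lborel) = 0" "integrable lborel (\<lambda>y. ?F' y e)"
      using integral_deriv_eq_0[OF d i b e m] by auto
  qed
  have ax: "cx (axis 1 1) = 1" "cx (axis 2 1) = \<i>" "y \<bullet> axis 1 1 = Re (cx y)" "y \<bullet> axis 2 1 = Im (cx y)" "norm (axis i (1::real) :: real^2) = 1" for i y
    by (simp_all add: complex_eq_iff inner_axis) (simp_all add: axis_def)
  have h0: "has_bochner_integral lborel (\<lambda>y. complex_of_real (gauss y)) (of_real gauss_mass)"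
    using g0 integrable_gauss by (simp add: has_bochner_integral_iff)
  have h1: "has_bochner_integral lborel (\<lambda>y. (1 - of_real (2 * Re (cx y)) * cx y) * of_real (gauss y)) 0"
    using D[of "axis 1 1"] Di[of "axis 1 1"] unfolding ax by (simp add: has_bochner_integral_iff)
  have h2: "has_bochner_integral lborel (\<lambda>y. (\<i> - of_real (2 * Im (cx y)) * cx y) * of_real (gauss y)) 0"
    using D[of "axis 2 1"] Di[of "axis 2 1"] unfolding ax by (simp add: has_bochner_integral_iff)
  \<comment> \<open>This combination is minus the \<open>dbar\<close> derivative of
    \<open>cx y * gauss y\<close>, which is \<open>(cx y)^2 * gauss y\<close>.\<close>
  have b1: "has_bochner_integral lborel (\<lambda>y. - (1/2) * ((1 - of_real (2 * Re (cx y)) * cx y) * of_real (gauss y))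
       + - (\<i>/2) * ((\<i> - of_real (2 * Im (cx y)) * cx y) * of_real (gauss y))) (- (1/2) * 0 + - (\<i>/2) * 0)"
    by (intro has_bochner_integral_add has_bochner_integral_cmult h1 h2)
  have e1: "- (1/2) * ((1 - of_real (2 * Re z) * z) * g) + - (\<i>/2) * ((\<i> - of_real (2 * Im z) * z) * g) = z\<^sup>2 * g" for z g
  proof -
    have "- (1/2) * ((1 - of_real (2 * Re z) * z) * g) + - (\<i>/2) * ((\<i> - of_real (2 * Im z) * z) * g)
      = (of_real (Re z) + \<i> * of_real (Im z)) * z * g" by (simp add: algebra_simps)
    then show ?thesis by (simp add: complex_eq[symmetric] power2_eq_square)
  qed
  have s: "has_bochner_integral lborel (\<lambda>y. (cx y)\<^sup>2 * of_real (gauss y)) 0" using b1 unfolding e1 by simp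
  then show "(\<integral>y. (cx y)\<^sup>2 * of_real (gauss y) \<partial>lborel) = 0" by (simp add: has_bochner_integral_iff)
  show "(\<integral>y. (cnj (cx y))\<^sup>2 * of_real (gauss y) \<partial>lborel) = 0"
    using has_bochner_integral_cnj[OF s] by (simp add: has_bochner_integral_iff)
  \<comment> \<open>Subtracting the holomorphic derivative of \<open>cx y * gauss y\<close> from
    \<open>gauss y\<close> leaves \<open>cx y * cnj (cx y) * gauss y\<close>.\<close>
  have b2: "has_bochner_integral lborel (\<lambda>y. of_real (gauss y) + (- (1/2) * ((1 - of_real (2 * Re (cx y)) * cx y) * of_real (gauss y))
       + (\<i>/2) * ((\<i> - of_real (2 * Im (cx y)) * cx y) * of_real (gauss y)))) (of_real gauss_mass + (- (1/2) * 0 + (\<i>/2) * 0))"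
    by (intro has_bochner_integral_add has_bochner_integral_cmult h0 h1 h2)
  have e2: "g + (- (1/2) * ((1 - of_real (2 * Re z) * z) * g) + (\<i>/2) * ((\<i> - of_real (2 * Im z) * z) * g)) = (z * cnj z) * g" for z g
  proof -
    have "g + (- (1/2) * ((1 - of_real (2 * Re z) * z) * g) + (\<i>/2) * ((\<i> - of_real (2 * Im z) * z) * g))
      = z * (of_real (Re z) - \<i> * of_real (Im z)) * g" by (simp add: algebra_simps)
    moreover have "of_real (Re z) - \<i> * of_real (Im z) = cnj z" by (simp add: complex_eq_iff)
    ultimately show ?thesis by simp
  qed
  show "(\<integral>y. (cx y * cnj (cx y)) * of_real (gauss y) \<partial>lborel) = of_real gauss_mass"
    using b2 unfolding e2 by (simp add: has_bochner_integral_iff)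
qed

text \<open>The fields \<open>gauss\<close>, \<open>cnj (cx y) * gauss\<close> and
  \<open>\<i> * cx y * gauss\<close> are dual to the three conditions in \<open>balanced\<close>,
  and the coefficients cancel the respective moments. Removing the mean too makes the map available
  for densities that do not integrate to zero.\<close>

definition sharp :: "(real^2 \<Rightarrow> complex) \<Rightarrow> real^2 \<Rightarrow> complex" where
  "sharp f y = f y - ((\<integral>y. f y \<partial>lborel) + (\<integral>y. cx y * f y \<partial>lborel) * cnj (cx y)
      + \<i> * of_real (Im (\<integral>y. cnj (cx y) * f y \<partial>lborel)) * cx y) / of_real gauss_mass * of_real (gauss y)"

text \<open>Among the Gaussian moments only the total mass and that of
  \<open>cx y * cnj (cx y)\<close> survive, so each corrector is seen by one condition only. The
  last moment becomes \<open>b\<close> minus its imaginary part, which is real.\<close>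

lemma sharp_balanced:
  assumes q: "4 < q" and f: "decaying q M f"
  shows "balanced (sharp f)"
proof -
  define m a b where "m = (\<integral>y. f y \<partial>lborel)" and "a = (\<integral>y. cx y * f y \<partial>lborel)" and "b = (\<integral>y. cnj (cx y) * f y \<partial>lborel)"
  let ?G = "complex_of_real gauss_mass"
  have G: "?G \<noteq> 0" using gauss_mass_pos by simp
  note hf = moment_integrals[OF q f, THEN has_bochner_integral_integrable]
  have gi: "integrable lborel (\<lambda>y. h y * complex_of_real (gauss y))" if "h \<in> borel_measurable borel" "\<And>y. cmod (h y) \<le> (1 + norm y)\<^sup>2" for h
  proof (rule integrable_gauss_mult(1)[OF that(1)])
    show "cmod (h y) \<le> 2 * (1 + norm y)\<^sup>2" for y
      using that(2)[of y] zero_le_power2[of "1 + norm y"] by linarith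
  qed
  have hg: "has_bochner_integral lborel (\<lambda>y. complex_of_real (gauss y)) ?G"
    "has_bochner_integral lborel (\<lambda>y. cx y * complex_of_real (gauss y)) 0"
    "has_bochner_integral lborel (\<lambda>y. cnj (cx y) * complex_of_real (gauss y)) 0"
    "has_bochner_integral lborel (\<lambda>y. (cx y)\<^sup>2 * complex_of_real (gauss y)) 0"
    "has_bochner_integral lborel (\<lambda>y. (cnj (cx y))\<^sup>2 * complex_of_real (gauss y)) 0"
    "has_bochner_integral lborel (\<lambda>y. (cx y * cnj (cx y)) * complex_of_real (gauss y)) ?G"
    using gauss_moments gi[of "\<lambda>y. 1"] gi[of cx] gi[of "\<lambda>y. cnj (cx y)"] gi[of "\<lambda>y. (cx y)\<^sup>2"] gi[of "\<lambda>y. (cnj (cx y))\<^sup>2"] gi[of "\<lambda>y. cx y * cnj (cx y)"]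
      sq_weight_bounds by (auto simp: has_bochner_integral_iff norm_power norm_mult power2_eq_square)
  have sharp: "sharp f y = f y - (m / ?G * of_real (gauss y) + a / ?G * (cnj (cx y) * of_real (gauss y))
      + \<i> * of_real (Im b) / ?G * (cx y * of_real (gauss y)))" for y
    by (simp add: sharp_def m_def a_def b_def add_divide_distrib algebra_simps)
  note hb = has_bochner_integral_add has_bochner_integral_diff has_bochner_integral_cmult
  have "has_bochner_integral lborel (sharp f) (m - (m / ?G * ?G + a / ?G * 0 + \<i> * of_real (Im b) / ?G * 0))"
    unfolding sharp[abs_def] m_def by (intro hb hf hg)
  then have 1: "(\<integral>y. sharp f y \<partial>lborel) = 0" using G by (simp add: has_bochner_integral_iff)
  have "has_bochner_integral lborel (\<lambda>y. cx y * f y - (m / ?G * (cx y * of_real (gauss y)) + a / ?G * ((cx y * cnj (cx y)) * of_real (gauss y))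
      + \<i> * of_real (Im b) / ?G * ((cx y)\<^sup>2 * of_real (gauss y)))) (a - (m / ?G * 0 + a / ?G * ?G + \<i> * of_real (Im b) / ?G * 0))"
    unfolding a_def by (intro hb hf hg)
  moreover have "cx y * sharp f y = cx y * f y - (m / ?G * (cx y * of_real (gauss y)) + a / ?G * ((cx y * cnj (cx y)) * of_real (gauss y))
      + \<i> * of_real (Im b) / ?G * ((cx y)\<^sup>2 * of_real (gauss y)))" for y
    unfolding sharp by (simp add: algebra_simps power2_eq_square)
  ultimately have 2: "(\<integral>y. cx y * sharp f y \<partial>lborel) = 0" using G by (simp add: has_bochner_integral_iff)
  have "has_bochner_integral lborel (\<lambda>y. cnj (cx y) * f y - (m / ?G * (cnj (cx y) * of_real (gauss y)) + a / ?G * ((cnj (cx y))\<^sup>2 * of_real (gauss y))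
      + \<i> * of_real (Im b) / ?G * ((cx y * cnj (cx y)) * of_real (gauss y)))) (b - (m / ?G * 0 + a / ?G * 0 + \<i> * of_real (Im b) / ?G * ?G))"
    unfolding b_def by (intro hb hf hg)
  moreover have "cnj (cx y) * sharp f y = cnj (cx y) * f y - (m / ?G * (cnj (cx y) * of_real (gauss y)) + a / ?G * ((cnj (cx y))\<^sup>2 * of_real (gauss y))
      + \<i> * of_real (Im b) / ?G * ((cx y * cnj (cx y)) * of_real (gauss y)))" for y
    unfolding sharp by (simp add: algebra_simps power2_eq_square)
  ultimately have "(\<integral>y. cnj (cx y) * sharp f y \<partial>lborel) = b - \<i> * of_real (Im b)" using G by (simp add: has_bochner_integral_iff)
  then show ?thesis using 1 2 by (simp add: balanced_def)
qed

text \<open>Additivity transfers the bounds for \<open>sharp\<close> to differences of densities, as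
  the Lipschitz estimate in \<open>fixed_point\<close> requires.\<close>

lemma sharp_diff:
  assumes q: "4 < q" and f: "decaying q M f" and g: "decaying q N g"
  shows "sharp (\<lambda>y. f y - g y) = (\<lambda>y. sharp f y - sharp g y)"
proof -
  note i = moment_integrals[OF q f] and j = moment_integrals[OF q g]
  have "(\<integral>y. f y - g y \<partial>lborel) = (\<integral>y. f y \<partial>lborel) - (\<integral>y. g y \<partial>lborel)"
    "(\<integral>y. cx y * (f y - g y) \<partial>lborel) = (\<integral>y. cx y * f y \<partial>lborel) - (\<integral>y. cx y * g y \<partial>lborel)"
    "(\<integral>y. cnj (cx y) * (f y - g y) \<partial>lborel) = (\<integral>y. cnj (cx y) * f y \<partial>lborel) - (\<integral>y. cnj (cx y) * g y \<partial>lborel)"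
    unfolding right_diff_distrib using i j by simp_all
  moreover have "F - G - (mf - mg + (af - ag) * c + \<i> * of_real (bf - bg) * d) / M * e
     = F - (mf + af * c + \<i> * of_real bf * d) / M * e - (G - (mg + ag * c + \<i> * of_real bg * d) / M * e)"
    for F G mf mg af ag c d M e :: complex and bf bg
    by (simp add: ring_distribs add_divide_distrib diff_divide_distrib)
  ultimately show ?thesis unfolding sharp_def by (simp only: minus_complex.simps)
qed

context
  fixes q :: real
  assumes q: "4 < q" "q < 5"
begin

lemma gauss_decaying: "(1 + norm y) * gauss y \<le> 3584 / (1 + norm y powr q)"
proof -
  have p: "0 < 1 + norm y powr q" by (simp add: add_pos_nonneg)
  have "norm y powr q \<le> (1 + norm y) powr q" using q by (intro powr_mono2) auto
  also have "\<dots> \<le> (1 + norm y) powr 5" using q by (intro powr_mono) auto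
  also have "\<dots> = (1 + norm y) ^ 5" by (simp add: add_pos_nonneg)
  finally have "norm y powr q \<le> (1 + norm y) ^ 5" .
  moreover have "1 \<le> (1 + norm y) ^ 5" by (rule one_le_power) simp
  ultimately have "1 + norm y powr q \<le> 2 * (1 + norm y) ^ 5" by linarith
  then have "(1 + norm y) * (1 + norm y powr q) \<le> (1 + norm y) * (2 * (1 + norm y) ^ 5)" by (intro mult_left_mono) auto
  also have "\<dots> = 2 * (1 + norm y) ^ 6" by (simp add: power_eq_if)
  finally have "(1 + norm y) * (1 + norm y powr q) * gauss y \<le> 2 * (1 + norm y) ^ 6 * gauss y"
    using gauss_pos[of y] by (intro mult_right_mono) auto
  also have "\<dots> \<le> 2 * (1 + norm y) ^ 6 * (1792 / (1 + norm y) ^ 6)" by (intro mult_left_mono gauss_bound) auto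
  also have "\<dots> = 3584"
    using add_pos_nonneg[of 1 "norm y"] by simp
  finally show ?thesis using p by (simp add: pos_le_divide_eq mult_ac)
qed

lemma sharp_decaying:
  obtains C where "C > 0" "\<And>f M. decaying q M f \<Longrightarrow> decaying q (C * M) (sharp f)"
proof -
  obtain C where C: "C > 0" "\<And>f M B (g :: real^2 \<Rightarrow> complex).
    \<lbrakk>decaying q M f; g \<in> borel_measurable borel; B \<ge> 0; \<And>y. y \<noteq> 0 \<Longrightarrow> norm (g y) \<le> B * ((1 + norm y)\<^sup>2 * cmod (f y))\<rbrakk>
    \<Longrightarrow> integrable lborel g \<and> norm (integral\<^sup>L lborel g) \<le> B * M * C"
    by (rule decaying_moment_integrable[OF q(1)]) blast
  \<comment> \<open>The 3 counts the correctors, each with a coefficient of size at most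
    \<open>M * C / gauss_mass\<close>; 3584 is the constant of
    \<open>gauss_decaying\<close>.\<close>
  let ?K = "1 + 3 * C / gauss_mass * 3584"
  have "decaying q (?K * M) (sharp f)" if f: "decaying q M f" for f M
  proof -
    note [measurable] = decaying_measurable[OF f]
    have M: "M \<ge> 0" using f by (rule decaying_nonneg)
    have mom: "cmod (\<integral>y. h y * f y \<partial>lborel) \<le> M * C" if "h \<in> borel_measurable borel" "\<And>y. cmod (h y) \<le> (1 + norm y)\<^sup>2" for h
      using C(2)[OF f, of "\<lambda>y. h y * f y" 1] that by (auto simp: norm_mult mult_right_mono)
    define m a b where "m = (\<integral>y. f y \<partial>lborel)" and "a = (\<integral>y. cx y * f y \<partial>lborel)" and "b = (\<integral>y. cnj (cx y) * f y \<partial>lborel)"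
    have mm: "cmod m \<le> M * C" using mom[of "\<lambda>y. 1"] sq_weight_bounds(1) by (simp add: m_def)
    have aa: "cmod a \<le> M * C" unfolding a_def by (rule mom) (use sq_weight_bounds(2) in auto)
    have bb: "cmod b \<le> M * C" unfolding b_def by (rule mom) (use sq_weight_bounds(2) in auto)
    have "cmod (sharp f y) \<le> ?K * M / (1 + norm y powr q)" for y
    proof -
      have "cmod (m + a * cnj (cx y) + \<i> * of_real (Im b) * cx y) \<le> cmod m + cmod a * norm y + \<bar>Im b\<bar> * norm y"
        by (intro order_trans[OF norm_triangle_ineq] add_mono) (auto simp: norm_mult)
      also have "\<dots> \<le> M * C + M * C * norm y + M * C * norm y"
        using mm aa bb abs_Im_le_cmod[of b] by (intro add_mono mult_right_mono) auto
      also have "\<dots> \<le> 3 * (M * C) * (1 + norm y)" using M C(1) by (simp add: algebra_simps)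
      finally have 1: "cmod (m + a * cnj (cx y) + \<i> * of_real (Im b) * cx y) \<le> 3 * (M * C) * (1 + norm y)" .
      have "cmod ((m + a * cnj (cx y) + \<i> * of_real (Im b) * cx y) / of_real gauss_mass * of_real (gauss y))
         = cmod (m + a * cnj (cx y) + \<i> * of_real (Im b) * cx y) / gauss_mass * gauss y"
        using gauss_mass_pos gauss_pos[of y] by (simp add: norm_mult norm_divide)
      also have "\<dots> \<le> 3 * (M * C) * (1 + norm y) / gauss_mass * gauss y"
        using 1 gauss_mass_pos gauss_pos[of y] by (intro mult_right_mono divide_right_mono) auto
      also have "\<dots> = 3 * C / gauss_mass * M * ((1 + norm y) * gauss y)" by simp
      also have "\<dots> \<le> 3 * C / gauss_mass * M * (3584 / (1 + norm y powr q))"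
        using M C(1) gauss_mass_pos by (intro mult_left_mono gauss_decaying) auto
      finally have 2: "cmod ((m + a * cnj (cx y) + \<i> * of_real (Im b) * cx y) / of_real gauss_mass * of_real (gauss y))
        \<le> 3 * C / gauss_mass * M * (3584 / (1 + norm y powr q))" .
      have "cmod (sharp f y) \<le> cmod (f y) + cmod ((m + a * cnj (cx y) + \<i> * of_real (Im b) * cx y) / of_real gauss_mass * of_real (gauss y))"
        unfolding sharp_def m_def a_def b_def by (rule norm_triangle_ineq4)
      also have "\<dots> \<le> M / (1 + norm y powr q) + 3 * C / gauss_mass * M * (3584 / (1 + norm y powr q))"
        using f 2 by (intro add_mono) (auto simp: decaying_def)
      also have "M / W + c * M * (3584 / W) = (1 + c * 3584) * M / W" for W c
        by (simp add: add_divide_distrib ring_distribs mult_ac)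
      finally show ?thesis .
    qed
    moreover have "continuous_on UNIV (sharp f)"
      unfolding sharp_def using f gauss_mass_pos by (intro continuous_intros) (auto simp: decaying_def)
    ultimately show ?thesis by (simp add: decaying_def)
  qed
  moreover have "?K > 0" using C(1) gauss_mass_pos by (intro add_pos_nonneg) auto
  ultimately show thesis using that by blast
qed

text \<open>The first estimate is bilinear with explicit \<open>M\<close> and \<open>N\<close>,
  which yields self-mapping as well as contraction. The other two provide the cubic decay for
  \<open>integral_deriv_eq_0\<close>; it follows from \<open>q - 1 > 3\<close>.\<close>

lemma convection_bound:
  obtains K where "K > 0" "\<And>f g M N x. \<lbrakk>decaying q M f; decaying q N g\<rbrakk> \<Longrightarrow>
      cmod (vel' (sharp g) x (vel (sharp f) x)) \<le> K * M * N / (1 + norm x powr q)"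
    "\<And>f M x h. decaying q M f \<Longrightarrow> cmod (vel (sharp f) x) * cmod (vel (sharp f) x) \<le> K * M * M / (1 + norm x) ^ 3"
    "\<And>f M x h. decaying q M f \<Longrightarrow> cmod (vel (sharp f) x) * cmod (vel' (sharp f) x h) \<le> K * M * M * cmod h / (1 + norm x) ^ 3"
proof -
  obtain S where S: "S > 0" "\<And>f M. decaying q M f \<Longrightarrow> decaying q (S * M) (sharp f)" by (rule sharp_decaying) blast
  obtain C1 where C1: "C1 > 0" "\<And>f M x. decaying q M f \<Longrightarrow> cmod (vel f x) \<le> C1 * M * (1 + norm x)\<^sup>2"
    by (rule vel_bound[OF q]) blast
  obtain C2 where C2: "C2 > 0" "\<And>f M x h. decaying q M f \<Longrightarrow> cmod (vel' f x h) \<le> C2 * M * (1 + norm x)\<^sup>2 * cmod h"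
    by (rule vel'_bound[OF q]) blast
  obtain C3 where C3: "C3 > 0" "\<And>f M x. \<lbrakk>decaying q M f; balanced f; x \<noteq> 0\<rbrakk> \<Longrightarrow> cmod (vel f x) \<le> C3 * M * norm x powr (-(q-1)/2)"
    "\<And>f M x h. \<lbrakk>decaying q M f; balanced f; x \<noteq> 0\<rbrakk> \<Longrightarrow> cmod (vel' f x h) \<le> C3 * M * norm x powr (-(q+1)/2) * cmod h"
    by (rule vel_decay[OF q]) blast
  \<comment> \<open>On the unit disc \<open>(1 + norm x)^2 <= 4\<close>, whence the two factors 4;
    outside it the decay constant \<open>C3\<close> is the relevant one.\<close>
  define C where "C = 4 * C1 + 4 * C2 + C3"
  have Cp: "C > 0" "4 * C1 \<le> C" "4 * C2 \<le> C" "C3 \<le> C" using C1(1) C2(1) C3(1) by (auto simp: C_def)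
  define D where "D = C * S"
  have D: "D > 0" using Cp S by (simp add: D_def)
  \<comment> \<open>One weight for both regions: it is \<open>1\<close> on the unit disc and a power
    outside, and exponents still add under multiplication.\<close>
  define e where "e b x = max 1 (norm x) powr (-b)" for b and x :: "real^2"
  have e0: "e b x \<ge> 0" for b x by (simp add: e_def)
  have e_mult: "e b x * e b' x = e (b + b') x" for b b' x
    by (simp add: e_def flip: powr_add)
  have e_eq: "e b x = (if norm x \<le> 1 then 1 else norm x powr (-b))" for b x
    by (simp add: e_def max_def)
  have bd: "cmod (vel (sharp f) x) \<le> D * M * e ((q-1)/2) x" "cmod (vel' (sharp f) x h) \<le> D * M * e ((q+1)/2) x * cmod h"
    if f: "decaying q M f" for f M x h
  proof -
    have SM: "0 \<le> S * M" using decaying_nonneg[OF S(2)[OF f]] .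
    have up: "c * (S * M) * r \<le> D * M * r" if "c \<le> C" "r \<ge> 0" for c r
    proof -
      have "c * (S * M) * r \<le> C * (S * M) * r" using that SM by (intro mult_right_mono)
      then show ?thesis by (simp add: D_def mult_ac)
    qed
    have "cmod (vel (sharp f) x) \<le> D * M * e ((q-1)/2) x \<and> cmod (vel' (sharp f) x h) \<le> D * M * e ((q+1)/2) x * cmod h"
    proof (cases "norm x \<le> 1")
      case True
      have x4: "(1 + norm x)\<^sup>2 \<le> 4" using power_mono[of "1 + norm x" 2 2] True by simp
      have "cmod (vel (sharp f) x) \<le> C1 * (S * M) * 4"
        using x4 SM C1(1) by (intro order_trans[OF C1(2)[OF S(2)[OF f]]] mult_left_mono) auto
      also have "\<dots> \<le> D * M * 1" using up[OF Cp(2), of 1] by simp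
      finally have 1: "cmod (vel (sharp f) x) \<le> D * M * 1" .
      have "cmod (vel' (sharp f) x h) \<le> C2 * (S * M) * 4 * cmod h"
        using x4 SM C2(1) by (intro order_trans[OF C2(2)[OF S(2)[OF f]]] mult_left_mono mult_right_mono) auto
      also have "\<dots> \<le> D * M * 1 * cmod h" using up[OF Cp(3), of "cmod h"] by (simp add: mult_ac)
      finally show ?thesis using 1 True by (simp add: e_eq)
    next
      case False
      then have x: "x \<noteq> 0" by auto
      note b = sharp_balanced[OF q(1) f]
      have "cmod (vel (sharp f) x) \<le> D * M * norm x powr (-(q-1)/2)"
        by (rule order_trans[OF C3(2)[OF S(2)[OF f] b x] up[OF Cp(4)]]) simp
      moreover have "cmod (vel' (sharp f) x h) \<le> D * M * norm x powr (-(q+1)/2) * cmod h"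
        by (rule order_trans[OF C3(3)[OF S(2)[OF f] b x] mult_right_mono[OF up[OF Cp(4)]]]) simp_all
      moreover have "- ((q-1)/2) = -(q-1)/2" "- ((q+1)/2) = -(q+1)/2" by (simp_all add: field_simps)
      ultimately show ?thesis using False by (simp only: e_eq if_False)
    qed
    then show "cmod (vel (sharp f) x) \<le> D * M * e ((q-1)/2) x" "cmod (vel' (sharp f) x h) \<le> D * M * e ((q+1)/2) x * cmod h"
      by auto
  qed
  have eq: "e q x \<le> 8 / (1 + norm x powr q)" for x
  proof (cases "norm x \<le> 1")
    case True
    then have "norm x powr q \<le> 1" using q by (intro powr_le1) auto
    then show ?thesis using True by (simp add: e_eq pos_le_divide_eq add_pos_nonneg)
  next
    case False
    then have "1 \<le> norm x powr q" using q by (intro ge_one_powr_ge_zero) auto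
    then show ?thesis using False by (simp add: e_eq powr_minus_divide divide_simps add_pos_nonneg)
  qed
  \<comment> \<open>Cubing \<open>1 + norm x <= 2 * max 1 (norm x)\<close> gives the 8; the same 8
    stands in \<open>eq\<close>, so that \<open>prod\<close> serves all three estimates.\<close>
  have e3: "e b x \<le> 8 / (1 + norm x) ^ 3" if "b \<ge> 3" for b x
  proof -
    let ?m = "max 1 (norm x)"
    have "(1 + norm x) ^ 3 \<le> (2 * ?m) ^ 3" by (intro power_mono) auto
    then have "8 / (2 * ?m) ^ 3 \<le> 8 / (1 + norm x) ^ 3" by (intro frac_le) (auto intro!: zero_less_power add_pos_nonneg)
    moreover have "?m powr (-3) = 8 / (2 * ?m) ^ 3"
      using powr_realpow[of ?m 3] by (simp add: powr_minus_divide power_mult_distrib)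
    moreover have "e b x \<le> ?m powr (-3)" unfolding e_def using that by (intro powr_mono) auto
    ultimately show ?thesis by simp
  qed
  have prod: "X * Y \<le> 8 * D * D * M * N * c / w"
    if "X \<le> D * M * e b x" "Y \<le> D * N * e b' x * c" "e (b + b') x \<le> 8 / w" "0 \<le> M" "0 \<le> N" "0 \<le> c" "0 \<le> Y"
    for X Y M N b b' x c w
  proof -
    have "X * Y \<le> (D * M * e b x) * (D * N * e b' x * c)"
      using that D e0[of b x] by (intro mult_mono) auto
    also have "\<dots> = (D * M * (D * N) * c) * e (b + b') x" by (simp add: mult_ac flip: e_mult)
    also have "\<dots> \<le> (D * M * (D * N) * c) * (8 / w)" using that D by (intro mult_left_mono) auto
    finally show ?thesis by (simp add: mult_ac)
  qed
  have A: "cmod (vel' (sharp g) x (vel (sharp f) x)) \<le> 8 * D * D * M * N / (1 + norm x powr q)"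
    if f: "decaying q M f" and g: "decaying q N g" for f g M N x
  proof -
    have b: "e ((q-1)/2 + (q+1)/2) x \<le> 8 / (1 + norm x powr q)" using eq[of x] by (simp add: field_simps)
    have N: "0 \<le> N" "0 \<le> M" using f g by (auto intro: decaying_nonneg)
    have "cmod (vel' (sharp g) x (vel (sharp f) x)) \<le> cmod (vel (sharp f) x) * (D * N * e ((q+1)/2) x * 1)"
      using bd(2)[OF g, of x "vel (sharp f) x"] by (simp add: mult_ac)
    also have "\<dots> \<le> 8 * D * D * M * N * 1 / (1 + norm x powr q)"
      using D N e0 by (intro prod[OF bd(1)[OF f] order_refl b]) auto
    finally show ?thesis by simp
  qed
  have B: "cmod (vel (sharp f) x) * cmod (vel (sharp f) x) \<le> 8 * D * D * M * M / (1 + norm x) ^ 3"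
    if f: "decaying q M f" for f M x
    using prod[OF bd(1)[OF f, of x], of "cmod (vel (sharp f) x)" M "(q-1)/2" 1 "(1 + norm x) ^ 3"]
      bd(1)[OF f, of x] decaying_nonneg[OF f] e3[of "(q-1)/2 + (q-1)/2" x] q by simp
  have B': "cmod (vel (sharp f) x) * cmod (vel' (sharp f) x h) \<le> 8 * D * D * M * M * cmod h / (1 + norm x) ^ 3"
    if f: "decaying q M f" for f M x h
    using prod[OF bd(1)[OF f, of x] bd(2)[OF f, of x h], of "(1 + norm x) ^ 3"]
      decaying_nonneg[OF f] e3[of "(q-1)/2 + (q+1)/2" x] q by (simp add: field_simps)
  have "8 * D * D > 0" using D by simp
  then show thesis using A B B' by (rule that)
qed

end

section \<open>The fixed point\<close>

lemma bounded_linear_vel'_expand: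
  assumes "bounded_linear L"
  shows "L h = Re h *\<^sub>R L 1 + Im h *\<^sub>R L \<i>"
proof -
  interpret bounded_linear L by fact
  have "h = Re h *\<^sub>R 1 + Im h *\<^sub>R \<i>" by (simp add: complex_eq_iff)
  then have "L h = L (Re h *\<^sub>R 1 + Im h *\<^sub>R \<i>)" by simp
  then show ?thesis by (simp add: add scaleR)
qed

context
  fixes q :: real
  assumes q: "4 < q" "q < 5"
begin

lemma continuous_vel: "decaying q M f \<Longrightarrow> continuous_on UNIV (vel f)"
  using vel_has_derivative[OF q] by (meson has_derivative_continuous continuous_at_imp_continuous_on)

text \<open>Continuity of \<open>vel'\<close> in \<open>x\<close> is known for a fixed direction.
  Here the direction \<open>vel f x\<close> moves, so it is expanded in the real basis
  \<open>1\<close>, \<open>\<i>\<close>.\<close>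

lemma continuous_convection:
  assumes f: "decaying q M f"
  shows "continuous_on UNIV (\<lambda>x. vel' f x (vel f x))"
  unfolding bounded_linear_vel'_expand[OF bounded_linear_vel'[OF q f], of _ "vel f _"]
  by (intro continuous_intros continuous_vel'[OF q f] continuous_vel[OF f])

text \<open>In \<open>vel'_cauchy\<close> the right side is purely imaginary, and the real part of
  the left side is the divergence.\<close>

lemma vel_divergence:
  assumes f: "decaying q M f"
  shows "Re (vel' f x 1) + Im (vel' f x \<i>) = 0"
  using arg_cong[OF vel'_cauchy[OF q f, of x], of Re] by simp

text \<open>For a divergence-free field the convection term is the divergence of the tensor product
  of the field with itself, and this tensor decays fast enough for its derivatives to integrate to
  zero.\<close>

lemma convection_mean_zero:
  assumes f: "decaying q M f"
  shows "(\<integral>x. vel' (sharp f) x (vel (sharp f) x) \<partial>lborel) = 0"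
proof -
  obtain K where K: "K > 0"
    "\<And>f M x h. decaying q M f \<Longrightarrow> cmod (vel (sharp f) x) * cmod (vel (sharp f) x) \<le> K * M * M / (1 + norm x) ^ 3"
    "\<And>f M x h. decaying q M f \<Longrightarrow> cmod (vel (sharp f) x) * cmod (vel' (sharp f) x h) \<le> K * M * M * cmod h / (1 + norm x) ^ 3"
    by (rule convection_bound[OF q]) blast
  obtain S where S: "\<And>f M. decaying q M f \<Longrightarrow> decaying q (S * M) (sharp f)" by (rule sharp_decaying[OF q]) blast
  note sf = S[OF f]
  let ?V = "vel (sharp f)" and ?V' = "vel' (sharp f)"
  have cV: "continuous_on UNIV ?V" by (rule continuous_vel[OF sf])
  have cV': "continuous_on UNIV (\<lambda>x. ?V' x h)" for h by (rule continuous_vel'[OF q sf])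
  \<comment> \<open>\<open>L\<close> extracts a component: \<open>Re\<close> is paired with the
    first direction and \<open>Im\<close> with the second, and the two instances add up to the
    divergence of the tensor.\<close>
  have zero: "(\<integral>x. L (?V' x (cx e)) *\<^sub>R ?V x + L (?V x) *\<^sub>R ?V' x (cx e) \<partial>lborel) = 0"
    and int: "integrable lborel (\<lambda>x. L (?V' x (cx e)) *\<^sub>R ?V x + L (?V x) *\<^sub>R ?V' x (cx e))"
    if L: "bounded_linear L" "\<And>z. \<bar>L z\<bar> \<le> cmod z" and e: "norm e = 1" for L :: "complex \<Rightarrow> real" and e
  proof -
    note cL = bounded_linear.continuous_on[OF L(1)]
    let ?F' = "\<lambda>x h. L (?V x) *\<^sub>R ?V' x (cx h) + L (?V' x (cx h)) *\<^sub>R ?V x"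
    have d: "((\<lambda>x. L (?V x) *\<^sub>R ?V x) has_derivative ?F' x) (at x)" for x
      by (intro has_derivative_scaleR bounded_linear.has_derivative[OF L(1)] vel_has_derivative[OF q sf])
    have m1: "(\<lambda>x. L (?V x) *\<^sub>R ?V x) \<in> borel_measurable borel" and m2: "(\<lambda>x. ?F' x e) \<in> borel_measurable borel"
      by (intro borel_measurable_continuous_onI continuous_intros cL cV cV')+
    have i: "integrable lborel (\<lambda>x. L (?V x) *\<^sub>R ?V x)"
    proof (rule integrable_cube[OF m1])
      show "norm (L (?V x) *\<^sub>R ?V x) \<le> K * M * M / (1 + norm x) ^ 3" for x
        unfolding norm_scaleR by (intro order_trans[OF mult_right_mono[OF L(2)] K(2)[OF f]]) auto
    qed
    have b: "norm (?F' x e) \<le> (2 * (K * M * M)) / (1 + norm x) ^ 3" for x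
    proof -
      have "norm (?F' x e) \<le> \<bar>L (?V x)\<bar> * cmod (?V' x (cx e)) + \<bar>L (?V' x (cx e))\<bar> * cmod (?V x)"
        by (rule order_trans[OF norm_triangle_ineq]) simp
      also have "\<dots> \<le> cmod (?V x) * cmod (?V' x (cx e)) + cmod (?V' x (cx e)) * cmod (?V x)"
        by (intro add_mono mult_right_mono L(2)) auto
      also have "\<dots> = 2 * (cmod (?V x) * cmod (?V' x (cx e)))" by simp
      also have "\<dots> \<le> 2 * (K * M * M * cmod (cx e) / (1 + norm x) ^ 3)" by (intro mult_left_mono K(3)[OF f]) auto
      finally show ?thesis using e by simp
    qed
    show "(\<integral>x. L (?V' x (cx e)) *\<^sub>R ?V x + L (?V x) *\<^sub>R ?V' x (cx e) \<partial>lborel) = 0"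
      "integrable lborel (\<lambda>x. L (?V' x (cx e)) *\<^sub>R ?V x + L (?V x) *\<^sub>R ?V' x (cx e))"
      using integral_deriv_eq_0[OF d i b e m2] by (simp_all add: add.commute)
  qed
  have ax: "cx (axis 1 1) = 1" "cx (axis 2 1) = \<i>" by (simp_all add: complex_eq_iff axis_def)
  have n: "norm (axis i (1::real) :: real^2) = 1" for i by simp
  note z1 = zero[OF bounded_linear_Re abs_Re_le_cmod n[of 1]] int[OF bounded_linear_Re abs_Re_le_cmod n[of 1]]
  note z2 = zero[OF bounded_linear_Im abs_Im_le_cmod n[of 2]] int[OF bounded_linear_Im abs_Im_le_cmod n[of 2]]
  have "vel' (sharp f) x (vel (sharp f) x)
    = (Re (?V' x (cx (axis 1 1))) *\<^sub>R ?V x + Re (?V x) *\<^sub>R ?V' x (cx (axis 1 1)))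
    + (Im (?V' x (cx (axis 2 1))) *\<^sub>R ?V x + Im (?V x) *\<^sub>R ?V' x (cx (axis 2 1)))" for x
  proof -
    have "Re (?V' x 1) *\<^sub>R ?V x + Im (?V' x \<i>) *\<^sub>R ?V x = 0"
      using vel_divergence[OF sf, of x] by (simp flip: scaleR_left_distrib)
    then show ?thesis
      unfolding ax bounded_linear_vel'_expand[OF bounded_linear_vel'[OF q sf], of x "?V x"] by (simp add: algebra_simps)
  qed
  then show ?thesis using z1 z2 by simp
qed

text \<open>Multiplication by the weight \<open>W\<close> identifies the weighted space with the
  bounded continuous functions, which are complete in the supremum norm. In the application
  \<open>c\<close> is the square of the normalising constant of the velocity, the convection term
  being quadratic.\<close>

lemma fixed_point:
  assumes c: "c \<ge> (0::real)"
  obtains \<nu> where "\<nu> > 0" "\<And>k. decaying q \<nu> k \<Longrightarrow>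
    \<exists>f M. decaying q M f \<and> (\<forall>x. f x = k x + c *\<^sub>R vel' (sharp f) x (vel (sharp f) x))"
proof -
  obtain K where K: "K > 0" "\<And>f g M N x. \<lbrakk>decaying q M f; decaying q N g\<rbrakk> \<Longrightarrow>
      cmod (vel' (sharp g) x (vel (sharp f) x)) \<le> K * M * N / (1 + norm x powr q)"
    by (rule convection_bound[OF q]) blast
  obtain S where S: "\<And>f M. decaying q M f \<Longrightarrow> decaying q (S * M) (sharp f)" by (rule sharp_decaying[OF q]) blast
  \<comment> \<open>The summand 1 ensures \<open>L > 0\<close>, also for
    \<open>c = 0\<close>.\<close>
  define L where "L = c * K + 1"
  have L: "L > 0" "c * K \<le> L" using c K(1) by (auto simp: L_def intro!: add_nonneg_pos)
  \<comment> \<open>With \<open>L * R = 1/4\<close> the quadratic term costs \<open>R/4\<close>,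
    within the half of the ball that \<open>k\<close> leaves free, and the Lipschitz constant
    \<open>2 * L * R\<close> is \<open>1/2\<close>.\<close>
  define R where "R = 1 / (4 * L)"
  have R: "R > 0" "L * R = 1/4" using L by (auto simp: R_def)
  have "\<exists>f M. decaying q M f \<and> (\<forall>x. f x = k x + c *\<^sub>R vel' (sharp f) x (vel (sharp f) x))"
    if k: "decaying q (R/2) k" for k
  proof -
    define W where "W y = 1 + norm y powr q" for y :: "real^2"
    have W: "W y > 0" for y by (simp add: W_def add_pos_nonneg)
    have cW: "continuous_on UNIV W" unfolding W_def using q by (intro continuous_intros continuous_on_powr') auto
    define F where "F \<phi> y = (1 / W y) *\<^sub>R apply_bcontfun \<phi> y" for \<phi> :: "(real^2) \<Rightarrow>\<^sub>C complex" and y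
    define N where "N f x = c *\<^sub>R vel' (sharp f) x (vel (sharp f) x)" for f x
    have Wnz: "W y \<noteq> 0" for y using W[of y] by simp
    have Fc: "continuous_on UNIV (F \<phi>)" for \<phi>
      unfolding F_def using Wnz by (intro continuous_intros cW) auto
    have Fd: "decaying q M (F \<phi>)" if "\<And>y. cmod (apply_bcontfun \<phi> y) \<le> M" for \<phi> M
    proof -
      have "cmod (F \<phi> y) \<le> M / W y" for y
        using divide_right_mono[OF that[of y], of "W y"] W[of y] by (simp add: F_def)
      then show ?thesis using Fc unfolding decaying_def W_def by blast
    qed
    have Bd: "W x * cmod (c *\<^sub>R vel' (sharp g) x (vel (sharp f) x)) \<le> L * M * M'"
      if f: "decaying q M f" and g: "decaying q M' g" for f g M M' x
    proof -
      have "cmod (vel' (sharp g) x (vel (sharp f) x)) \<le> K * M * M' / W x" unfolding W_def by (rule K(2)[OF f g])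
      then have "W x * cmod (vel' (sharp g) x (vel (sharp f) x)) \<le> K * M * M'"
        using W[of x] by (simp add: pos_le_divide_eq mult.commute)
      then have "c * (W x * cmod (vel' (sharp g) x (vel (sharp f) x))) \<le> c * (K * M * M')"
        using c by (rule mult_left_mono)
      also have "\<dots> = (c * K) * (M * M')" by simp
      also have "\<dots> \<le> L * (M * M')"
        using decaying_nonneg[OF f] decaying_nonneg[OF g] by (intro mult_right_mono L(2)) auto
      finally show ?thesis using c by (simp add: mult_ac)
    qed
    \<comment> \<open>\<open>T \<phi>\<close> is a plain function.
      \<open>Bcontfun (T \<phi>)\<close> represents it only once it is bounded and continuous, which
      \<open>app\<close> secures on the ball.\<close>
    define T where "T \<phi> x = W x *\<^sub>R (k x + N (F \<phi>) x)" for \<phi> x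
    have Tc: "continuous_on UNIV (T \<phi>)" if "\<And>y. cmod (apply_bcontfun \<phi> y) \<le> R" for \<phi>
      unfolding T_def N_def using k
      by (intro continuous_intros cW continuous_convection[OF S[OF Fd[OF that]]]) (auto simp: decaying_def)
    have Tb: "cmod (T \<phi> x) \<le> R" if b: "\<And>y. cmod (apply_bcontfun \<phi> y) \<le> R" for \<phi> x
    proof -
      have 1: "W x * cmod (k x) \<le> R / 2"
      proof -
        have "cmod (k x) \<le> (R/2) / W x" using k by (auto simp: decaying_def W_def)
        then show ?thesis using W[of x] by (simp add: pos_le_divide_eq mult_ac)
      qed
      have "cmod (T \<phi> x) = W x * cmod (k x + N (F \<phi>) x)" using W[of x] by (simp add: T_def)
      also have "\<dots> \<le> W x * (cmod (k x) + cmod (N (F \<phi>) x))" using W[of x] by (intro mult_left_mono norm_triangle_ineq) auto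
      also have "\<dots> = W x * cmod (k x) + W x * cmod (N (F \<phi>) x)" by (rule distrib_left)
      also have "\<dots> \<le> R / 2 + L * R * R" unfolding N_def using 1 Bd[OF Fd[OF b] Fd[OF b]] by (rule add_mono)
      also have "\<dots> \<le> R" unfolding R(2) using R(1) by simp
      finally show ?thesis .
    qed
    have app: "apply_bcontfun (Bcontfun (T \<phi>)) = T \<phi>" if b: "\<And>y. cmod (apply_bcontfun \<phi> y) \<le> R" for \<phi>
      using bcontfun_normI[OF Tc[OF b] Tb[OF b]] by (rule Bcontfun_inverse)
    have lip: "cmod (T \<phi> x - T \<psi> x) \<le> 1/2 * dist \<phi> \<psi>"
      if b1: "\<And>y. cmod (apply_bcontfun \<phi> y) \<le> R" and b2: "\<And>y. cmod (apply_bcontfun \<psi> y) \<le> R" for \<phi> \<psi> x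
    proof -
      let ?f = "F \<phi>" and ?g = "F \<psi>"
      have f: "decaying q R ?f" and g: "decaying q R ?g" using Fd b1 b2 by blast+
      have d: "decaying q (dist \<phi> \<psi>) (\<lambda>y. ?f y - ?g y)"
      proof -
        have "cmod (?f y - ?g y) \<le> dist \<phi> \<psi> / W y" for y
        proof -
          have "cmod (?f y - ?g y) = cmod (apply_bcontfun \<phi> y - apply_bcontfun \<psi> y) / W y"
            using W[of y] by (simp add: F_def flip: scaleR_diff_right)
          also have "\<dots> \<le> dist \<phi> \<psi> / W y"
            using W[of y] dist_bounded[of \<phi> y \<psi>] by (intro divide_right_mono) (auto simp: dist_norm)
          finally show ?thesis .
        qed
        then show ?thesis unfolding decaying_def W_def by (auto intro!: continuous_intros Fc)
      qed
      let ?d = "sharp (\<lambda>y. ?f y - ?g y)"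
      have sd: "?d = (\<lambda>y. sharp ?f y - sharp ?g y)" by (rule sharp_diff[OF q(1) f g])
      have vd: "vel ?d x = vel (sharp ?f) x - vel (sharp ?g) x" "vel' ?d x h = vel' (sharp ?f) x h - vel' (sharp ?g) x h" for h
        unfolding sd by (rule vel_diff[OF q S[OF f] S[OF g]])+
      interpret bounded_linear "vel' (sharp ?f) x" by (rule bounded_linear_vel'[OF q S[OF f]])
      \<comment> \<open>The usual splitting of a bilinear difference: the increment stands once in
        the transporting velocity and once in the gradient.\<close>
      have "N ?f x - N ?g x = c *\<^sub>R vel' (sharp ?f) x (vel ?d x) + c *\<^sub>R vel' ?d x (vel (sharp ?g) x)"
        unfolding N_def vd diff by (simp add: algebra_simps)
      then have "T \<phi> x - T \<psi> x = W x *\<^sub>R (c *\<^sub>R vel' (sharp ?f) x (vel ?d x) + c *\<^sub>R vel' ?d x (vel (sharp ?g) x))"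
        unfolding T_def by (simp flip: scaleR_diff_right)
      then have "cmod (T \<phi> x - T \<psi> x) = W x * cmod (c *\<^sub>R vel' (sharp ?f) x (vel ?d x) + c *\<^sub>R vel' ?d x (vel (sharp ?g) x))"
        using W[of x] by simp
      also have "\<dots> \<le> W x * (cmod (c *\<^sub>R vel' (sharp ?f) x (vel ?d x)) + cmod (c *\<^sub>R vel' ?d x (vel (sharp ?g) x)))"
        using W[of x] by (intro mult_left_mono norm_triangle_ineq) auto
      also have "\<dots> = W x * cmod (c *\<^sub>R vel' (sharp ?f) x (vel ?d x)) + W x * cmod (c *\<^sub>R vel' ?d x (vel (sharp ?g) x))"
        by (rule distrib_left)
      also have "\<dots> \<le> L * dist \<phi> \<psi> * R + L * R * dist \<phi> \<psi>" by (intro add_mono Bd f g d)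
      also have "\<dots> = 2 * (L * R) * dist \<phi> \<psi>" by simp
      also have "\<dots> = 1/2 * dist \<phi> \<psi>" unfolding R(2) by simp
      finally show ?thesis .
    qed
    have ball: "cmod (apply_bcontfun \<phi> y) \<le> R" if "\<phi> \<in> cball 0 R" for \<phi> y
      using dist_bounded[of 0 y \<phi>] that by (auto simp: dist_norm intro: order_trans)
    have "\<exists>!\<phi>\<in>cball 0 R. Bcontfun (T \<phi>) = \<phi>"
    proof (rule Banach_fix[where c="1/2"])
      show "complete (cball 0 R :: ((real^2) \<Rightarrow>\<^sub>C complex) set)" by (simp add: complete_eq_closed)
      show "cball 0 R \<noteq> ({} :: ((real^2) \<Rightarrow>\<^sub>C complex) set)" using R by simp
      show "(\<lambda>\<phi>. Bcontfun (T \<phi>)) ` cball 0 R \<subseteq> cball 0 R"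
      proof (rule image_subsetI)
        fix \<phi> :: "(real^2) \<Rightarrow>\<^sub>C complex" assume \<phi>: "\<phi> \<in> cball 0 R"
        have "dist (Bcontfun (T \<phi>)) 0 \<le> R"
          by (rule dist_bound) (use app[OF ball[OF \<phi>]] Tb[OF ball[OF \<phi>]] in simp)
        then show "Bcontfun (T \<phi>) \<in> cball 0 R" by (simp add: dist_commute)
      qed
      show "dist (Bcontfun (T \<phi>)) (Bcontfun (T \<psi>)) \<le> 1/2 * dist \<phi> \<psi>" if "\<phi> \<in> cball 0 R" "\<psi> \<in> cball 0 R" for \<phi> \<psi>
      proof (rule dist_bound)
        show "dist (apply_bcontfun (Bcontfun (T \<phi>)) x) (apply_bcontfun (Bcontfun (T \<psi>)) x) \<le> 1/2 * dist \<phi> \<psi>" for x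
          using that lip[OF ball ball, of \<phi> \<psi> x] app[OF ball, of \<phi>] app[OF ball, of \<psi>] by (simp add: dist_norm)
      qed
    qed auto
    then obtain \<phi> where \<phi>: "\<phi> \<in> cball 0 R" "Bcontfun (T \<phi>) = \<phi>" by blast
    have "apply_bcontfun \<phi> x = W x *\<^sub>R (k x + N (F \<phi>) x)" for x
      using app[OF ball[OF \<phi>(1)]] \<phi>(2) by (simp add: T_def[abs_def])
    then have "F \<phi> x = k x + N (F \<phi>) x" for x using W[of x] by (simp add: F_def)
    then show ?thesis using Fd[OF ball[OF \<phi>(1)]] unfolding N_def by blast
  qed
  then show thesis using that[of "R/2"] R by simp
qed

end

section \<open>Translation to real vector fields and assembly of the solution\<close>

definition uncx :: "complex \<Rightarrow> real^2" where "uncx z = vector [Re z, Im z]"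

lemma uncx_simps[simp]: "uncx z $ 1 = Re z" "uncx z $ 2 = Im z" "cx (uncx z) = z" "uncx (cx x) = x" "norm (uncx z) = cmod z"
  by (simp_all add: uncx_def complex_eq_iff vec_eq_iff forall_2 norm_plane cmod_def)

lemma bounded_linear_uncx: "bounded_linear uncx"
  by (rule bounded_linear_intro[where K=1]) (auto simp: vec_eq_iff forall_2)

lemma cx_corrected_force:
  "cx (corrected_force k a x) = cx (k x) + (gauss x / pi) *\<^sub>R (Complex (a$1) (a$2) * cnj (cx x) + \<i> * of_real (a$3) * cx x)"
  by (simp add: corrected_force_def gauss_def complex_eq_iff algebra_simps)

text \<open>In polar form \<open>1 / (cnj z)^2\<close>, \<open>1 / z^2\<close> and
  \<open>z / (cnj z)^3\<close> are \<open>1 / r^2\<close> times exponentials with the angles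
  \<open>2\<theta>\<close>, \<open>-2\<theta>\<close> and \<open>4\<theta>\<close>. The lone cosine
  and sine of \<open>2\<theta>\<close> in the last two fields split into the angles
  \<open>2\<theta>\<close> and \<open>-2\<theta>\<close>, hence the halves.\<close>

lemma cx_asymptotic_profile:
  assumes x: "x \<noteq> 0"
  shows "cx (asymptotic_profile A x) = (1 / (4 * pi)) *\<^sub>R
     (Complex (A$1 + A$3 / 2) (- A$2 - A$4 / 2) / (cnj (cx x))\<^sup>2
      + Complex (A$3) (A$4) / (2 * (cx x)\<^sup>2) + Complex (A$3) (- A$4) * cx x / (cnj (cx x)) ^ 3)"
proof -
  define r where "r = norm x"
  define t where "t = polar_angle x"
  have r: "r > 0" using x by (simp add: r_def)
  have z: "cx x = of_real r * cis t"
    using rcis_cmod_Arg[of "cx x"] by (simp add: r_def t_def polar_angle_def cx_def[symmetric] rcis_def)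
  have cz: "cnj (cx x) = of_real r * cis (- t)" unfolding z by (simp add: cis_cnj)
  have p2: "(cis s)\<^sup>2 = cis (2 * s)" for s by (simp add: power2_eq_square cis_mult)
  have e1: "1 / (cnj (cx x))\<^sup>2 = (1 / r\<^sup>2) *\<^sub>R cis (2 * t)"
    unfolding cz power_mult_distrib p2 using r
    by (simp add: scaleR_conv_of_real divide_inverse)
  have e2: "1 / (cx x)\<^sup>2 = (1 / r\<^sup>2) *\<^sub>R cis (- (2 * t))"
    unfolding z power_mult_distrib p2 using r
    by (simp add: scaleR_conv_of_real divide_inverse)
  have e3: "cx x / (cnj (cx x)) ^ 3 = (1 / r\<^sup>2) *\<^sub>R cis (4 * t)"
  proof -
    have p3: "(cis s) ^ 3 = cis (3 * s)" for s by (simp add: power3_eq_cube cis_mult)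
    have "cx x / (cnj (cx x)) ^ 3 = of_real (r / r ^ 3) * (cis t / cis (3 * - t))"
      unfolding cz power_mult_distrib p3 unfolding z by simp
    also have "cis t / cis (3 * - t) = cis (4 * t)" by (simp add: cis_divide)
    also have "r / r ^ 3 = 1 / r\<^sup>2" using r by (simp add: power3_eq_cube power2_eq_square)
    finally show ?thesis by (simp add: scaleR_conv_of_real)
  qed
  have "Complex (A$1 + A$3 / 2) (- A$2 - A$4 / 2) / (cnj (cx x))\<^sup>2
      + Complex (A$3) (A$4) / (2 * (cx x)\<^sup>2) + Complex (A$3) (- A$4) * cx x / (cnj (cx x)) ^ 3
    = Complex (A$1 + A$3 / 2) (- A$2 - A$4 / 2) * (1 / (cnj (cx x))\<^sup>2)
      + Complex (A$3) (A$4) / 2 * (1 / (cx x)\<^sup>2) + Complex (A$3) (- A$4) * (cx x / (cnj (cx x)) ^ 3)"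
    by simp
  also have "\<dots> = (1 / r\<^sup>2) *\<^sub>R (Complex (A$1 + A$3 / 2) (- A$2 - A$4 / 2) * cis (2 * t)
      + Complex (A$3) (A$4) / 2 * cis (- (2 * t)) + Complex (A$3) (- A$4) * cis (4 * t))"
    unfolding e1 e2 e3 by (simp add: scaleR_add_right)
  finally have rhs: "Complex (A$1 + A$3 / 2) (- A$2 - A$4 / 2) / (cnj (cx x))\<^sup>2
      + Complex (A$3) (A$4) / (2 * (cx x)\<^sup>2) + Complex (A$3) (- A$4) * cx x / (cnj (cx x)) ^ 3 = \<dots>" .
  let ?V = "A$1 *\<^sub>R vector [cos (2*t), sin (2*t)]
     + A$2 *\<^sub>R vector [sin (2*t), - cos (2*t)] + A$3 *\<^sub>R vector [cos (2*t) + cos (4*t), sin (4*t)]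
     + A$4 *\<^sub>R vector [sin (2*t) + sin (4*t), - cos (4*t)] :: real^2"
  have "asymptotic_profile A x = (1 / (4 * pi)) *\<^sub>R (1 / r\<^sup>2) *\<^sub>R ?V"
    unfolding asymptotic_profile_def Let_def r_def[symmetric] t_def[symmetric] by (simp add: scaleR_add_right)
  moreover have "cx ?V = Complex (A$1 + A$3 / 2) (- A$2 - A$4 / 2) * cis (2 * t)
      + Complex (A$3) (A$4) / 2 * cis (- (2 * t)) + Complex (A$3) (- A$4) * cis (4 * t)"
    by (simp add: complex_eq_iff field_simps)
  ultimately show ?thesis unfolding rhs by (simp only: cx_simps)
qed

text \<open>A real supremum says nothing about an unbounded set, so membership in
  \<open>B_space\<close> has to supply boundedness before \<open>B_norm\<close> can be read as a
  pointwise bound.\<close>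

lemma decaying_of_B_space:
  assumes q: "q > 0" and k: "k \<in> B_space 0 q" and n: "B_norm 0 q k \<le> \<nu>"
  shows "decaying q \<nu> (\<lambda>x. cx (k x))"
proof -
  have w: "weight q x = 1 + norm x powr q" for x using q by (simp add: weight_def)
  have p: "0 < 1 + norm x powr q" for x :: "real^2" by (simp add: add_pos_nonneg)
  have "{\<alpha>. mi_length \<alpha> \<le> 0} = {(0, 0)}" by (auto simp: mi_length_def)
  then have "B_norm 0 q k = (SUP x. (1 + norm x powr q) * norm (k x))"
    by (simp add: B_norm_def mi_deriv_def mi_length_def w)
  moreover have "bounded (range (\<lambda>x. weight (q + real (mi_length (0, 0))) x *\<^sub>R mi_deriv (0, 0) k x))"
    using k unfolding B_space_def by (auto simp: mi_length_def)
  then have "bounded (range (\<lambda>x. (1 + norm x powr q) *\<^sub>R k x))"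
    by (simp add: mi_deriv_def mi_length_def w)
  then obtain B where "\<And>x. norm ((1 + norm x powr q) *\<^sub>R k x) \<le> B" by (auto simp: bounded_iff)
  then have "bdd_above (range (\<lambda>x. (1 + norm x powr q) * norm (k x)))"
    using p by (intro bdd_aboveI[of _ B]) (auto simp: less_imp_le)
  ultimately have "(1 + norm x powr q) * norm (k x) \<le> \<nu>" for x
    using cSUP_upper[of x UNIV "\<lambda>x. (1 + norm x powr q) * norm (k x)"] n by fastforce
  then have "norm (k x) \<le> \<nu> / (1 + norm x powr q)" for x
    using p[of x] by (simp add: pos_le_divide_eq mult.commute)
  moreover have "continuous_on UNIV k" using k by (simp add: B_space_def)
  ultimately show ?thesis unfolding decaying_def by (auto intro!: continuous_intros)
qed

text \<open>Both momentum components are bundled into one complex identity. The pressure enters with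
  a plus sign, because its distributional derivative contributes a second minus, and it is tested
  against \<open>2 * dbar \<phi>\<close>, whose components are the partial derivatives.\<close>

lemma stationary_NS_complex:
  assumes u: "\<And>\<phi>. tfun \<phi> \<Longrightarrow>
      has_bochner_integral lborel (\<lambda>x. partial_deriv 1 (partial_deriv 1 \<phi>) x *\<^sub>R cx (u x)) (I1 \<phi>)
    \<and> has_bochner_integral lborel (\<lambda>x. partial_deriv 2 (partial_deriv 2 \<phi>) x *\<^sub>R cx (u x)) (I2 \<phi>)
    \<and> has_bochner_integral lborel (\<lambda>x. p x *\<^sub>R (2 * dbar \<phi> x)) (P \<phi>)
    \<and> has_bochner_integral lborel (\<lambda>x. \<phi> x *\<^sub>R cx (convection u x)) (N \<phi>)
    \<and> has_bochner_integral lborel (\<lambda>x. \<phi> x *\<^sub>R cx (f x)) (F \<phi>)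
    \<and> I1 \<phi> + I2 \<phi> + P \<phi> - N \<phi> = F \<phi>
    \<and> has_bochner_integral lborel (\<lambda>x. partial_deriv 1 \<phi> x *\<^sub>R cx (u x)) (J1 \<phi>)
    \<and> has_bochner_integral lborel (\<lambda>x. partial_deriv 2 \<phi> x *\<^sub>R cx (u x)) (J2 \<phi>)
    \<and> Re (J1 \<phi>) + Im (J2 \<phi>) = 0"
  shows "stationary_NS u p f"
  unfolding stationary_NS_def
proof (intro allI impI)
  fix \<phi> assume "test_function \<phi>"
  then have t: "tfun \<phi>" by (rule test_function_tfun)
  note h = u[OF t]
  have comp: "(\<integral>x. c x * Re (g x) \<partial>lborel) = Re G" "(\<integral>x. c x * Im (g x) \<partial>lborel) = Im G"
    if "has_bochner_integral lborel (\<lambda>x. c x *\<^sub>R g x) G" for c :: "real^2 \<Rightarrow> real" and g :: "real^2 \<Rightarrow> complex" and G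
    using has_bochner_integral_bounded_linear[OF bounded_linear_Re that]
      has_bochner_integral_bounded_linear[OF bounded_linear_Im that]
    by (simp_all add: has_bochner_integral_iff)
  have c1: "(\<integral>x. u x $ 1 * partial_deriv 1 (partial_deriv 1 \<phi>) x \<partial>lborel) = Re (I1 \<phi>)"
    "(\<integral>x. u x $ 2 * partial_deriv 1 (partial_deriv 1 \<phi>) x \<partial>lborel) = Im (I1 \<phi>)"
    "(\<integral>x. u x $ 1 * partial_deriv 2 (partial_deriv 2 \<phi>) x \<partial>lborel) = Re (I2 \<phi>)"
    "(\<integral>x. u x $ 2 * partial_deriv 2 (partial_deriv 2 \<phi>) x \<partial>lborel) = Im (I2 \<phi>)"
    "(\<integral>x. convection u x $ 1 * \<phi> x \<partial>lborel) = Re (N \<phi>)" "(\<integral>x. convection u x $ 2 * \<phi> x \<partial>lborel) = Im (N \<phi>)"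
    "(\<integral>x. f x $ 1 * \<phi> x \<partial>lborel) = Re (F \<phi>)" "(\<integral>x. f x $ 2 * \<phi> x \<partial>lborel) = Im (F \<phi>)"
    "(\<integral>x. u x $ 1 * partial_deriv 1 \<phi> x \<partial>lborel) = Re (J1 \<phi>)"
    "(\<integral>x. u x $ 2 * partial_deriv 2 \<phi> x \<partial>lborel) = Im (J2 \<phi>)"
    using comp[of "partial_deriv 1 (partial_deriv 1 \<phi>)" "\<lambda>x. cx (u x)"] comp[of "partial_deriv 2 (partial_deriv 2 \<phi>)" "\<lambda>x. cx (u x)"]
      comp[of \<phi> "\<lambda>x. cx (convection u x)"] comp[of \<phi> "\<lambda>x. cx (f x)"]
      comp[of "partial_deriv 1 \<phi>" "\<lambda>x. cx (u x)"] comp[of "partial_deriv 2 \<phi>" "\<lambda>x. cx (u x)"] h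
    by (simp_all add: mult.commute)
  have c2: "(\<integral>x. p x * partial_deriv 1 \<phi> x \<partial>lborel) = Re (P \<phi>)" "(\<integral>x. p x * partial_deriv 2 \<phi> x \<partial>lborel) = Im (P \<phi>)"
    using comp[of p "\<lambda>x. 2 * dbar \<phi> x"] h by (simp_all add: dbar_def)
  have eq: "Re (I1 \<phi>) + Re (I2 \<phi>) + Re (P \<phi>) - Re (N \<phi>) = Re (F \<phi>)" "Im (I1 \<phi>) + Im (I2 \<phi>) + Im (P \<phi>) - Im (N \<phi>) = Im (F \<phi>)"
    using arg_cong[of _ _ Re, OF h[THEN conjunct2, THEN conjunct2, THEN conjunct2, THEN conjunct2, THEN conjunct2, THEN conjunct1]]
      arg_cong[of _ _ Im, OF h[THEN conjunct2, THEN conjunct2, THEN conjunct2, THEN conjunct2, THEN conjunct2, THEN conjunct1]]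
    by simp_all
  show "(\<forall>i. (\<Sum>j\<in>UNIV. distr_deriv j (distr_deriv j (distr_of (\<lambda>x. u x $ i))) \<phi>)
            - distr_deriv i (distr_of p) \<phi>
            - distr_of (\<lambda>x. convection u x $ i) \<phi>
          = distr_of (\<lambda>x. f x $ i) \<phi>) \<and>
     (\<Sum>j\<in>UNIV. distr_deriv j (distr_of (\<lambda>x. u x $ j)) \<phi>) = 0"
    unfolding forall_2 sum_2 distr_deriv_def distr_of_def c1 c2 using eq h by simp
qed

text \<open>The coefficients of \<open>1 / z^2\<close> and \<open>z / (cnj z)^3\<close> are tied to
  each other through \<open>c\<close> on the right and through \<open>A$3\<close>,
  \<open>A$4\<close> on the left, so four real parameters suffice.\<close>

lemma matching_coefficients:
  fixes \<kappa> :: real and c B :: complex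
  assumes "\<kappa> > 0"
  shows "\<exists>A :: real^4. \<forall>z. (1 / (4 * pi)) *\<^sub>R (Complex (A$1 + A$3 / 2) (- A$2 - A$4 / 2) / (cnj z)\<^sup>2
      + Complex (A$3) (A$4) / (2 * z\<^sup>2) + Complex (A$3) (- A$4) * z / (cnj z) ^ 3)
    = (1 / (8 * \<kappa>)) *\<^sub>R (- c / (2 * z\<^sup>2) + B / (cnj z)\<^sup>2 - z * cnj c / (cnj z) ^ 3)"
proof -
  \<comment> \<open>The ratio of the two prefactors \<open>1 / (8 * \<kappa>)\<close> and
    \<open>1 / (4 * pi)\<close>.\<close>
  define l where "l = pi / (2 * \<kappa>)"
  define A :: "real^4" where "A = (\<chi> i. if i = 1 then l * Re B + l * Re c / 2 else if i = 2 then - (l * Im B) + l * Im c / 2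
    else if i = 3 then - (l * Re c) else - (l * Im c))"
  have A: "A$1 = l * Re B + l * Re c / 2" "A$2 = - (l * Im B) + l * Im c / 2" "A$3 = - (l * Re c)" "A$4 = - (l * Im c)"
    by (simp_all add: A_def)
  have C: "Complex (A$1 + A$3 / 2) (- A$2 - A$4 / 2) = l *\<^sub>R B" "Complex (A$3) (A$4) = l *\<^sub>R (- c)" "Complex (A$3) (- A$4) = l *\<^sub>R (- cnj c)"
    unfolding A by (simp_all add: complex_eq_iff)
  have l: "1 / (4 * pi) * l = 1 / (8 * \<kappa>)" using assms by (simp add: l_def)
  have "(1 / (4 * pi)) *\<^sub>R (Complex (A$1 + A$3 / 2) (- A$2 - A$4 / 2) / (cnj z)\<^sup>2
      + Complex (A$3) (A$4) / (2 * z\<^sup>2) + Complex (A$3) (- A$4) * z / (cnj z) ^ 3)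
    = (1 / (8 * \<kappa>)) *\<^sub>R (- c / (2 * z\<^sup>2) + B / (cnj z)\<^sup>2 - z * cnj c / (cnj z) ^ 3)" for z
  proof -
    have "(l *\<^sub>R B) / X + (l *\<^sub>R (- c)) / Y + (l *\<^sub>R (- cnj c)) * z / Z = l *\<^sub>R (- c / Y + B / X - z * cnj c / Z)" for X Y Z
      by (simp add: scaleR_conv_of_real algebra_simps)
    then show ?thesis unfolding C l[symmetric] by (simp add: mult.commute)
  qed
  then show ?thesis by blast
qed

theorem theorem3p6:
  fixes \<epsilon> :: real
  assumes "0 < \<epsilon>" and "\<epsilon> < 1"
  shows "\<exists>\<nu>>0. \<forall>k :: real^2 \<Rightarrow> real^2.
    k \<in> B_space 0 (4 + \<epsilon>) \<and> B_norm 0 (4 + \<epsilon>) k \<le> \<nu> \<and> (LINT x|lborel. k x) = 0 \<longrightarrow>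
    (\<exists>a :: real^3. \<exists>(u :: real^2 \<Rightarrow> real^2) (p :: real^2 \<Rightarrow> real).
       Ck 1 u \<and> Ck 0 p \<and>
       stationary_NS u p (corrected_force k a) \<and>
       (u \<longlongrightarrow> 0) at_infinity \<and>
       (\<exists>A :: real^4.
          (\<lambda>x. norm (u x - asymptotic_profile A x)) \<in> O[at_infinity](\<lambda>x. norm x powr (- 2 - \<epsilon>))))"
proof -
  define q where "q = 4 + \<epsilon>"
  have q: "4 < q" "q < 5" using assms by (auto simp: q_def)
  define \<kappa> where "\<kappa> = poisson_mass"
  have \<kappa>: "\<kappa> > 0" unfolding \<kappa>_def by (rule poisson_mass_pos)
  \<comment> \<open>Dividing by the factor \<open>8 * poisson_mass\<close> of
    \<open>stokes_weak\<close> makes \<open>s\<close> times \<open>vel F\<close> the velocity for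
    the force \<open>F\<close>; the convection term then carries \<open>s * s\<close>.\<close>
  define s where "s = 1 / (8 * \<kappa>)"
  have s: "s > 0" using \<kappa> by (simp add: s_def)
  obtain \<nu> where \<nu>: "\<nu> > 0" "\<And>k. decaying q \<nu> k \<Longrightarrow>
    \<exists>f M. decaying q M f \<and> (\<forall>x. f x = k x + (s * s) *\<^sub>R vel' (sharp f) x (vel (sharp f) x))"
    by (rule fixed_point[OF q, of "s * s"]) (use s in simp, blast)
  obtain S where S: "\<And>f M. decaying q M f \<Longrightarrow> decaying q (S * M) (sharp f)" by (rule sharp_decaying[OF q]) blast
  show ?thesis
  proof (intro exI[of _ \<nu>] conjI allI impI \<nu>(1))
    fix k :: "real^2 \<Rightarrow> real^2"
    assume "k \<in> B_space 0 (4 + \<epsilon>) \<and> B_norm 0 (4 + \<epsilon>) k \<le> \<nu> \<and> (LINT x|lborel. k x) = 0"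
    then have k: "decaying q \<nu> (\<lambda>x. cx (k x))" and k0: "(\<integral>x. k x \<partial>lborel) = 0"
      using decaying_of_B_space[of q k \<nu>] q by (auto simp: q_def)
    obtain f M where f: "decaying q M f"
      and fp_eq: "\<And>x. f x = cx (k x) + (s * s) *\<^sub>R vel' (sharp f) x (vel (sharp f) x)"
      using \<nu>(2)[OF k] by blast
    define F where "F = sharp f"
    have F: "decaying q (S * M) F" unfolding F_def by (rule S[OF f])
    have bal: "balanced F" unfolding F_def by (rule sharp_balanced[OF q(1) f])
    define N where "N x = (s * s) *\<^sub>R vel' F x (vel F x)" for x
    \<comment> \<open>Both \<open>k\<close> and the convection term have mean zero. Hence the mean
      corrector in \<open>sharp\<close> drops out, and only the three admissible Gaussian fields
      remain.\<close>
    have f0: "(\<integral>x. f x \<partial>lborel) = 0"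
    proof -
      have ik: "integrable lborel (\<lambda>x. cx (k x))" by (rule moment_integrals(1)[OF q(1) k])
      have "integrable lborel (\<lambda>x. uncx (cx (k x)))" by (rule integrable_bounded_linear[OF bounded_linear_uncx ik])
      then have "(\<integral>x. cx (k x) \<partial>lborel) = cx (\<integral>x. k x \<partial>lborel)"
        by (intro integral_bounded_linear[OF bounded_linear_cx]) simp
      moreover have "integrable lborel (\<lambda>x. f x - cx (k x))"
        using moment_integrals(1)[OF q(1) f] ik by (rule Bochner_Integration.integrable_diff)
      moreover have "f x - cx (k x) = N x" for x unfolding N_def F_def using fp_eq[of x] by simp
      ultimately have "(\<integral>x. f x \<partial>lborel) = (\<integral>x. N x \<partial>lborel)"
        using Bochner_Integration.integral_diff[OF moment_integrals(1)[OF q(1) f] ik] k0 by simp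
      also have "\<dots> = 0" unfolding N_def F_def using convection_mean_zero[OF q f] by simp
      finally show ?thesis .
    qed
    \<comment> \<open>The minus sign is that of \<open>sharp\<close>, and \<open>pi\<close> cancels
      the \<open>1 / pi\<close> in \<open>corrected_force\<close>.\<close>
    define \<alpha> where "\<alpha> = - (pi / gauss_mass) *\<^sub>R (\<integral>y. cx y * f y \<partial>lborel)"
    define \<beta> where "\<beta> = - (pi / gauss_mass) * Im (\<integral>y. cnj (cx y) * f y \<partial>lborel)"
    define a :: "real^3" where "a = vector [Re \<alpha>, Im \<alpha>, \<beta>]"
    have force: "F x = cx (corrected_force k a x) + N x" for x
    proof -
      have "(gauss x / pi) *\<^sub>R (\<alpha> * cnj (cx x) + \<i> * of_real \<beta> * cx x)
        = - (((\<integral>y. cx y * f y \<partial>lborel) * cnj (cx x) + \<i> * of_real (Im (\<integral>y. cnj (cx y) * f y \<partial>lborel)) * cx x) / of_real gauss_mass * of_real (gauss x))"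
        unfolding \<alpha>_def \<beta>_def using gauss_mass_pos
        by (simp add: scaleR_conv_of_real field_simps)
      moreover have "F x = f x - ((\<integral>y. cx y * f y \<partial>lborel) * cnj (cx x)
          + \<i> * of_real (Im (\<integral>y. cnj (cx y) * f y \<partial>lborel)) * cx x) / of_real gauss_mass * of_real (gauss x)"
        by (simp add: F_def sharp_def f0)
      moreover have "f x = cx (k x) + N x" using fp_eq[of x] by (simp add: N_def F_def)
      ultimately show ?thesis
        unfolding cx_corrected_force by (simp add: a_def vector_3)
    qed
    define u where "u x = uncx (s *\<^sub>R vel F x)" for x
    \<comment> \<open>After scaling by \<open>s\<close>, \<open>stokes_weak\<close> leaves
      \<open>- 8 * s\<close> times \<open>Re H * dbar \<phi>\<close>, while the pressure is tested
      against \<open>2 * dbar \<phi>\<close>; this gives the factor \<open>- 4 * s\<close>.\<close>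
    define p where "p x = - (4 * s) * Re (cauchy F x)" for x
    note dV = vel_has_derivative[OF q F]
    have du: "(u has_derivative (\<lambda>h. uncx (s *\<^sub>R vel' F x (cx h)))) (at x)" for x
      unfolding u_def by (intro bounded_linear.has_derivative[OF bounded_linear_uncx] has_derivative_scaleR_right dV)
    have pu: "partial_deriv i u x = uncx (s *\<^sub>R vel' F x (cx (axis i 1)))" for i x
      by (rule partial_deriv_eq[OF du])
    have C1: "Ck 1 u"
    proof -
      have "u differentiable_on UNIV"
        unfolding differentiable_on_def differentiable_def using du by (metis has_derivative_at_withinI)
      moreover have "continuous_on UNIV (partial_deriv i u)" for i
        unfolding pu[abs_def] by (intro bounded_linear.continuous_on[OF bounded_linear_uncx] continuous_intros continuous_vel'[OF q F])
      ultimately show ?thesis by simp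
    qed
    have C0: "Ck 0 p" unfolding p_def by (simp, intro continuous_intros continuous_cauchy[OF q F])
    have ax: "cx (axis 1 1) = 1" "cx (axis 2 1) = \<i>" by (simp_all add: complex_eq_iff axis_def)
    have conv: "cx (convection u x) = N x" for x
    proof -
      have "cx (convection u x) = (s * Re (vel F x)) *\<^sub>R (s *\<^sub>R vel' F x 1) + (s * Im (vel F x)) *\<^sub>R (s *\<^sub>R vel' F x \<i>)"
        by (simp add: convection_def sum_2 pu ax u_def)
      also have "\<dots> = N x"
        unfolding N_def bounded_linear_vel'_expand[OF bounded_linear_vel'[OF q F], of x "vel F x"]
        by (simp add: scaleR_add_right mult_ac)
      finally show ?thesis .
    qed
    have NS: "stationary_NS u p (corrected_force k a)"
    proof (rule stationary_NS_complex)
      fix \<phi> :: "real^2 \<Rightarrow> real" assume t: "tfun \<phi>"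
      obtain R where R: "\<And>x. R < norm x \<Longrightarrow> \<phi> x = 0" using t by (auto simp: tfun_def)
      obtain R' where R': "\<And>x. R' < norm x \<Longrightarrow> dbar \<phi> x = 0" using dbar_tfun(2)[OF t] by blast
      have ci: "integrable lborel g" if "continuous_on UNIV g" "\<And>x. r < norm x \<Longrightarrow> g x = 0" for g :: "real^2 \<Rightarrow> complex" and r
      proof -
        have "q > 0" using q by simp
        from compact_support_decaying[OF that this] obtain M' where "decaying q M' g" by blast
        then show ?thesis by (rule moment_integrals(1)[OF q(1)])
      qed
      have cN: "continuous_on UNIV N"
        unfolding N_def by (intro continuous_intros continuous_convection[OF q F])
      have cF: "continuous_on UNIV F" using F by (simp add: decaying_def)
      have iN: "integrable lborel (\<lambda>x. \<phi> x *\<^sub>R N x)"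
        by (rule ci[of _ R]) (auto intro!: continuous_intros tfun_continuous[OF t] cN simp: R)
      have iF: "integrable lborel (\<lambda>x. \<phi> x *\<^sub>R F x)"
        by (rule ci[of _ R]) (auto intro!: continuous_intros tfun_continuous[OF t] cF simp: R)
      have iH: "integrable lborel (\<lambda>x. of_real (Re (cauchy F x)) * dbar \<phi> x)"
        by (rule ci[of _ R']) (auto intro!: continuous_intros dbar_tfun(1)[OF t] continuous_cauchy[OF q F] simp: R')
      note iU = stokes_weak(2)[OF q F t]
      note ibp = integral_by_parts[OF t dV continuous_vel'[OF q F]]
      let ?I1 = "s *\<^sub>R (\<integral>x. partial_deriv 1 (partial_deriv 1 \<phi>) x *\<^sub>R vel F x \<partial>lborel)"
      let ?I2 = "s *\<^sub>R (\<integral>x. partial_deriv 2 (partial_deriv 2 \<phi>) x *\<^sub>R vel F x \<partial>lborel)"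
      let ?P = "(- (8 * s)) *\<^sub>R (\<integral>x. of_real (Re (cauchy F x)) * dbar \<phi> x \<partial>lborel)"
      let ?N = "\<integral>x. \<phi> x *\<^sub>R N x \<partial>lborel" and ?F = "\<integral>x. \<phi> x *\<^sub>R F x \<partial>lborel"
      let ?J = "\<lambda>i. s *\<^sub>R (\<integral>x. partial_deriv i \<phi> x *\<^sub>R vel F x \<partial>lborel)"
      have scl: "has_bochner_integral lborel (\<lambda>x. c x *\<^sub>R cx (u x)) (s *\<^sub>R (\<integral>x. c x *\<^sub>R vel F x \<partial>lborel))"
        if "integrable lborel (\<lambda>x. c x *\<^sub>R vel F x)" for c
        using has_bochner_integral_scaleR_right[OF has_bochner_integral_integrable[OF that], of s]
        by (simp add: u_def mult.commute)
      have 1: "has_bochner_integral lborel (\<lambda>x. partial_deriv 1 (partial_deriv 1 \<phi>) x *\<^sub>R cx (u x)) ?I1"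
        "has_bochner_integral lborel (\<lambda>x. partial_deriv 2 (partial_deriv 2 \<phi>) x *\<^sub>R cx (u x)) ?I2"
        by (rule scl[OF iU])+
      have 2: "has_bochner_integral lborel (\<lambda>x. p x *\<^sub>R (2 * dbar \<phi> x)) ?P"
      proof -
        have "(\<lambda>x. p x *\<^sub>R (2 * dbar \<phi> x)) = (\<lambda>x. (- (8 * s)) *\<^sub>R (of_real (Re (cauchy F x)) * dbar \<phi> x))"
          by (simp add: fun_eq_iff p_def scaleR_conv_of_real)
        then show ?thesis using has_bochner_integral_scaleR_right[OF has_bochner_integral_integrable[OF iH], of "- (8 * s)"] by simp
      qed
      have 3: "has_bochner_integral lborel (\<lambda>x. \<phi> x *\<^sub>R cx (convection u x)) ?N"
        unfolding conv by (rule has_bochner_integral_integrable[OF iN])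
      have 4: "has_bochner_integral lborel (\<lambda>x. \<phi> x *\<^sub>R cx (corrected_force k a x)) (?F - ?N)"
      proof -
        have "cx (corrected_force k a x) = F x - N x" for x using force[of x] by simp
        then have "(\<lambda>x. \<phi> x *\<^sub>R cx (corrected_force k a x)) = (\<lambda>x. \<phi> x *\<^sub>R F x - \<phi> x *\<^sub>R N x)" by (simp add: scaleR_diff_right)
        then show ?thesis by (simp add: has_bochner_integral_diff has_bochner_integral_integrable iF iN)
      qed
      have 5: "?I1 + ?I2 + ?P - ?N = ?F - ?N"
      proof -
        have "(\<integral>x. (partial_deriv 1 (partial_deriv 1 \<phi>) x + partial_deriv 2 (partial_deriv 2 \<phi>) x) *\<^sub>R vel F x \<partial>lborel)
          = (\<integral>x. partial_deriv 1 (partial_deriv 1 \<phi>) x *\<^sub>R vel F x \<partial>lborel) + (\<integral>x. partial_deriv 2 (partial_deriv 2 \<phi>) x *\<^sub>R vel F x \<partial>lborel)"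
          unfolding scaleR_left_distrib by (rule Bochner_Integration.integral_add[OF iU iU])
        note weak = stokes_weak(1)[OF q F t, unfolded this]
        have g: "s *\<^sub>R X + s *\<^sub>R Y + (- (8 * s)) *\<^sub>R H = s *\<^sub>R (X + Y - 8 * H)" for X Y H :: complex
          by (simp add: scaleR_conv_of_real algebra_simps)
        have "?I1 + ?I2 + ?P = s *\<^sub>R (8 * poisson_mass *\<^sub>R ?F)"
          unfolding g weak ..
        also have "\<dots> = ?F" using \<kappa> by (simp add: s_def \<kappa>_def scaleR_conv_of_real)
        finally show ?thesis by simp
      qed
      have 6: "has_bochner_integral lborel (\<lambda>x. partial_deriv i \<phi> x *\<^sub>R cx (u x)) (?J i)" for i
        by (rule scl[OF ibp(3)])
      \<comment> \<open>The divergence vanishes pointwise by \<open>vel_divergence\<close>; one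
        integration by parts gives the weak form.\<close>
      have 7: "Re (?J 1) + Im (?J 2) = 0"
      proof -
        have h: "has_bochner_integral lborel (\<lambda>x. \<phi> x *\<^sub>R vel' F x (cx (axis i 1))) (- (\<integral>x. partial_deriv i \<phi> x *\<^sub>R vel F x \<partial>lborel))" for i
          using ibp(1,2)[of i] by (simp add: has_bochner_integral_iff)
        from has_bochner_integral_add[OF has_bochner_integral_bounded_linear[OF bounded_linear_Re h[of 1]] has_bochner_integral_bounded_linear[OF bounded_linear_Im h[of 2]]]
        have "has_bochner_integral lborel (\<lambda>x. \<phi> x * (Re (vel' F x 1) + Im (vel' F x \<i>)))
          (- Re (\<integral>x. partial_deriv 1 \<phi> x *\<^sub>R vel F x \<partial>lborel) - Im (\<integral>x. partial_deriv 2 \<phi> x *\<^sub>R vel F x \<partial>lborel))"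
          by (simp add: ax distrib_left)
        then have "Re (\<integral>x. partial_deriv 1 \<phi> x *\<^sub>R vel F x \<partial>lborel) + Im (\<integral>x. partial_deriv 2 \<phi> x *\<^sub>R vel F x \<partial>lborel) = 0"
          unfolding vel_divergence[OF q F] by (simp add: has_bochner_integral_iff)
        then show ?thesis by (simp flip: distrib_left)
      qed
      show "has_bochner_integral lborel (\<lambda>x. partial_deriv 1 (partial_deriv 1 \<phi>) x *\<^sub>R cx (u x)) ?I1
        \<and> has_bochner_integral lborel (\<lambda>x. partial_deriv 2 (partial_deriv 2 \<phi>) x *\<^sub>R cx (u x)) ?I2
        \<and> has_bochner_integral lborel (\<lambda>x. p x *\<^sub>R (2 * dbar \<phi> x)) ?P
        \<and> has_bochner_integral lborel (\<lambda>x. \<phi> x *\<^sub>R cx (convection u x)) ?N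
        \<and> has_bochner_integral lborel (\<lambda>x. \<phi> x *\<^sub>R cx (corrected_force k a x)) (?F - ?N)
        \<and> ?I1 + ?I2 + ?P - ?N = ?F - ?N
        \<and> has_bochner_integral lborel (\<lambda>x. partial_deriv 1 \<phi> x *\<^sub>R cx (u x)) (?J 1)
        \<and> has_bochner_integral lborel (\<lambda>x. partial_deriv 2 \<phi> x *\<^sub>R cx (u x)) (?J 2)
        \<and> Re (?J 1) + Im (?J 2) = 0"
        using 1 2 3 4 5 6 7 by blast
    qed
    obtain C where C: "C > 0" "\<And>f M x. \<lbrakk>decaying q M f; balanced f; x \<noteq> 0\<rbrakk> \<Longrightarrow> cmod (vel f x) \<le> C * M * norm x powr (-(q-1)/2)"
      "\<And>f M x. \<lbrakk>decaying q M f; balanced f; x \<noteq> 0\<rbrakk> \<Longrightarrow> cmod (vel f x - far_profile f (cx x)) \<le> C * M * norm x powr (2-q)"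
      by (rule vel_decay[OF q]) blast
    have nz: "eventually (\<lambda>x::real^2. x \<noteq> 0) at_infinity"
      unfolding eventually_at_infinity by (intro exI[of _ 1]) auto
    have lim: "(u \<longlongrightarrow> 0) at_infinity"
    proof (rule Lim_null_comparison)
      show "eventually (\<lambda>x. norm (u x) \<le> s * (C * (S * M)) * norm x powr (-(q-1)/2)) at_infinity"
        using nz
      proof eventually_elim
        case (elim x)
        have "s * cmod (vel F x) \<le> s * (C * (S * M) * norm x powr (-(q-1)/2))"
          using s by (intro mult_left_mono C(2)[OF F bal elim]) auto
        then show ?case using s by (simp add: u_def)
      qed
      have "((\<lambda>x::real^2. norm x powr (-(q-1)/2)) \<longlongrightarrow> 0) at_infinity"
        using q by (intro tendsto_neg_powr filterlim_norm_at_top) auto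
      from tendsto_mult_right_zero[OF this]
      show "((\<lambda>x::real^2. s * (C * (S * M)) * norm x powr (-(q-1)/2)) \<longlongrightarrow> 0) at_infinity" .
    qed
    define c where "c = (\<integral>y. (cx y)\<^sup>2 * F y \<partial>lborel)"
    define B where "B = - (\<integral>y. (cnj (cx y))\<^sup>2 * F y \<partial>lborel) / 2 + cnj (\<integral>y. (cx y * cnj (cx y)) * F y \<partial>lborel)"
    have fp: "far_profile F z = - c / (2 * z\<^sup>2) + B / (cnj z)\<^sup>2 - z * cnj c / (cnj z) ^ 3" for z
      by (simp add: far_profile_def c_def B_def add_divide_distrib diff_divide_distrib)
    obtain A :: "real^4" where A: "\<And>z. (1 / (4 * pi)) *\<^sub>R (Complex (A$1 + A$3 / 2) (- A$2 - A$4 / 2) / (cnj z)\<^sup>2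
      + Complex (A$3) (A$4) / (2 * z\<^sup>2) + Complex (A$3) (- A$4) * z / (cnj z) ^ 3) = s *\<^sub>R far_profile F z"
      using matching_coefficients[OF \<kappa>, of c B] unfolding fp s_def by blast
    have asy: "(\<lambda>x. norm (u x - asymptotic_profile A x)) \<in> O[at_infinity](\<lambda>x. norm x powr (- 2 - \<epsilon>))"
    proof (rule bigoI[where c="s * (C * (S * M))"])
      show "eventually (\<lambda>x. norm (norm (u x - asymptotic_profile A x)) \<le> s * (C * (S * M)) * norm (norm x powr (- 2 - \<epsilon>))) at_infinity"
        using nz
      proof eventually_elim
        case (elim x)
        have "norm (u x - asymptotic_profile A x) = cmod (cx (u x) - cx (asymptotic_profile A x))"
          by (simp only: cx_simps(3) cx_simps(5)[symmetric])
        also have "cx (u x) - cx (asymptotic_profile A x) = s *\<^sub>R (vel F x - far_profile F (cx x))"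
          unfolding cx_asymptotic_profile[OF elim] A by (simp add: u_def scaleR_diff_right)
        also have "cmod \<dots> = s * cmod (vel F x - far_profile F (cx x))" using s by simp
        also have "\<dots> \<le> s * (C * (S * M) * norm x powr (2-q))"
          using s by (intro mult_left_mono C(3)[OF F bal elim]) auto
        finally show ?case by (simp add: q_def)
      qed
    qed
    show "\<exists>a :: real^3. \<exists>(u :: real^2 \<Rightarrow> real^2) (p :: real^2 \<Rightarrow> real).
       Ck 1 u \<and> Ck 0 p \<and> stationary_NS u p (corrected_force k a) \<and> (u \<longlongrightarrow> 0) at_infinity \<and>
       (\<exists>A :: real^4. (\<lambda>x. norm (u x - asymptotic_profile A x)) \<in> O[at_infinity](\<lambda>x. norm x powr (- 2 - \<epsilon>)))"
      using C1 C0 NS lim asy by blast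
  qed
qed

end
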